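(* Let $\Bbbk$ be a field of characteristic zero and let $\mathsf{Gr}$ be the (linearized) species of graphs with its cosymmetric $\mathsf{E}$-bicomodule structure given by restriction of graphs. Then for each integer $p\ge0$, $\dim_\Bbbk H^p(\mathsf{Gr})$ equals the number of isomorphism classes of graphs on $p$ vertices with no odd automorphisms; for $p=0,1,2,\ldots$ these numbers are $$1,\ 1,\ 0,\ 0,\ 1,\ 6,\ 28,\ 252,\ 4726,\ 150324,\ \ldots$$
   Context: A (linear) species is a functor from finite sets and bijections to $\Bbbk$-modules. A decomposition of $I$ is a tuple of disjoint, possibly empty, subsets with union $I$. The Cauchy product is $(\mathsf{X}\cdot\mathsf{Y})[I]=\bigoplus_{(S,T)}\mathsf{X}[S]\otimes\mathsf{Y}[T]$ over decompositions. $\mathsf{E}[I]=\Bbbk e_I$ is the exponential species, with coproduct $e_I\mapsto e_S\otimes e_T$. $\mathsf{Gr}[I]$ is free on the set of (simple, undirected) graphs with vertex set $I$; for $S\subseteq I$ the restriction $g|_S$ is the induced subgraph on $S$, and the coactions are $\lambda(g)=\sum e_S\otimes g|_T$, $\rho(g)=\sum g|_S\otimes e_T$. An automorphism of a graph is odd if it is an odd permutation of the vertices. $H^*(\mathsf{X})$ is the cohomology of $C^n(\mathsf{X})=\operatorname{Hom}(\mathsf{X},\mathsf{E}^{\cdot n})$; cochains are given by coefficients $\alpha(F_1,\ldots,F_n)(z)\in\Bbbk$ for $(F_1,\ldots,F_n)$ a decomposition of $I$ and $z\in\mathsf{X}[I]$, and $\delta=\sum_{i=0}^{n+1}(-1)^id^i$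 with $(d^0\alpha)(F_0,\ldots,F_n)(z)=\alpha(F_1,\ldots,F_n)(z|_{F_0^c})$, $(d^i\alpha)(F_0,\ldots,F_n)(z)=\alpha(F_0,\ldots,F_{i-1}\cup F_i,\ldots,F_n)(z)$ for $0<i<n+1$, $(d^{n+1}\alpha)(F_0,\ldots,F_n)(z)=\alpha(F_0,\ldots,F_{n-1})(z|_{F_n^c})$. *)

theory Defs
  imports
    "Jordan_Normal_Form.VS_Connect"
    "HOL-Combinatorics.Permutations"
    "HOL-Algebra.AbelCoset"
    "HOL-Library.Infinite_Typeclass"
begin

hide_const (open) Modules.module Modules.module_hom
hide_fact (open) Modules.module_hom_def

text \<open>Vector spaces are modules in the sense of HOL-Algebra over \<open>class_ring\<close>, the type
  \<open>'k\<close> viewed as a ring record. In all records of modules the ring components \<open>mult\<close> and \<open>one\<close>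
  carry no meaning.\<close>

section \<open>Free modules and linearization\<close>

definition free_mod :: "'b set \<Rightarrow> ('k::field, 'b \<Rightarrow> 'k) module" where
  "free_mod B =
    \<lparr>carrier = {f. finite {b. f b \<noteq> 0} \<and> {b. f b \<noteq> 0} \<subseteq> B},
     mult = undefined, one = undefined,
     zero = (\<lambda>b. 0),
     add = (\<lambda>f g b. f b + g b),
     smult = (\<lambda>a f b. a * f b)\<rparr>"

text \<open>The linear extension of a map \<open>\<phi>\<close> of bases, sending \<open>\<Sum> f b \<cdot> b\<close> to \<open>\<Sum> f b \<cdot> \<phi> b\<close>.\<close>

definition lin :: "('b \<Rightarrow> 'c) \<Rightarrow> ('b \<Rightarrow> 'k::field) \<Rightarrow> 'c \<Rightarrow> 'k" where
  "lin \<phi> f = (\<lambda>c. \<Sum>b | f b \<noteq> 0 \<and> \<phi> b = c. f b)"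

section \<open>Linear species\<close>

text \<open>The finite sets are the finite subsets of an infinite type \<open>'a\<close>. A bijection
  \<open>I \<rightarrow> J\<close> is a function \<open>\<sigma>\<close> that is injective on \<open>I\<close>, with \<open>J = \<sigma> ` I\<close>; its values off \<open>I\<close>
  are irrelevant (axiom \<open>map_cong\<close>).\<close>

record ('a, 'k, 'v) species =
  obj :: "'a set \<Rightarrow> ('k, 'v) module"
  tr :: "'a set \<Rightarrow> ('a \<Rightarrow> 'a) \<Rightarrow> 'v \<Rightarrow> 'v"

locale linear_species =
  fixes X :: "('a::infinite, 'k::field, 'v, 'x) species_scheme"
  assumes obj_vectorspace: "finite I \<Longrightarrow> vectorspace class_ring (obj X I)"
    and tr_hom: "finite I \<Longrightarrow> inj_on \<sigma> I \<Longrightarrow>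
      tr X I \<sigma> \<in> module_hom class_ring (obj X I) (obj X (\<sigma> ` I))"
    and tr_cong: "finite I \<Longrightarrow> inj_on \<sigma> I \<Longrightarrow> z \<in> carrier (obj X I) \<Longrightarrow>
      (\<And>x. x \<in> I \<Longrightarrow> \<sigma> x = \<tau> x) \<Longrightarrow> tr X I \<sigma> z = tr X I \<tau> z"
    and tr_id: "finite I \<Longrightarrow> z \<in> carrier (obj X I) \<Longrightarrow> tr X I id z = z"
    and tr_comp: "finite I \<Longrightarrow> inj_on \<sigma> I \<Longrightarrow> inj_on \<tau> (\<sigma> ` I) \<Longrightarrow> z \<in> carrier (obj X I) \<Longrightarrow>
      tr X I (\<tau> \<circ> \<sigma>) z = tr X (\<sigma> ` I) \<tau> (tr X I \<sigma> z)"

text \<open>Morphisms of species, extended by zero outside their domain, and the vector space they form.\<close>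

definition species_hom ::
  "('a, 'k::field, 'v, 'x) species_scheme \<Rightarrow> ('a, 'k, 'w, 'y) species_scheme \<Rightarrow>
    ('a set \<Rightarrow> 'v \<Rightarrow> 'w) set" where
  "species_hom X Y = {\<alpha>.
    (\<forall>I. finite I \<longrightarrow> \<alpha> I \<in> module_hom class_ring (obj X I) (obj Y I)) \<and>
    (\<forall>I \<sigma> z. finite I \<longrightarrow> inj_on \<sigma> I \<longrightarrow> z \<in> carrier (obj X I) \<longrightarrow>
       \<alpha> (\<sigma> ` I) (tr X I \<sigma> z) = tr Y I \<sigma> (\<alpha> I z)) \<and>
    (\<forall>I z. \<not> (finite I \<and> z \<in> carrier (obj X I)) \<longrightarrow> \<alpha> I z = \<zero>\<^bsub>obj Y I\<^esub>)}"

definition hom_mod ::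
  "('a, 'k::field, 'v, 'x) species_scheme \<Rightarrow> ('a, 'k, 'w, 'y) species_scheme \<Rightarrow>
    ('k, 'a set \<Rightarrow> 'v \<Rightarrow> 'w) module" where
  "hom_mod X Y =
    \<lparr>carrier = species_hom X Y,
     mult = undefined, one = undefined,
     zero = (\<lambda>I z. \<zero>\<^bsub>obj Y I\<^esub>),
     add = (\<lambda>\<alpha> \<beta> I z. \<alpha> I z \<oplus>\<^bsub>obj Y I\<^esub> \<beta> I z),
     smult = (\<lambda>a \<alpha> I z. a \<odot>\<^bsub>obj Y I\<^esub> \<alpha> I z)\<rparr>"

definition decomps :: "nat \<Rightarrow> 'a set \<Rightarrow> 'a set list set" where
  "decomps n I = {F. length F = n \<and> \<Union>(set F) = I \<and>
    (\<forall>i<n. \<forall>j<n. i \<noteq> j \<longrightarrow> F ! i \<inter> F ! j = {})}"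

text \<open>The Cauchy power \<open>E\<^sup>n\<close> of the exponential species. The summand of \<open>E\<^sup>n[I]\<close> at a
  decomposition \<open>F\<close> is the line \<open>E[F\<^sub>1] \<otimes> \<dots> \<otimes> E[F\<^sub>n]\<close>, spanned by
  \<open>e\<^bsub>F\<^sub>1\<^esub> \<otimes> \<dots> \<otimes> e\<^bsub>F\<^sub>n\<^esub>\<close>; so \<open>E\<^sup>n[I]\<close> is free on the decompositions of \<open>I\<close>. For \<open>n = 0\<close> this
  is the unit species, concentrated on the empty set.\<close>

definition E_power :: "nat \<Rightarrow> ('a, 'k::field, 'a set list \<Rightarrow> 'k) species" where
  "E_power n = \<lparr>obj = (\<lambda>I. free_mod (decomps n I)), tr = (\<lambda>I \<sigma>. lin (map ((`) \<sigma>)))\<rparr>"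

section \<open>Bicomodules over the exponential species\<close>

text \<open>Since \<open>E[S]\<close> is the line spanned by \<open>e\<^sub>S\<close>, the component \<open>X[S \<union> T] \<rightarrow> E[S] \<otimes> X[T]\<close> of a left
  coaction at a decomposition \<open>(S, T)\<close> has the form \<open>z \<mapsto> e\<^sub>S \<otimes> lres X S T z\<close>. Likewise the
  component \<open>X[S \<union> T] \<rightarrow> X[S] \<otimes> E[T]\<close> of a right coaction is \<open>z \<mapsto> rres X S T z \<otimes> e\<^sub>T\<close>.\<close>

record ('a, 'k, 'v) bicomodule = "('a, 'k, 'v) species" +
  lres :: "'a set \<Rightarrow> 'a set \<Rightarrow> 'v \<Rightarrow> 'v"
  rres :: "'a set \<Rightarrow> 'a set \<Rightarrow> 'v \<Rightarrow> 'v"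

locale E_bicomodule = linear_species X
  for X :: "('a::infinite, 'k::field, 'v, 'x) bicomodule_scheme" +
  assumes lres_hom: "finite S \<Longrightarrow> finite T \<Longrightarrow> S \<inter> T = {} \<Longrightarrow>
      lres X S T \<in> module_hom class_ring (obj X (S \<union> T)) (obj X T)"
    and rres_hom: "finite S \<Longrightarrow> finite T \<Longrightarrow> S \<inter> T = {} \<Longrightarrow>
      rres X S T \<in> module_hom class_ring (obj X (S \<union> T)) (obj X S)"
    and lres_natural: "finite S \<Longrightarrow> finite T \<Longrightarrow> S \<inter> T = {} \<Longrightarrow> inj_on \<sigma> (S \<union> T) \<Longrightarrow>
      z \<in> carrier (obj X (S \<union> T)) \<Longrightarrow>
      lres X (\<sigma> ` S) (\<sigma> ` T) (tr X (S \<union> T) \<sigma> z) = tr X T \<sigma> (lres X S T z)"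
    and rres_natural: "finite S \<Longrightarrow> finite T \<Longrightarrow> S \<inter> T = {} \<Longrightarrow> inj_on \<sigma> (S \<union> T) \<Longrightarrow>
      z \<in> carrier (obj X (S \<union> T)) \<Longrightarrow>
      rres X (\<sigma> ` S) (\<sigma> ` T) (tr X (S \<union> T) \<sigma> z) = tr X S \<sigma> (rres X S T z)"
    and lres_counit: "finite I \<Longrightarrow> z \<in> carrier (obj X I) \<Longrightarrow> lres X {} I z = z"
    and rres_counit: "finite I \<Longrightarrow> z \<in> carrier (obj X I) \<Longrightarrow> rres X I {} z = z"
    and lres_coassoc: "finite R \<Longrightarrow> finite S \<Longrightarrow> finite T \<Longrightarrow>
      R \<inter> S = {} \<Longrightarrow> R \<inter> T = {} \<Longrightarrow> S \<inter> T = {} \<Longrightarrow> z \<in> carrier (obj X (R \<union> S \<union> T)) \<Longrightarrow>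
      lres X (R \<union> S) T z = lres X S T (lres X R (S \<union> T) z)"
    and rres_coassoc: "finite R \<Longrightarrow> finite S \<Longrightarrow> finite T \<Longrightarrow>
      R \<inter> S = {} \<Longrightarrow> R \<inter> T = {} \<Longrightarrow> S \<inter> T = {} \<Longrightarrow> z \<in> carrier (obj X (R \<union> S \<union> T)) \<Longrightarrow>
      rres X R (S \<union> T) z = rres X R S (rres X (R \<union> S) T z)"
    and lres_rres: "finite R \<Longrightarrow> finite S \<Longrightarrow> finite T \<Longrightarrow>
      R \<inter> S = {} \<Longrightarrow> R \<inter> T = {} \<Longrightarrow> S \<inter> T = {} \<Longrightarrow> z \<in> carrier (obj X (R \<union> S \<union> T)) \<Longrightarrow>
      lres X R S (rres X (R \<union> S) T z) = rres X S T (lres X R (S \<union> T) z)"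

locale cosymmetric_E_bicomodule = E_bicomodule +
  assumes cosymmetric: "finite S \<Longrightarrow> finite T \<Longrightarrow> S \<inter> T = {} \<Longrightarrow> z \<in> carrier (obj X (S \<union> T)) \<Longrightarrow>
      lres X S T z = rres X T S z"

section \<open>Cohomology\<close>

text \<open>For a cochain \<open>\<alpha>\<close>, the coefficient \<open>\<alpha>(F\<^sub>1, \<dots>, F\<^sub>n)(z)\<close>, for \<open>z \<in> X[I]\<close> and \<open>F\<close> a decomposition
  of \<open>I\<close>, is \<open>\<alpha> I z F\<close>.\<close>

type_synonym ('a, 'k, 'v) cochain = "'a set \<Rightarrow> 'v \<Rightarrow> 'a set list \<Rightarrow> 'k"

definition cochains ::
  "('a, 'k::field, 'v, 'x) species_scheme \<Rightarrow> nat \<Rightarrow> ('k, ('a, 'k, 'v) cochain) module" where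
  "cochains X n = hom_mod X (E_power n)"

definition coface ::
  "('a, 'k::field, 'v, 'x) bicomodule_scheme \<Rightarrow> nat \<Rightarrow> nat \<Rightarrow>
    ('a, 'k, 'v) cochain \<Rightarrow> ('a, 'k, 'v) cochain" where
  "coface X n i \<alpha> I z F =
    (if i = 0 then \<alpha> (I - hd F) (lres X (hd F) (I - hd F) z) (tl F)
     else if i \<le> n then \<alpha> I z (take (i - 1) F @ (F ! (i - 1) \<union> F ! i) # drop (i + 1) F)
     else \<alpha> (I - last F) (rres X (I - last F) (last F) z) (butlast F))"

definition coboundary ::
  "('a, 'k::field, 'v, 'x) bicomodule_scheme \<Rightarrow> nat \<Rightarrow>
    ('a, 'k, 'v) cochain \<Rightarrow> ('a, 'k, 'v) cochain" where
  "coboundary X n \<alpha> I z F =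
    (if finite I \<and> z \<in> carrier (obj X I) \<and> F \<in> decomps (n + 1) I
     then \<Sum>i\<le>n + 1. (- 1) ^ i * coface X n i \<alpha> I z F else 0)"

definition cocycles ::
  "('a, 'k::field, 'v, 'x) bicomodule_scheme \<Rightarrow> nat \<Rightarrow> ('a, 'k, 'v) cochain set" where
  "cocycles X n =
    {\<alpha> \<in> carrier (cochains X n). coboundary X n \<alpha> = \<zero>\<^bsub>cochains X (n + 1)\<^esub>}"

fun coboundaries ::
  "('a, 'k::field, 'v, 'x) bicomodule_scheme \<Rightarrow> nat \<Rightarrow> ('a, 'k, 'v) cochain set" where
  "coboundaries X 0 = {\<zero>\<^bsub>cochains X 0\<^esub>}"
| "coboundaries X (Suc n) = coboundary X n ` carrier (cochains X n)"

definition quot_mod :: "('k::field, 'v) module \<Rightarrow> 'v set \<Rightarrow> ('k, 'v set) module" where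
  "quot_mod M B =
    \<lparr>carrier = a_rcosets\<^bsub>M\<^esub> B,
     mult = undefined, one = undefined,
     zero = B,
     add = set_add M,
     smult = (\<lambda>a C. \<Union>v\<in>C. B +>\<^bsub>M\<^esub> (a \<odot>\<^bsub>M\<^esub> v))\<rparr>"

definition cohomology ::
  "('a, 'k::field, 'v, 'x) bicomodule_scheme \<Rightarrow> nat \<Rightarrow> ('k, ('a, 'k, 'v) cochain set) module"
  where
  "cohomology X n = quot_mod ((cochains X n)\<lparr>carrier := cocycles X n\<rparr>) (coboundaries X n)"

section \<open>Graphs\<close>

text \<open>A graph is a pair of its vertex set and its set of edges; edges are two-element sets.\<close>

type_synonym 'a graph = "'a set \<times> 'a set set"

definition graphs :: "'a set \<Rightarrow> 'a graph set" where
  "graphs I = {(V, E). V = I \<and> (\<forall>e\<in>E. e \<subseteq> V \<and> card e = 2)}"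

definition relabel :: "('a \<Rightarrow> 'b) \<Rightarrow> 'a graph \<Rightarrow> 'b graph" where
  "relabel \<sigma> g = (\<sigma> ` fst g, (`) \<sigma> ` snd g)"

definition induced :: "'a graph \<Rightarrow> 'a set \<Rightarrow> 'a graph" where
  "induced g S = (fst g \<inter> S, {e \<in> snd g. e \<subseteq> S})"

definition Gr :: "('a, 'k::field, 'a graph \<Rightarrow> 'k) bicomodule" where
  "Gr = \<lparr>obj = (\<lambda>I. free_mod (graphs I)),
         tr = (\<lambda>I \<sigma>. lin (relabel \<sigma>)),
         lres = (\<lambda>S T. lin (\<lambda>g. induced g T)),
         rres = (\<lambda>S T. lin (\<lambda>g. induced g S))\<rparr>"

definition graph_iso :: "'a graph \<Rightarrow> 'a graph \<Rightarrow> bool" where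
  "graph_iso g h \<longleftrightarrow> (\<exists>\<sigma>. bij_betw \<sigma> (fst g) (fst h) \<and> relabel \<sigma> g = h)"

definition automorphism :: "('a \<Rightarrow> 'a) \<Rightarrow> 'a graph \<Rightarrow> bool" where
  "automorphism \<sigma> g \<longleftrightarrow> \<sigma> permutes (fst g) \<and> relabel \<sigma> g = g"

definition no_odd_aut_graphs :: "nat \<Rightarrow> 'a graph set" where
  "no_odd_aut_graphs p = {g. \<exists>I. finite I \<and> card I = p \<and> g \<in> graphs I \<and>
    (\<forall>\<sigma>. automorphism \<sigma> g \<longrightarrow> evenperm \<sigma>)}"

definition no_odd_aut_classes :: "nat \<Rightarrow> 'a graph set set" where
  "no_odd_aut_classes p = no_odd_aut_graphs p //
    {(g, h). g \<in> no_odd_aut_graphs p \<and> h \<in> no_odd_aut_graphs p \<and> graph_iso g h}"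

section \<open>The structure on graphs\<close>

lemma lin_sup:
  assumes "finite S" "{b. f b \<noteq> 0} \<subseteq> S"
  shows "lin \<phi> f c = (\<Sum>b\<in>S. if \<phi> b = c then f b else 0)"
proof -
  have "lin \<phi> f c = (\<Sum>b | b \<in> S \<and> \<phi> b = c. f b)"
    unfolding lin_def using assms by (intro sum.mono_neutral_left) auto
  also have "\<dots> = (\<Sum>b\<in>S. if \<phi> b = c then f b else 0)"
    using assms(1) by (simp add: sum.inter_filter)
  finally show ?thesis .
qed

lemma lin_supp: "{c. lin \<phi> f c \<noteq> 0} \<subseteq> \<phi> ` {b. f b \<noteq> 0}"
proof
  fix c assume "c \<in> {c. lin \<phi> f c \<noteq> 0}"
  then have "(\<Sum>b | f b \<noteq> 0 \<and> \<phi> b = c. f b) \<noteq> 0" unfolding lin_def by simp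
  then have "{b. f b \<noteq> 0 \<and> \<phi> b = c} \<noteq> {}" by (metis sum.empty)
  then show "c \<in> \<phi> ` {b. f b \<noteq> 0}" by auto
qed

lemma lin_cong:
  assumes "\<And>b. f b \<noteq> 0 \<Longrightarrow> \<phi> b = \<psi> b"
  shows "lin \<phi> f = lin \<psi> f"
  unfolding lin_def by (intro ext sum.cong) (use assms in auto)

lemma lin_ident:
  assumes "\<And>b. f b \<noteq> 0 \<Longrightarrow> \<phi> b = b"
  shows "lin \<phi> f = f"
proof
  fix c
  have "{b. f b \<noteq> 0 \<and> \<phi> b = c} = (if f c = 0 then {} else {c})" using assms by auto
  then show "lin \<phi> f c = f c" unfolding lin_def by simp
qed

lemma lin_comp:
  assumes fin: "finite {b. f b \<noteq> 0}"
  shows "lin \<psi> (lin \<phi> f) = lin (\<psi> \<circ> \<phi>) f"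
proof
  fix d
  let ?S = "{b. f b \<noteq> 0}"
  have "lin \<psi> (lin \<phi> f) d = (\<Sum>c\<in>\<phi> ` ?S. if \<psi> c = d then lin \<phi> f c else 0)"
    by (intro lin_sup lin_supp finite_imageI fin)
  also have "\<dots> = (\<Sum>c\<in>\<phi> ` ?S. \<Sum>b\<in>?S. if \<psi> c = d \<and> \<phi> b = c then f b else 0)"
    by (intro sum.cong refl) (auto simp: lin_sup[OF fin order_refl])
  also have "\<dots> = (\<Sum>b\<in>?S. \<Sum>c\<in>\<phi> ` ?S. if \<psi> c = d \<and> \<phi> b = c then f b else 0)"
    by (rule sum.swap)
  also have "\<dots> = (\<Sum>b\<in>?S. if (\<psi> \<circ> \<phi>) b = d then f b else 0)"
  proof (intro sum.cong refl)
    fix b assume b: "b \<in> ?S"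
    have "(\<Sum>c\<in>\<phi> ` ?S. if \<psi> c = d \<and> \<phi> b = c then f b else 0) =
          (\<Sum>c\<in>\<phi> ` ?S. if c = \<phi> b then (if \<psi> (\<phi> b) = d then f b else 0) else 0)"
      by (intro sum.cong refl) auto
    also have "\<dots> = (if (\<psi> \<circ> \<phi>) b = d then f b else 0)"
      using fin b by (subst sum.delta) auto
    finally show "(\<Sum>c\<in>\<phi> ` ?S. if \<psi> c = d \<and> \<phi> b = c then f b else 0) = \<dots>" .
  qed
  also have "\<dots> = lin (\<psi> \<circ> \<phi>) f d" by (simp add: lin_sup[OF fin order_refl])
  finally show "lin \<psi> (lin \<phi> f) d = lin (\<psi> \<circ> \<phi>) f d" .
qed

lemma lin_add:
  assumes "finite {b. f b \<noteq> 0}" "finite {b. g b \<noteq> 0}"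
  shows "lin \<phi> (\<lambda>b. f b + g b) = (\<lambda>c. lin \<phi> f c + lin \<phi> g c)"
proof
  fix c
  let ?S = "{b. f b \<noteq> 0} \<union> {b. g b \<noteq> 0}"
  have S: "finite ?S" using assms by simp
  have "lin \<phi> (\<lambda>b. f b + g b) c = (\<Sum>b\<in>?S. if \<phi> b = c then f b + g b else 0)"
    by (intro lin_sup S) auto
  also have "\<dots> = (\<Sum>b\<in>?S. if \<phi> b = c then f b else 0) + (\<Sum>b\<in>?S. if \<phi> b = c then g b else 0)"
    by (subst sum.distrib[symmetric]) (intro sum.cong, auto)
  also have "\<dots> = lin \<phi> f c + lin \<phi> g c"
    using S by (subst (1 2) lin_sup[of ?S]) auto
  finally show "lin \<phi> (\<lambda>b. f b + g b) c = lin \<phi> f c + lin \<phi> g c" .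
qed

lemma lin_scale: "lin \<phi> (\<lambda>b. a * f b) = (\<lambda>c. a * lin \<phi> f c)"
  by (cases "a = 0") (auto simp: lin_def sum_distrib_left)

lemma lin_hom:
  fixes \<phi> :: "'b \<Rightarrow> 'c"
  assumes "\<phi> ` A \<subseteq> B"
  shows "lin \<phi> \<in> module_hom class_ring (free_mod A :: ('k::field, _) module) (free_mod B)"
proof -
  have "finite {c. lin \<phi> f c \<noteq> 0} \<and> {c. lin \<phi> f c \<noteq> 0} \<subseteq> B"
    if "finite {b. f b \<noteq> 0}" "{b. f b \<noteq> 0} \<subseteq> A" for f :: "'b \<Rightarrow> 'k"
    using finite_subset[OF lin_supp[of \<phi> f] finite_imageI[OF that(1)]] lin_supp[of \<phi> f] that(2) assms
    by blast
  then show ?thesis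
    by (auto simp: module_hom_def free_mod_def lin_add lin_scale)
qed

lemma free_mod_vectorspace: "vectorspace class_ring (free_mod B :: ('k::field, 'b \<Rightarrow> 'k) module)"
proof -
  have sub: "finite {b. f b + g b \<noteq> 0} \<and> {b. f b + g b \<noteq> 0} \<subseteq> B"
    if "finite {b. f b \<noteq> 0}" "finite {b. g b \<noteq> 0}" "{b. f b \<noteq> 0} \<subseteq> B" "{b. g b \<noteq> 0} \<subseteq> B"
    for f g :: "'b \<Rightarrow> 'k"
  proof -
    have "{b. f b + g b \<noteq> 0} \<subseteq> {b. f b \<noteq> 0} \<union> {b. g b \<noteq> 0}" by auto
    then show ?thesis using that by (meson Un_least finite_UnI finite_subset subset_trans)
  qed
  have inv: "\<exists>g. finite {b. g b \<noteq> 0} \<and> {b. g b \<noteq> 0} \<subseteq> B \<and> (\<lambda>b. g b + f b) = (\<lambda>b. 0)"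
    if "finite {b. f b \<noteq> 0}" "{b. f b \<noteq> 0} \<subseteq> B" for f :: "'b \<Rightarrow> 'k"
    using that by (intro exI[of _ "\<lambda>b. - f b"]) auto
  have sm: "finite {b. a \<noteq> 0 \<and> f b \<noteq> 0}" if "finite {b. f b \<noteq> 0}" for f :: "'b \<Rightarrow> 'k" and a :: 'k
    using that by auto
  have grp: "abelian_group (free_mod B :: ('k, 'b \<Rightarrow> 'k) module)"
    by (rule abelian_groupI)
      (use sub inv in \<open>auto simp: free_mod_def add.assoc add.commute\<close>)
  have "module class_ring (free_mod B :: ('k, 'b \<Rightarrow> 'k) module)"
    by (rule moduleI[OF class_cring.is_cring grp])
      (use sm in \<open>auto simp: free_mod_def algebra_simps\<close>)
  then show ?thesis
    using class_field by (rule vectorspace.intro)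
qed

lemma free_mod_carrierD:
  "f \<in> carrier (free_mod B) \<Longrightarrow> finite {b. f b \<noteq> 0}"
  "f \<in> carrier (free_mod B) \<Longrightarrow> f b \<noteq> 0 \<Longrightarrow> b \<in> B"
  by (auto simp: free_mod_def)

lemma lin_cong_on:
  "f \<in> carrier (free_mod B) \<Longrightarrow> (\<And>b. b \<in> B \<Longrightarrow> \<phi> b = \<psi> b) \<Longrightarrow> lin \<phi> f = lin \<psi> f"
  by (metis lin_cong free_mod_carrierD(2))

lemma lin_comp_on:
  "f \<in> carrier (free_mod B) \<Longrightarrow> lin \<psi> (lin \<phi> f) = lin (\<psi> \<circ> \<phi>) f"
  by (rule lin_comp) (rule free_mod_carrierD(1))

lemma E_power_species: "linear_species (E_power n :: ('a::infinite, 'k::field, 'a set list \<Rightarrow> 'k) species)"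
proof (rule linear_species.intro)
  show "tr (E_power n) I \<sigma> \<in> module_hom class_ring (obj (E_power n) I) (obj (E_power n) (\<sigma> ` I))"
    if "finite I" "inj_on \<sigma> I" for I :: "'a set" and \<sigma>
  proof -
    have "map ((`) \<sigma>) F \<in> decomps n (\<sigma> ` I)" if F: "F \<in> decomps n I" for F
    proof -
      have len: "length F = n" and un: "\<Union>(set F) = I"
        and dj: "\<And>i j. i < n \<Longrightarrow> j < n \<Longrightarrow> i \<noteq> j \<Longrightarrow> F ! i \<inter> F ! j = {}"
        using F by (auto simp: decomps_def)
      have sub: "F ! i \<subseteq> I" if "i < n" for i using that len un nth_mem by blast
      have "\<sigma> ` (F ! i) \<inter> \<sigma> ` (F ! j) = {}" if "i < n" "j < n" "i \<noteq> j" for i j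
        using inj_on_image_Int[OF \<open>inj_on \<sigma> I\<close> sub sub, of i j] dj[of i j] that by auto
      then show ?thesis using len un by (auto simp: decomps_def)
    qed
    then show ?thesis by (auto simp: E_power_def intro!: lin_hom)
  qed
  show "tr (E_power n) I \<sigma> z = tr (E_power n) I \<tau> z"
    if "finite I" "z \<in> carrier (obj (E_power n) I)" "\<And>x. x \<in> I \<Longrightarrow> \<sigma> x = \<tau> x"
    for I :: "'a set" and \<sigma> \<tau> and z :: "'a set list \<Rightarrow> 'k"
  proof -
    have "map ((`) \<sigma>) F = map ((`) \<tau>) F" if "z F \<noteq> 0" for F
    proof -
      have "F \<in> decomps n I"
        using free_mod_carrierD(2)[of z "decomps n I" F] that \<open>z \<in> _\<close> by (simp add: E_power_def)
      then show ?thesis using \<open>\<And>x. x \<in> I \<Longrightarrow> \<sigma> x = \<tau> x\<close>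
        by (auto simp: decomps_def intro!: image_cong)
    qed
    then show ?thesis by (auto simp: E_power_def intro!: lin_cong)
  qed
qed (auto simp: E_power_def free_mod_vectorspace lin_comp free_mod_carrierD(1) comp_def image_image
      intro!: lin_ident)

lemma graphsD: "g \<in> graphs I \<Longrightarrow> fst g = I" "g \<in> graphs I \<Longrightarrow> e \<in> snd g \<Longrightarrow> e \<subseteq> I \<and> card e = 2"
  by (auto simp: graphs_def)

lemma graphsI: "fst g = I \<Longrightarrow> (\<And>e. e \<in> snd g \<Longrightarrow> e \<subseteq> I \<and> card e = 2) \<Longrightarrow> g \<in> graphs I"
  by (cases g) (auto simp: graphs_def)

lemma relabel_graphs:
  assumes "inj_on \<sigma> I" "g \<in> graphs I" shows "relabel \<sigma> g \<in> graphs (\<sigma> ` I)"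
proof (rule graphsI)
  show "fst (relabel \<sigma> g) = \<sigma> ` I" using graphsD(1)[OF assms(2)] by (simp add: relabel_def)
  show "e \<subseteq> \<sigma> ` I \<and> card e = 2" if e: "e \<in> snd (relabel \<sigma> g)" for e
  proof -
    obtain d where d: "d \<in> snd g" "e = \<sigma> ` d" using e by (auto simp: relabel_def)
    then show ?thesis using graphsD(2)[OF assms(2) d(1)] card_image[of \<sigma> d] inj_on_subset[OF assms(1)]
      by (metis image_mono)
  qed
qed

lemma induced_graphs: "g \<in> graphs I \<Longrightarrow> T \<subseteq> I \<Longrightarrow> induced g T \<in> graphs T"
  by (rule graphsI) (auto simp: induced_def dest: graphsD)

lemma relabel_cong:
  assumes "g \<in> graphs I" "\<And>x. x \<in> I \<Longrightarrow> \<sigma> x = \<tau> x" shows "relabel \<sigma> g = relabel \<tau> g"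
proof -
  have "\<sigma> ` e = \<tau> ` e" if "e \<in> snd g" for e
    using graphsD(2)[OF assms(1) that] assms(2) by (intro image_cong) auto
  then show ?thesis
    using graphsD(1)[OF assms(1)] assms(2) by (auto simp: relabel_def intro!: image_cong)
qed

lemma induced_relabel:
  assumes "g \<in> graphs I" "inj_on \<sigma> I" "T \<subseteq> I"
  shows "induced (relabel \<sigma> g) (\<sigma> ` T) = relabel \<sigma> (induced g T)"
proof -
  have "\<sigma> ` e \<subseteq> \<sigma> ` T \<longleftrightarrow> e \<subseteq> T" if "e \<in> snd g" for e
  proof -
    have "e \<subseteq> I" using graphsD(2)[OF assms(1) that] by simp
    then show ?thesis using assms(2,3)
      by (metis image_mono image_eqI inj_on_image_mem_iff subset_iff)
  qed
  moreover have "\<sigma> ` I \<inter> \<sigma> ` T = \<sigma> ` (I \<inter> T)"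
    using inj_on_image_Int[OF assms(2), of I T] assms(3) by auto
  ultimately show ?thesis
    using graphsD(1)[OF assms(1)] by (auto simp: induced_def relabel_def)
qed

lemma Gr_simps [simp]:
  "obj Gr I = free_mod (graphs I)"
  "tr Gr I \<sigma> = lin (relabel \<sigma>)"
  "lres Gr S T = lin (\<lambda>g. induced g T)"
  "rres Gr S T = lin (\<lambda>g. induced g S)"
  by (simp_all add: Gr_def)

lemma Gr_species:
  "linear_species (Gr :: ('a::infinite, 'k::field, 'a graph \<Rightarrow> 'k) bicomodule)"
proof (rule linear_species.intro)
  fix I :: "'a set" and \<sigma> \<tau> :: "'a \<Rightarrow> 'a" and z :: "'a graph \<Rightarrow> 'k"
  show "vectorspace class_ring (obj (Gr :: ('a, 'k, 'a graph \<Rightarrow> 'k) bicomodule) I)"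
    by (simp add: free_mod_vectorspace)
  show "inj_on \<sigma> I \<Longrightarrow> tr Gr I \<sigma> \<in> module_hom class_ring (obj Gr I)
      (obj (Gr :: ('a, 'k, 'a graph \<Rightarrow> 'k) bicomodule) (\<sigma> ` I))"
    by (auto intro!: lin_hom relabel_graphs)
  show "z \<in> carrier (obj Gr I) \<Longrightarrow> (\<And>x. x \<in> I \<Longrightarrow> \<sigma> x = \<tau> x) \<Longrightarrow> tr Gr I \<sigma> z = tr Gr I \<tau> z"
    by (auto intro: lin_cong_on relabel_cong)
  show "tr Gr I id z = z"
    by (auto intro!: lin_ident simp: relabel_def)
  show "z \<in> carrier (obj Gr I) \<Longrightarrow> tr Gr I (\<tau> \<circ> \<sigma>) z = tr Gr (\<sigma> ` I) \<tau> (tr Gr I \<sigma> z)"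
    by (auto simp: lin_comp_on relabel_def image_image intro!: lin_cong)
qed

theorem Gr_cosymmetric_E_bicomodule:
  "cosymmetric_E_bicomodule (Gr :: ('a::infinite, 'k::field, 'a graph \<Rightarrow> 'k) bicomodule)"
proof (intro cosymmetric_E_bicomodule.intro E_bicomodule.intro E_bicomodule_axioms.intro
    cosymmetric_E_bicomodule_axioms.intro Gr_species)
  fix I S T R :: "'a set" and \<sigma> :: "'a \<Rightarrow> 'a" and z :: "'a graph \<Rightarrow> 'k"
  show "lres Gr S T \<in> module_hom class_ring (obj Gr (S \<union> T))
      (obj (Gr :: ('a, 'k, 'a graph \<Rightarrow> 'k) bicomodule) T)"
    by (auto intro!: lin_hom induced_graphs)
  show "rres Gr S T \<in> module_hom class_ring (obj Gr (S \<union> T))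
      (obj (Gr :: ('a, 'k, 'a graph \<Rightarrow> 'k) bicomodule) S)"
    by (auto intro!: lin_hom induced_graphs)
  show "inj_on \<sigma> (S \<union> T) \<Longrightarrow> z \<in> carrier (obj Gr (S \<union> T)) \<Longrightarrow>
      lres Gr (\<sigma> ` S) (\<sigma> ` T) (tr Gr (S \<union> T) \<sigma> z) = tr Gr T \<sigma> (lres Gr S T z)"
    by (simp add: lin_comp_on) (auto simp: induced_relabel intro!: lin_cong_on)
  show "inj_on \<sigma> (S \<union> T) \<Longrightarrow> z \<in> carrier (obj Gr (S \<union> T)) \<Longrightarrow>
      rres Gr (\<sigma> ` S) (\<sigma> ` T) (tr Gr (S \<union> T) \<sigma> z) = tr Gr S \<sigma> (rres Gr S T z)"
    by (simp add: lin_comp_on) (auto simp: induced_relabel intro!: lin_cong_on)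
  have whole: "induced g I = g" if "g \<in> graphs I" for g
    using graphsD[OF that] by (cases g) (auto simp: induced_def)
  show "z \<in> carrier (obj Gr I) \<Longrightarrow> lres Gr {} I z = z"
    using whole free_mod_carrierD(2)[of z "graphs I"] by (auto intro!: lin_ident)
  show "z \<in> carrier (obj Gr I) \<Longrightarrow> rres Gr I {} z = z"
    using whole free_mod_carrierD(2)[of z "graphs I"] by (auto intro!: lin_ident)
  show "z \<in> carrier (obj Gr (R \<union> S \<union> T)) \<Longrightarrow>
      lres Gr (R \<union> S) T z = lres Gr S T (lres Gr R (S \<union> T) z)"
    by (simp add: lin_comp_on) (auto simp: induced_def intro!: lin_cong)
  show "z \<in> carrier (obj Gr (R \<union> S \<union> T)) \<Longrightarrow>
      rres Gr R (S \<union> T) z = rres Gr R S (rres Gr (R \<union> S) T z)"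
    by (simp add: lin_comp_on) (auto simp: induced_def intro!: lin_cong)
  show "z \<in> carrier (obj Gr (R \<union> S \<union> T)) \<Longrightarrow>
      lres Gr R S (rres Gr (R \<union> S) T z) = rres Gr S T (lres Gr R (S \<union> T) z)"
    by (simp add: lin_comp_on) (auto simp: induced_def intro!: lin_cong)
  show "lres Gr S T z = rres Gr T S z"
    by simp
qed

end

theory Submission
  imports Defs "HOL-Combinatorics.Cycles"
begin

text \<open>
  A cochain on graphs is a function of a graph and an ordered decomposition of its vertices into \<open>n\<close>
  possibly empty blocks, invariant under relabelling. The complex is filtered by the number of
  vertices. On graphs with a fixed vertex set \<open>I\<close>, modulo smaller graphs, the coboundary only merges
  neighbouring blocks or drops empty blocks at the ends, and it acts on each graph separately. This local
  complex computes the cohomology of a sphere of dimension \<open>card I\<close>: it is acyclic except in degree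
  \<open>card I\<close>, where the cohomology is one-dimensional and detected by the signed sum over all orders of
  the vertices, each order giving a decomposition into singletons (\<open>local_cohomology\<close>).

  Hence in degree \<open>p\<close> the only obstruction to a cocycle \<open>a\<close> being a coboundary sits on graphs with \<open>p\<close>
  vertices and is its antisymmetrization. In characteristic zero the local solutions can be averaged
  over relabellings and so made natural, and solving for 0, 1, 2, ... vertices in turn shows that
  cocycles with vanishing antisymmetrization are coboundaries
  (\<open>cocycle_with_zero_antisym_is_coboundary\<close>). Conversely the antisymmetrization of a
  coboundary is zero (\<open>antisym_graph_coboundary\<close>). This is where cosymmetry enters: left and right
  restriction coincide, so the two end faces cancel after a cyclic rotation of the vertices; in terms of the
  spectral sequence of the filtration, its only possible differentials vanish. Finally every
  sign-equivariant function of enumerated graphs on \<open>p\<close> vertices extends to a cocycle, by summing over all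
  choices of one vertex from each block (\<open>transversal_cochain_cocycle\<close>). Cohomology in degree \<open>p\<close> is
  therefore the space of sign-equivariant functions on graphs with vertices \<open>0, \<dots>, p - 1\<close>. Such a function
  vanishes at graphs with an odd automorphism and is free on the other isomorphism classes
  (\<open>dim_cohomology_Gr\<close>).

  For the numerical values, a signed version of Burnside's lemma says that \<open>fact p\<close> times the number of classes
  is the sum over all permutations \<open>\<pi>\<close> of \<open>sign \<pi>\<close> times the number of graphs fixed by \<open>\<pi>\<close>
  (\<open>signed_burnside\<close>). Fixed graphs are unions of orbits of edges: \<open>k div 2\<close> orbits within a cycle of length \<open>k\<close>, and
  \<open>gcd k l\<close> between cycles of lengths \<open>k\<close> and \<open>l\<close>. Splitting off the cycle of one point after the other
  turns the sum into a recursion over lists of cycle lengths (\<open>sum_sign_cycle_weight\<close>), which is evaluated for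
  \<open>p < 10\<close>.
\<close>

section \<open>Decompositions as colourings\<close>

text \<open>A decomposition of \<open>I\<close> into \<open>n\<close> blocks is a colouring of \<open>I\<close> by \<open>0, \<dots>, n - 1\<close>. Every face of a
  decomposition into \<open>n + 1\<close> blocks is then one of the maps \<open>collapse i\<close>: for \<open>1 \<le> i \<le> n\<close> it merges
  the colours \<open>i - 1\<close> and \<open>i\<close>; for \<open>i = 0\<close> the colours that survive the removal of the first block
  move down by one; for \<open>i = n + 1\<close> the surviving colours stay. Colourings are total functions,
  so that faces compose as functions; only the values on the vertex set matter.\<close>

definition collapse :: "nat \<Rightarrow> ('a \<Rightarrow> nat) \<Rightarrow> 'a \<Rightarrow> nat" where
  "collapse i c v = (if i \<le> c v then c v - 1 else c v)"

definition open_gap :: "nat \<Rightarrow> ('a \<Rightarrow> nat) \<Rightarrow> 'a \<Rightarrow> nat" where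
  "open_gap j c v = (if j \<le> c v then c v + 1 else c v)"

text \<open>An end face deletes a block. On functions that vanish on smaller vertex sets it contributes
  only if that block is empty.\<close>

definition face_ok :: "'a set \<Rightarrow> nat \<Rightarrow> nat \<Rightarrow> ('a \<Rightarrow> nat) \<Rightarrow> bool" where
  "face_ok I n i c \<longleftrightarrow> (i = 0 \<longrightarrow> (\<forall>v\<in>I. c v \<noteq> 0)) \<and> (i = n + 1 \<longrightarrow> (\<forall>v\<in>I. c v \<noteq> n))"

text \<open>The coboundary on functions of decompositions of one fixed set \<open>I\<close>: the associated graded piece,
  for the filtration of cochains by the number of vertices, of the complex of graphs. It is the reduced
  cochain complex of the simplicial sphere obtained as the smash product of \<open>I\<close> circles, each circle
  having one vertex and one edge.\<close>

definition local_coboundary :: "'a set \<Rightarrow> nat \<Rightarrow> (('a \<Rightarrow> nat) \<Rightarrow> 'k::comm_ring_1) \<Rightarrow> ('a \<Rightarrow> nat) \<Rightarrow> 'k" where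
  "local_coboundary I n f c = (\<Sum>i\<le>n + 1. if face_ok I n i c then (- 1) ^ i * f (collapse i c) else 0)"

definition depends_on :: "'a set \<Rightarrow> (('a \<Rightarrow> nat) \<Rightarrow> 'k) \<Rightarrow> bool" where
  "depends_on I f \<longleftrightarrow> (\<forall>c c'. (\<forall>v\<in>I. c v = c' v) \<longrightarrow> f c = f c')"

lemma depends_onD: "depends_on I f \<Longrightarrow> (\<And>v. v \<in> I \<Longrightarrow> c v = c' v) \<Longrightarrow> f c = f c'"
  by (auto simp: depends_on_def)

definition insert_at :: "'a \<Rightarrow> nat \<Rightarrow> ('a \<Rightarrow> nat) \<Rightarrow> 'a \<Rightarrow> nat" where
  "insert_at x j c = (open_gap j c)(x := j)"

section \<open>The local complex of a finite set\<close>

text \<open>With \<open>x\<close> alone in block \<open>j\<close>, the faces that do not involve \<open>x\<close> are faces of the decomposition of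
  \<open>J\<close> with \<open>x\<close> inserted afterwards; the two remaining ones push \<open>x\<close> into the block before or after it.\<close>

lemma local_coboundary_insert_at:
  fixes f :: "('a \<Rightarrow> nat) \<Rightarrow> 'k::comm_ring_1"
  assumes x: "x \<notin> J" and f: "depends_on (insert x J) f" and c: "\<And>v. v \<in> J \<Longrightarrow> c v \<le> m" and j: "j \<le> m + 1"
  shows "local_coboundary (insert x J) (m + 1) f (insert_at x j c) =
    (\<Sum>t\<le>m + 1. if face_ok J m t c then (- 1) ^ t *
       ((if t < j then f (insert_at x (j - 1) (collapse t c)) else 0) -
        (if j < t then f (insert_at x j (collapse t c)) else 0)) else 0)
    + (- 1) ^ j * ((if 1 \<le> j then f (c(x := j - 1)) else 0) - (if j \<le> m then f (c(x := j)) else 0))"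
proof -
  let ?I = "insert x J" and ?c = "insert_at x j c"
  define T where "T t = (if face_ok ?I (m + 1) t ?c then (- 1) ^ t * f (collapse t ?c) else 0)" for t
  have eqI: "f a = f b" if "a x = b x" "\<And>v. v \<in> J \<Longrightarrow> a v = b v" for a b
    by (rule depends_onD[OF f]) (use that in auto)
  have xv: "v \<noteq> x" if "v \<in> J" for v using x that by auto
  have low: "T t = (if face_ok J m t c then (- 1) ^ t * f (insert_at x (j - 1) (collapse t c)) else 0)" if t: "t < j" for t
  proof -
    have "face_ok ?I (m + 1) t ?c = face_ok J m t c"
      using t j xv c by (auto simp: face_ok_def insert_at_def open_gap_def split: if_splits)
    moreover have "f (collapse t ?c) = f (insert_at x (j - 1) (collapse t c))" if "face_ok J m t c"
      using t xv that by (intro eqI) (fastforce simp: face_ok_def collapse_def insert_at_def open_gap_def)+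
    ultimately show ?thesis by (simp add: T_def)
  qed
  have mid1: "T j = (if 1 \<le> j then (- 1) ^ j * f (c(x := j - 1)) else 0)"
  proof -
    have "face_ok ?I (m + 1) j ?c = (1 \<le> j)"
      using j xv by (fastforce simp: face_ok_def insert_at_def open_gap_def)
    moreover have "f (collapse j ?c) = f (c(x := j - 1))"
      using xv by (intro eqI) (auto simp: collapse_def insert_at_def open_gap_def)
    ultimately show ?thesis by (simp add: T_def)
  qed
  have mid2: "T (j + 1) = (if j \<le> m then (- 1) ^ (j + 1) * f (c(x := j)) else 0)"
  proof -
    have "face_ok ?I (m + 1) (j + 1) ?c = (j \<le> m)"
      using j xv by (fastforce simp: face_ok_def insert_at_def open_gap_def)
    moreover have "f (collapse (j + 1) ?c) = f (c(x := j))"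
      using xv by (intro eqI) (auto simp: collapse_def insert_at_def open_gap_def)
    ultimately show ?thesis by (simp add: T_def)
  qed
  have high: "T (t + 1) = (if face_ok J m t c then - ((- 1) ^ t * f (insert_at x j (collapse t c))) else 0)" if t: "j < t" for t
  proof -
    have "face_ok ?I (m + 1) (t + 1) ?c = face_ok J m t c"
      using t j xv c by (fastforce simp: face_ok_def insert_at_def open_gap_def split: if_splits)
    moreover have "f (collapse (t + 1) ?c) = f (insert_at x j (collapse t c))"
      using t xv by (intro eqI) (auto simp: collapse_def insert_at_def open_gap_def)
    ultimately show ?thesis by (simp add: T_def)
  qed
  have "local_coboundary ?I (m + 1) f ?c = (\<Sum>t\<le>m + 2. T t)" by (simp add: local_coboundary_def T_def)
  also have "{..m + 2} = {..<j} \<union> {j, j + 1} \<union> {j + 2..m + 2}" using j by auto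
  also have "sum T \<dots> = sum T {..<j} + (T j + T (j + 1)) + sum T {j + 2..m + 2}"
    by (subst sum.union_disjoint, auto)+
  also have "sum T {j + 2..m + 2} = (\<Sum>t\<in>{j + 1..m + 1}. T (t + 1))"
    using sum.shift_bounds_cl_Suc_ivl[of T "j + 1" "m + 1"] by simp
  also have "\<dots> = (\<Sum>t\<le>m + 1. if j < t then T (t + 1) else 0)"
    by (rule sum.mono_neutral_cong_left) auto
  also have "sum T {..<j} = (\<Sum>t\<le>m + 1. if t < j then T t else 0)"
    using j by (intro sum.mono_neutral_cong_left) auto
  finally have "local_coboundary ?I (m + 1) f ?c = (\<Sum>t\<le>m + 1. (if t < j then T t else 0) + (if j < t then T (t + 1) else 0))
     + (T j + T (j + 1))" by (simp add: sum.distrib)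
  also have "(\<Sum>t\<le>m + 1. (if t < j then T t else 0) + (if j < t then T (t + 1) else 0)) =
     (\<Sum>t\<le>m + 1. if face_ok J m t c then (- 1) ^ t *
       ((if t < j then f (insert_at x (j - 1) (collapse t c)) else 0) -
        (if j < t then f (insert_at x j (collapse t c)) else 0)) else 0)"
    by (rule sum.cong) (auto simp: low high[simplified])
  finally show ?thesis unfolding mid1 mid2 by (auto simp: algebra_simps)
qed

text \<open>In the alternating sum over \<open>j \<le> i\<close> of the cocycle conditions at \<open>insert_at x j c\<close>, the faces that
  push \<open>x\<close> into a neighbouring block telescope, since pushing \<open>x\<close> to the right from block \<open>j\<close> and to
  the left from block \<open>j + 1\<close> gives the same colouring.\<close>

lemma cocycle_insertion_identity:
  fixes f :: "('a \<Rightarrow> nat) \<Rightarrow> 'k::comm_ring_1"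
  assumes x: "x \<notin> J" and f: "depends_on (insert x J) f"
    and cocycle: "\<And>c. (\<And>v. v \<in> insert x J \<Longrightarrow> c v \<le> m + 1) \<Longrightarrow> local_coboundary (insert x J) (m + 1) f c = 0"
    and c: "\<And>v. v \<in> J \<Longrightarrow> c v \<le> m" and i: "i \<le> m + 1"
  shows "(\<Sum>t\<le>m + 1. if face_ok J m t c then (- 1) ^ t *
            (\<Sum>j<(if t \<le> i then i else i + 1). (- 1) ^ j * f (insert_at x j (collapse t c))) else 0)
    = - (if i \<le> m then f (c(x := i)) else 0)"
  using i
proof -
  define P where "P j t = f (insert_at x j (collapse t c))" for j t
  define S where "S i = (\<Sum>t\<le>m + 1. if face_ok J m t c then (- 1) ^ t *
            (\<Sum>j<(if t \<le> i then i else i + 1). (- 1) ^ j * P j t) else 0)" for i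
  define D where "D i = (\<Sum>t\<le>m + 1. if face_ok J m t c then (- 1) ^ t *
       ((if t < i then P (i - 1) t else 0) - (if i < t then P i t else 0)) else 0)" for i
  have D: "(- 1) ^ j * D j = (if j \<le> m then f (c(x := j)) else 0) - (if 1 \<le> j then f (c(x := j - 1)) else 0)"
    if j: "j \<le> m + 1" for j
  proof -
    have "local_coboundary (insert x J) (m + 1) f (insert_at x j c) = 0"
    proof (rule cocycle)
      show "insert_at x j c v \<le> m + 1" if "v \<in> insert x J" for v
        using that c[of v] j by (auto simp: insert_at_def open_gap_def)
    qed
    then have "0 = D j + (- 1) ^ j * ((if 1 \<le> j then f (c(x := j - 1)) else 0) - (if j \<le> m then f (c(x := j)) else 0))"
      unfolding D_def P_def by (rule trans[OF sym local_coboundary_insert_at[OF x f c j]])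
    then have "D j = (- 1) ^ j * ((if j \<le> m then f (c(x := j)) else 0) - (if 1 \<le> j then f (c(x := j - 1)) else 0))"
      by (simp only: right_diff_distrib eq_diff_eq) (simp add: algebra_simps)
    then show ?thesis by (simp flip: mult.assoc power_add mult_2)
  qed
  have "S i = - (if i \<le> m then f (c(x := i)) else 0)"
    using i
  proof (induction i)
    case 0
    have "S 0 = - D 0"
      unfolding S_def D_def sum_negf[symmetric] by (rule sum.cong) auto
    then show ?case using D[of 0] by simp
  next
    case (Suc i)
    have "S (Suc i) = S i - (- 1) ^ Suc i * D (Suc i)"
      unfolding S_def D_def sum_distrib_left sum_subtractf[symmetric]
      by (rule sum.cong) (auto simp: algebra_simps not_le less_Suc_eq_le le_Suc_eq)
    also have "S i = - f (c(x := i))" using Suc by simp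
    also have "(- 1) ^ Suc i * D (Suc i) =
        (if Suc i \<le> m then f (c(x := Suc i)) else 0) - f (c(x := i))"
      using D[of "Suc i"] Suc.prems by (simp only: diff_Suc_1) simp
    finally show ?case by (simp add: fun_upd_def)
  qed
  then show ?thesis by (simp only: S_def P_def)
qed

definition enum_colouring :: "'a list \<Rightarrow> ('a \<Rightarrow> nat) \<Rightarrow> bool" where
  "enum_colouring xs c \<longleftrightarrow> (\<forall>i<length xs. c (xs ! i) = i)"

lemma local_coboundary_add:
  "local_coboundary I m (\<lambda>c. f c + g c) c = local_coboundary I m f c + local_coboundary I m g c"
  unfolding local_coboundary_def sum.distrib[symmetric] by (rule sum.cong) (auto simp: algebra_simps)

definition alone_last :: "'a \<Rightarrow> 'a set \<Rightarrow> nat \<Rightarrow> ('a \<Rightarrow> nat) \<Rightarrow> bool" where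
  "alone_last x J m c \<longleftrightarrow> c x = m \<and> (\<forall>v\<in>J. c v \<noteq> m)"

definition signed_insertion :: "'a \<Rightarrow> nat \<Rightarrow> (('a \<Rightarrow> nat) \<Rightarrow> 'k::comm_ring_1) \<Rightarrow> ('a \<Rightarrow> nat) \<Rightarrow> 'k" where
  "signed_insertion x i f c = (\<Sum>j\<le>i. (- 1) ^ j * f (insert_at x j c))"

text \<open>The function \<open>\<lambda>c. - signed_insertion x (c x) f c\<close> is a contracting homotopy applied to \<open>f\<close>: it
  pairs the decompositions with \<open>x\<close> in a block \<open>B \<union> {x}\<close> with those where \<open>{x}\<close> directly precedes \<open>B\<close>.
  The decompositions ending in the block \<open>{x}\<close> have no partner, and there the alternating sum of all
  insertions of \<open>x\<close> remains.\<close>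

lemma contract_point:
  fixes f :: "('a \<Rightarrow> nat) \<Rightarrow> 'k::comm_ring_1"
  assumes x: "x \<notin> J" and f: "depends_on (insert x J) f"
    and cocycle: "\<And>c. (\<And>v. v \<in> insert x J \<Longrightarrow> c v \<le> m + 1) \<Longrightarrow> local_coboundary (insert x J) (m + 1) f c = 0"
    and c: "\<And>v. v \<in> insert x J \<Longrightarrow> c v \<le> m"
  shows "f c = local_coboundary (insert x J) m (\<lambda>c. - signed_insertion x (c x) f c) c +
    (if alone_last x J m c then (- 1) ^ m * signed_insertion x m f c else 0)"
proof -
  let ?h = "\<lambda>c. - signed_insertion x (c x) f c" and ?i = "c x"
  have dep: "f a = f b" if "\<And>v. v \<in> insert x J \<Longrightarrow> a v = b v" for a b
    by (rule depends_onD[OF f]) (use that in auto)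
  have "f c = - (\<Sum>t\<le>m + 1. if face_ok J m t c then (- 1) ^ t *
            (\<Sum>j<(if t \<le> ?i then ?i else ?i + 1). (- 1) ^ j * f (insert_at x j (collapse t c))) else 0)"
    (is "_ = - sum ?T _")
  proof -
    have "sum ?T {..m + 1} = - (if ?i \<le> m then f (c(x := ?i)) else 0)"
      by (rule cocycle_insertion_identity[OF x f cocycle]) (use c le_SucI[OF c[of x]] in auto)
    then show ?thesis using c[of x] by (simp only: fun_upd_triv) simp
  qed
  also have "\<dots> = - sum ?T {..m} + - ?T (m + 1)" by simp
  also have "- sum ?T {..m} = (\<Sum>t\<le>m. if face_ok (insert x J) m t c then (- 1) ^ t * ?h (collapse t c) else 0)"
    unfolding sum_negf[symmetric]
  proof (rule sum.cong[OF refl])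
    fix t assume t: "t \<in> {..m}"
    show "- ?T t = (if face_ok (insert x J) m t c then (- 1) ^ t * ?h (collapse t c) else 0)"
    \<comment> \<open>At \<open>t = 0\<close>, \<open>c x = 0\<close> the face deletes the block of \<open>x\<close>; here the sum is empty.\<close>
    proof (cases "t = 0 \<and> ?i = 0")
      case True then show ?thesis by (auto simp: face_ok_def)
    next
      case False
      then have "face_ok (insert x J) m t c = face_ok J m t c" using t by (auto simp: face_ok_def)
      moreover have "{..<(if t \<le> ?i then ?i else ?i + 1)} = {..collapse t c x}"
        using False by (auto simp: collapse_def)
      ultimately show ?thesis by (simp add: signed_insertion_def)
    qed
  qed
  also have "- ?T (m + 1) = (if face_ok (insert x J) m (m + 1) c then (- 1) ^ (m + 1) * ?h (collapse (m + 1) c) else 0)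
     + (if alone_last x J m c then (- 1) ^ m * signed_insertion x m f c else 0)"
  proof -
    have ins: "f (insert_at x j (collapse (m + 1) c)) = f (insert_at x j c)" for j
      using c by (intro dep) (fastforce simp: collapse_def insert_at_def open_gap_def)
    have le: "\<not> m + 1 \<le> ?i" and cx: "collapse (m + 1) c x = ?i" using c[of x] by (auto simp: collapse_def)
    have Pi: "{..<(if m + 1 \<le> ?i then ?i else ?i + 1)} = {..?i}" using le by auto
    have fo: "face_ok (insert x J) m (m + 1) c = (face_ok J m (m + 1) c \<and> ?i \<noteq> m)"
      and al: "alone_last x J m c = (face_ok J m (m + 1) c \<and> ?i = m)"
      by (auto simp: face_ok_def alone_last_def)
    show ?thesis unfolding Pi fo al signed_insertion_def cx ins by auto
  qed
  finally show ?thesis by (simp add: local_coboundary_def add.assoc)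
qed

text \<open>What remains after the contraction is a cocycle on \<open>J\<close> of one degree less: at the largest index
  \<open>i = m + 1\<close> the telescoping sum of the insertion identity vanishes completely.\<close>

lemma signed_insertion_cocycle:
  fixes f :: "('a \<Rightarrow> nat) \<Rightarrow> 'k::comm_ring_1"
  assumes x: "x \<notin> J" and f: "depends_on (insert x J) f"
    and cocycle: "\<And>c. (\<And>v. v \<in> insert x J \<Longrightarrow> c v \<le> m + 1) \<Longrightarrow> local_coboundary (insert x J) (m + 1) f c = 0"
    and c: "\<And>v. v \<in> J \<Longrightarrow> c v \<le> m"
  shows "local_coboundary J m (\<lambda>c. (- 1) ^ m * signed_insertion x m f c) c = 0"
proof -
  have "local_coboundary J m (\<lambda>c. (- 1) ^ m * signed_insertion x m f c) c =
    (- 1) ^ m * (\<Sum>t\<le>m + 1. if face_ok J m t c then (- 1) ^ t *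
            (\<Sum>j<(if t \<le> m + 1 then m + 1 else m + 1 + 1). (- 1) ^ j * f (insert_at x j (collapse t c))) else 0)"
    unfolding sum_distrib_left local_coboundary_def signed_insertion_def
    by (rule sum.cong) (auto simp: lessThan_Suc_atMost mult.left_commute sum_distrib_left)
  also have "\<dots> = 0"
    using cocycle_insertion_identity[OF x f cocycle c, where i = "m + 1"] by simp
  finally show ?thesis .
qed

text \<open>Appending \<open>{x}\<close> as last block embeds the complex of \<open>J\<close>, shifted by one degree. The end face of
  \<open>J\<close> that deletes an empty last block corresponds to merging that block with \<open>{x}\<close>. Where \<open>{x}\<close> is the
  last block but one and the last block is empty, the two faces that remove the empty block cancel.\<close>

lemma local_coboundary_append_last:
  fixes b :: "('a \<Rightarrow> nat) \<Rightarrow> 'k::comm_ring_1"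
  assumes x: "x \<notin> J" and b: "depends_on J b" and c: "\<And>v. v \<in> insert x J \<Longrightarrow> c v \<le> Suc m"
  shows "local_coboundary (insert x J) (Suc m) (\<lambda>c. if alone_last x J m c then b c else 0) c =
    (if alone_last x J (Suc m) c then local_coboundary J m b c else 0)"
proof -
  let ?g = "\<lambda>c. if alone_last x J m c then b c else 0"
  define T where "T t = (if face_ok (insert x J) (Suc m) t c then (- 1) ^ t * ?g (collapse t c) else 0)" for t
  have xv: "v \<noteq> x" if "v \<in> J" for v using x that by auto
  have cx: "c x \<le> Suc m" by (rule c) simp
  have cJ: "c v \<le> Suc m" if "v \<in> J" for v by (rule c) (simp add: that)
  have "local_coboundary (insert x J) (Suc m) ?g c = sum T {..Suc (m + 1)}"
    unfolding local_coboundary_def T_def by simp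
  then have L: "local_coboundary (insert x J) (Suc m) ?g c = sum T {..m + 1} + T (Suc (Suc m))"
    unfolding sum.atMost_Suc by simp
  from cx have "c x = Suc m \<or> c x = m \<or> c x < m" by linarith
  then consider (last) "alone_last x J (Suc m) c" | (top) "c x = Suc m" "\<exists>v\<in>J. c v = Suc m" | (pen) "c x = m" | (less) "c x < m"
    unfolding alone_last_def by blast
  then show ?thesis
  proof cases
    case last
    have lt: "c v \<le> m" if "v \<in> J" for v
      using last cJ[of v] that by (auto simp: alone_last_def le_Suc_eq)
    have cxm: "c x = Suc m" using last by (simp add: alone_last_def)
    have "sum T {..m + 1} = local_coboundary J m b c"
      unfolding local_coboundary_def
    proof (rule sum.cong[OF refl])
      fix t assume t: "t \<in> {..m + 1}"
      show "T t = (if face_ok J m t c then (- 1) ^ t * b (collapse t c) else 0)"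
      proof (cases "t \<le> m")
        case True
        have "alone_last x J m (collapse t c)" if "face_ok J m t c"
          unfolding alone_last_def
        proof (intro conjI ballI)
          show "collapse t c x = m" using cxm True by (simp add: collapse_def)
          show "collapse t c v \<noteq> m" if v: "v \<in> J" for v
            using lt[OF v] v True \<open>face_ok J m t c\<close> by (auto simp: face_ok_def collapse_def)
        qed
        moreover have "face_ok (insert x J) (Suc m) t c = face_ok J m t c"
          using True cxm by (auto simp: face_ok_def)
        ultimately show ?thesis by (simp add: T_def)
      next
        case False
        then have tm: "t = Suc m" using t by auto
        have "alone_last x J m (collapse t c) = face_ok J m t c"
          unfolding alone_last_def face_ok_def using cxm tm lt
          by (auto simp: collapse_def) (metis not_less_eq_eq)+
        moreover have "face_ok (insert x J) (Suc m) t c"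
          using tm cxm by (auto simp: face_ok_def)
        ultimately show ?thesis by (simp add: T_def)
      qed
    qed
    moreover have "T (Suc (Suc m)) = 0" using cxm by (auto simp: T_def face_ok_def)
    ultimately show ?thesis using L last by simp
  next
    case top
    then obtain v where v: "v \<in> J" "c v = Suc m" by auto
    have "T t = 0" if "t \<le> Suc (Suc m)" for t
      using that v top cJ by (auto simp: T_def face_ok_def alone_last_def collapse_def le_Suc_eq)
    then have "local_coboundary (insert x J) (Suc m) ?g c = 0" unfolding L by (simp add: sum.neutral)
    moreover have "\<not> alone_last x J (Suc m) c" using v by (auto simp: alone_last_def)
    ultimately show ?thesis by simp
  next
    case pen
    have low: "T t = 0" if "t \<le> m" for t
      using that pen by (auto simp: T_def face_ok_def alone_last_def collapse_def)
    have eq: "b (collapse (Suc m) c) = b (collapse (Suc (Suc m)) c)"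
      if "\<And>v. v \<in> J \<Longrightarrow> c v \<noteq> Suc m"
      by (rule depends_onD[OF b]) (use cJ that in \<open>fastforce simp: collapse_def le_Suc_eq\<close>)
    have "T (Suc m) + T (Suc (Suc m)) = 0"
    proof (cases "\<forall>v\<in>J. c v \<noteq> Suc m \<and> c v \<noteq> m")
      case True
      have "alone_last x J m (collapse (Suc m) c)" "alone_last x J m (collapse (Suc (Suc m)) c)"
        using True pen cJ by (fastforce simp: alone_last_def collapse_def le_Suc_eq)+
      moreover have "face_ok (insert x J) (Suc m) (Suc m) c" "face_ok (insert x J) (Suc m) (Suc (Suc m)) c"
        using True pen by (auto simp: face_ok_def)
      ultimately show ?thesis using eq True by (simp add: T_def)
    next
      case False
      then obtain v where v: "v \<in> J" "c v = Suc m \<or> c v = m" by auto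
      then have "\<not> alone_last x J m (collapse (Suc m) c)" by (force simp: alone_last_def collapse_def)
      moreover have "\<not> (face_ok (insert x J) (Suc m) (Suc (Suc m)) c \<and> alone_last x J m (collapse (Suc (Suc m)) c))"
        using v by (force simp: face_ok_def alone_last_def collapse_def)
      ultimately show ?thesis by (auto simp: T_def)
    qed
    moreover have "sum T {..m} = 0" using low by simp
    ultimately have "local_coboundary (insert x J) (Suc m) ?g c = 0" unfolding L by (simp add: add.assoc)
    moreover have "\<not> alone_last x J (Suc m) c" using pen by (auto simp: alone_last_def)
    ultimately show ?thesis by simp
  next
    case less
    have "T t = 0" for t
      using less by (auto simp: T_def alone_last_def collapse_def)
    then have "local_coboundary (insert x J) (Suc m) ?g c = 0" unfolding L by simp
    moreover have "\<not> alone_last x J (Suc m) c" using less by (auto simp: alone_last_def)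
    ultimately show ?thesis by simp
  qed
qed

lemma depends_on_insert_at:
  assumes "depends_on (insert x J) f" "\<And>v. v \<in> J \<Longrightarrow> c v = c' v"
  shows "f (insert_at x j c) = f (insert_at x j c')"
proof (rule depends_onD[OF assms(1)])
  show "insert_at x j c v = insert_at x j c' v" if "v \<in> insert x J" for v
    using that assms(2)[of v] by (auto simp: insert_at_def open_gap_def)
qed

lemma signed_insertion_depends_on:
  assumes "depends_on (insert x J) f"
  shows "depends_on J (signed_insertion x m f)"
  unfolding depends_on_def signed_insertion_def
proof (intro allI impI sum.cong refl)
  fix c c' :: "'a \<Rightarrow> nat" and j assume "\<forall>v\<in>J. c v = c' v"
  then show "(- 1) ^ j * f (insert_at x j c) = (- 1) ^ j * f (insert_at x j c')"
    using depends_on_insert_at[OF assms, of c c' j] by simp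
qed

text \<open>The sphere of dimension \<open>length xs\<close> has reduced cohomology only in that degree, and one class
  generates it: every cocycle is, up to a coboundary, a multiple of the indicator function of the
  decomposition into singletons in the order of \<open>xs\<close>. The induction moves one point at a time to the end
  of the decomposition. It ends at the empty set, where the coboundaries are alternately zero and
  the identity.\<close>

lemma local_cohomology:
  fixes f :: "('a \<Rightarrow> nat) \<Rightarrow> 'k::comm_ring_1"
  assumes "distinct xs" "depends_on (set xs) f"
    "\<And>c. (\<And>v. v \<in> set xs \<Longrightarrow> c v \<le> n) \<Longrightarrow> local_coboundary (set xs) n f c = 0"
  shows "\<exists>b k. depends_on (set xs) b \<and> (n \<noteq> length xs \<longrightarrow> k = 0) \<and>
    (\<forall>c. (\<forall>v\<in>set xs. c v < n) \<longrightarrow>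
      f c = (case n of 0 \<Rightarrow> 0 | Suc m \<Rightarrow> local_coboundary (set xs) m b c) + (if enum_colouring xs c then k else 0))"
  using assms
proof (induction xs arbitrary: n f rule: rev_induct)
  case Nil
  have const: "f c = f c'" for c c' using Nil.prems(2) by (auto simp: depends_on_def)
  define y where "y = f (\<lambda>_. 0)"
  have f: "f c = y" for c unfolding y_def by (rule const)
  have alt: "(\<Sum>i\<le>r. (- 1) ^ i * z) = (if even r then z else 0)" for z :: 'k and r :: nat
    by (induction r) auto
  have cob: "local_coboundary {} r (\<lambda>c. z) c = (if odd r then z else 0)" for z :: 'k and r c
    using alt[of z "r + 1"] by (simp add: local_coboundary_def face_ok_def del: sum.atMost_Suc)
  have ff: "f = (\<lambda>c. y)" using f by auto
  have cocycle: "(if odd n then y else 0) = 0"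
  proof -
    have "local_coboundary {} n f (\<lambda>_. 0) = 0" using Nil.prems(3)[of "\<lambda>_. 0"] by simp
    then show ?thesis unfolding ff cob .
  qed
  show ?case
  proof (cases n)
    case 0
    then show ?thesis
      by (intro exI[of _ "\<lambda>_. 0"] exI[of _ y]) (simp add: f depends_on_def enum_colouring_def)
  next
    case (Suc m)
    then show ?thesis using cocycle
      by (intro exI[of _ "\<lambda>_. y"] exI[of _ 0]) (auto simp: f cob depends_on_def)
  qed
next
  case (snoc x xs)
  let ?J = "set xs" and ?I = "insert x (set xs)"
  have x: "x \<notin> ?J" and d: "distinct xs" and I: "set (xs @ [x]) = ?I" using snoc.prems(1) by auto
  show ?case
  proof (cases n)
    case 0
    then have "\<not> (\<forall>v\<in>set (xs @ [x]). c v < n)" for c by auto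
    then show ?thesis by (intro exI[of _ "\<lambda>_. 0"] exI[of _ 0]) (auto simp: depends_on_def)
  next
    case (Suc m)
    have f: "depends_on ?I f" and coc: "\<And>c. (\<And>v. v \<in> ?I \<Longrightarrow> c v \<le> m + 1) \<Longrightarrow> local_coboundary ?I (m + 1) f c = 0"
      using snoc.prems(2,3) unfolding I Suc by simp_all
    let ?e = "\<lambda>c. (- 1) ^ m * signed_insertion x m f c"
    have "depends_on ?J ?e" 
      unfolding depends_on_def
      by (intro allI impI arg_cong[where f = "(*) ((- 1) ^ m)"] depends_onD[OF signed_insertion_depends_on[OF f]]) simp
    from snoc.IH[OF d this signed_insertion_cocycle[OF x f coc]]
    obtain b k where b: "depends_on ?J b" and k: "m \<noteq> length xs \<longrightarrow> k = 0"
      and e: "\<And>c. (\<forall>v\<in>?J. c v < m) \<Longrightarrow>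
        ?e c = (case m of 0 \<Rightarrow> 0 | Suc m \<Rightarrow> local_coboundary ?J m b c) + (if enum_colouring xs c then k else 0)"
      by blast
    \<comment> \<open>The homotopy reduces \<open>f\<close> to \<open>{x}\<close> as last block; \<open>g\<close> carries the solution on the other points there.\<close>
    define g where "g c = (case m of 0 \<Rightarrow> 0 | Suc m' \<Rightarrow> if alone_last x ?J m' c then b c else 0)" for c
    let ?h = "\<lambda>c. - signed_insertion x (c x) f c"
    have dep: "depends_on ?I (\<lambda>c. ?h c + g c)"
      unfolding depends_on_def
    proof (intro allI impI)
      fix c c' :: "'a \<Rightarrow> nat" assume eq: "\<forall>v\<in>?I. c v = c' v"
      have "signed_insertion x m f c = signed_insertion x m f c'" for m
        by (rule depends_onD[OF signed_insertion_depends_on[OF f]]) (simp add: eq)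
      moreover have "g c = g c'" 
        using eq depends_onD[OF b, of c c'] by (simp add: g_def alone_last_def split: nat.split)
      ultimately show "?h c + g c = ?h c' + g c'" using eq by simp
    qed
    have g: "local_coboundary ?I m g c = (if alone_last x ?J m c then (case m of 0 \<Rightarrow> 0 | Suc m \<Rightarrow> local_coboundary ?J m b c) else 0)"
      if "\<forall>v\<in>?I. c v < n" for c
    proof (cases m)
      case 0 then show ?thesis by (simp add: g_def local_coboundary_def)
    next
      case (Suc m')
      then have gg: "g = (\<lambda>c. if alone_last x ?J m' c then b c else 0)" by (auto simp: g_def)
      have "local_coboundary ?I (Suc m') g c = (if alone_last x ?J (Suc m') c then local_coboundary ?J m' b c else 0)"
        unfolding gg by (rule local_coboundary_append_last[OF x b]) (use that Suc \<open>n = Suc m\<close> in auto)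
      then show ?thesis using Suc by simp
    qed
    have "f c = local_coboundary ?I m (\<lambda>c. ?h c + g c) c + (if enum_colouring (xs @ [x]) c then k else 0)"
      if c: "\<forall>v\<in>?I. c v < n" for c
    proof -
      have "f c = local_coboundary ?I m ?h c + (if alone_last x ?J m c then ?e c else 0)"
        by (rule contract_point[OF x f coc]) (use c Suc in auto)
      also have "(if alone_last x ?J m c then ?e c else 0) =
        local_coboundary ?I m g c + (if enum_colouring (xs @ [x]) c then k else 0)"
      proof (cases "alone_last x ?J m c")
        case True
        have "\<forall>v\<in>?J. c v < m" using True c Suc by (force simp: alone_last_def less_Suc_eq)
        from e[OF this] True g[OF c] k show ?thesis
          by (auto simp: alone_last_def enum_colouring_def nth_append less_Suc_eq)
      next
        case False
        have "k = 0" if en: "enum_colouring (xs @ [x]) c"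
        proof (rule ccontr)
          assume "k \<noteq> 0"
          then have m: "m = length xs" using k by auto
          have "c x = m" using en m by (auto simp: enum_colouring_def nth_append)
          moreover have "c v < m" if "v \<in> ?J" for v
          proof -
            obtain i where i: "i < length xs" "xs ! i = v" using \<open>v \<in> ?J\<close> by (auto simp: in_set_conv_nth)
            then have "c ((xs @ [x]) ! i) = i" using en unfolding enum_colouring_def by simp
            then show ?thesis using i m by (simp add: nth_append)
          qed
          ultimately show False using False by (force simp: alone_last_def)
        qed
        then show ?thesis using False g[OF c] by auto
      qed
      finally show ?thesis by (simp only: local_coboundary_add add.assoc)
    qed
    then show ?thesis using dep k Suc unfolding I
      by (intro exI[of _ "\<lambda>c. ?h c + g c"] exI[of _ k]) auto
  qed
qed

section \<open>Cochains on coloured graphs\<close>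

definition kept :: "'a set \<Rightarrow> nat \<Rightarrow> nat \<Rightarrow> ('a \<Rightarrow> nat) \<Rightarrow> 'a set" where
  "kept V n i c = {v \<in> V. (i = 0 \<longrightarrow> c v \<noteq> 0) \<and> (i = n + 1 \<longrightarrow> c v \<noteq> n)}"

text \<open>The coboundary of a cochain in terms of its coefficients at single graphs; \<open>coboundary_eq_of_coeffs\<close>
  justifies the formula.\<close>

definition graph_coboundary :: "nat \<Rightarrow> ('a graph \<Rightarrow> ('a \<Rightarrow> nat) \<Rightarrow> 'k::comm_ring_1) \<Rightarrow> 'a graph \<Rightarrow> ('a \<Rightarrow> nat) \<Rightarrow> 'k" where
  "graph_coboundary n a g c = (\<Sum>i\<le>n + 1. (- 1) ^ i * a (induced g (kept (fst g) n i c)) (collapse i c))"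

definition fin_graph :: "'a graph \<Rightarrow> bool" where
  "fin_graph g \<longleftrightarrow> finite (fst g) \<and> g \<in> graphs (fst g)"

text \<open>Functions of coloured graphs that are invariant under relabelling; taking \<open>\<sigma> = id\<close> shows that only
  the colours of the vertices matter.\<close>

definition natural :: "('a graph \<Rightarrow> ('a \<Rightarrow> nat) \<Rightarrow> 'k) \<Rightarrow> bool" where
  "natural a \<longleftrightarrow> (\<forall>g \<sigma> c c'. fin_graph g \<longrightarrow> inj_on \<sigma> (fst g) \<longrightarrow> (\<forall>v\<in>fst g. c' (\<sigma> v) = c v) \<longrightarrow>
     a (relabel \<sigma> g) c' = a g c)"

lemma naturalD:
  "natural a \<Longrightarrow> fin_graph g \<Longrightarrow> inj_on \<sigma> (fst g) \<Longrightarrow> (\<And>v. v \<in> fst g \<Longrightarrow> c' (\<sigma> v) = c v) \<Longrightarrow>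
     a (relabel \<sigma> g) c' = a g c"
  unfolding natural_def by blast

lemma relabel_id: "relabel id g = g"
  by (simp add: relabel_def)

lemma natural_cong:
  assumes "natural a" "fin_graph g" "\<And>v. v \<in> fst g \<Longrightarrow> c' v = c v"
  shows "a g c' = a g c"
  using naturalD[OF assms(1,2), of id c' c] assms(3) by (simp add: relabel_id)

lemma kept_subset: "kept V n i c \<subseteq> V"
  by (auto simp: kept_def)

lemma fst_induced: "fst (induced g S) = fst g \<inter> S"
  by (simp add: induced_def)

lemma fst_relabel: "fst (relabel \<sigma> g) = \<sigma> ` fst g"
  by (simp add: relabel_def)

lemma fst_induced_kept: "fst (induced g (kept (fst g) n i c)) = kept (fst g) n i c"
  using kept_subset[of "fst g" n i c] by (auto simp: fst_induced)

lemma fin_graph_induced: "fin_graph g \<Longrightarrow> fin_graph (induced g S)"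
  by (cases g) (fastforce simp: fin_graph_def graphs_def induced_def)

lemma fin_graph_relabel: "fin_graph g \<Longrightarrow> inj_on \<sigma> (fst g) \<Longrightarrow> fin_graph (relabel \<sigma> g)"
  using relabel_graphs[of \<sigma> "fst g" g] by (auto simp: fin_graph_def fst_relabel)

lemma induced_all: "fin_graph g \<Longrightarrow> induced g (fst g) = g"
  by (cases g) (auto simp: fin_graph_def graphs_def induced_def)

lemma induced_induced: "induced (induced g S) T = induced g (S \<inter> T)"
  by (auto simp: induced_def)

lemma natural_graph_coboundary:
  assumes a: "natural a"
  shows "natural (graph_coboundary n a)"
  unfolding natural_def
proof (intro allI impI)
  fix g :: "'a graph" and \<sigma> :: "'a \<Rightarrow> 'a" and c c' :: "'a \<Rightarrow> nat"
  assume g: "fin_graph g" and \<sigma>: "inj_on \<sigma> (fst g)" and c: "\<forall>v\<in>fst g. c' (\<sigma> v) = c v"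
  have "a (induced (relabel \<sigma> g) (kept (fst (relabel \<sigma> g)) n i c')) (collapse i c') =
        a (induced g (kept (fst g) n i c)) (collapse i c)" for i
  proof -
    let ?S = "kept (fst g) n i c"
    have S: "kept (fst (relabel \<sigma> g)) n i c' = \<sigma> ` ?S"
      using c by (auto simp: kept_def fst_relabel)
    have "induced (relabel \<sigma> g) (\<sigma> ` ?S) = relabel \<sigma> (induced g ?S)"
      by (rule induced_relabel[OF _ \<sigma> kept_subset]) (use g in \<open>simp add: fin_graph_def\<close>)
    moreover have "a (relabel \<sigma> (induced g ?S)) (collapse i c') = a (induced g ?S) (collapse i c)"
    proof (rule naturalD[OF a fin_graph_induced[OF g]])
      show "inj_on \<sigma> (fst (induced g ?S))" using \<sigma> by (rule inj_on_subset) (auto simp: fst_induced)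
      show "collapse i c' (\<sigma> v) = collapse i c v" if "v \<in> fst (induced g ?S)" for v
      proof -
        have "c' (\<sigma> v) = c v" using that c by (simp add: fst_induced)
        then show ?thesis by (simp add: collapse_def)
      qed
    qed
    ultimately show ?thesis by (simp only: S)
  qed
  then show "graph_coboundary n a (relabel \<sigma> g) c' = graph_coboundary n a g c" by (simp add: graph_coboundary_def)
qed

lemma natural_diff: "natural a \<Longrightarrow> natural b \<Longrightarrow> natural (\<lambda>g c. a g c - b g c)"
  unfolding natural_def by metis

lemma natural_add: "natural a \<Longrightarrow> natural b \<Longrightarrow> natural (\<lambda>g c. a g c + b g c)"
  unfolding natural_def by metis

text \<open>The pairs \<open>j < i\<close> and \<open>i \<le> j\<close> cancel under \<open>(i, j) \<mapsto> (j, i - 1)\<close>, which changes the parity of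
  \<open>i + j\<close>.\<close>

lemma alternating_double_sum:
  fixes T :: "nat \<Rightarrow> nat \<Rightarrow> 'k::comm_ring_1"
  assumes T: "\<And>i j. j < i \<Longrightarrow> i \<le> N + 1 \<Longrightarrow> T i j = T j (i - 1)"
  shows "(\<Sum>i\<le>N + 1. \<Sum>j\<le>N. (- 1) ^ (i + j) * T i j) = 0"
proof -
  let ?f = "\<lambda>(i, j). (- 1) ^ (i + j) * T i j"
  let ?A = "{(i, j). i \<le> N + 1 \<and> j \<le> N \<and> j < i}" and ?B = "{(i, j). i \<le> N + 1 \<and> j \<le> N \<and> i \<le> j}"
  have "(\<Sum>i\<le>N + 1. \<Sum>j\<le>N. (- 1) ^ (i + j) * T i j) = sum ?f ({..N + 1} \<times> {..N})"
    by (simp add: sum.cartesian_product)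
  also have "{..N + 1} \<times> {..N} = ?A \<union> ?B" by auto
  also have "sum ?f (?A \<union> ?B) = sum ?f ?A + sum ?f ?B"
  proof (rule sum.union_disjoint)
    show "finite ?A" by (rule finite_subset[of _ "{..N + 1} \<times> {..N}"]) auto
    show "finite ?B" by (rule finite_subset[of _ "{..N + 1} \<times> {..N}"]) auto
  qed auto
  also have "sum ?f ?A = sum (\<lambda>x. - ?f x) ?B"
  proof (rule sum.reindex_bij_witness[where i = "\<lambda>(i, j). (j + 1, i)" and j = "\<lambda>(i, j). (j, i - 1)"])
    fix x assume "x \<in> ?A"
    then obtain i j where x: "x = (i, j)" and h: "i \<le> N + 1" "j < i" by auto
    have "(- 1 :: 'k) ^ (i + j) = - ((- 1) ^ (j + (i - 1)))"
      using h by (cases i) (auto simp: add.commute)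
    then show "- (case (case x of (i, j) \<Rightarrow> (j, i - 1)) of (i, j) \<Rightarrow> (- 1) ^ (i + j) * T i j) = ?f x"
      using T[OF h(2,1)] x by simp
  qed auto
  finally show ?thesis by (simp add: sum_negf)
qed

lemma graph_coboundary_graph_coboundary:
  fixes a :: "'a graph \<Rightarrow> ('a \<Rightarrow> nat) \<Rightarrow> 'k::comm_ring_1"
  assumes a: "natural a" and g: "fin_graph g" and c: "\<And>v. v \<in> fst g \<Longrightarrow> c v \<le> n + 1"
  shows "graph_coboundary (n + 1) (graph_coboundary n a) g c = 0"
proof -
  define keep where "keep i j = kept (kept (fst g) (n + 1) i c) n j (collapse i c)" for i j
  define T where "T i j = a (induced g (keep i j)) (collapse j (collapse i c))" for i j
  have sub: "keep i j \<subseteq> fst g" for i j by (auto simp: keep_def kept_def)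
  have "graph_coboundary (n + 1) (graph_coboundary n a) g c = (\<Sum>i\<le>n + 1 + 1. \<Sum>j\<le>n + 1. (- 1) ^ (i + j) * T i j)"
    unfolding graph_coboundary_def[of "n + 1"]
  proof (intro sum.cong refl)
    fix i
    have *: "kept (fst g) (n + 1) i c \<inter> keep i j = keep i j" for j by (auto simp: keep_def kept_def)
    show "(- 1) ^ i * graph_coboundary n a (induced g (kept (fst g) (n + 1) i c)) (collapse i c) =
        (\<Sum>j\<le>n + 1. (- 1) ^ (i + j) * T i j)"
      unfolding graph_coboundary_def fst_induced_kept induced_induced keep_def[symmetric] * T_def[symmetric] sum_distrib_left
      by (simp only: power_add mult.assoc)
  qed
  also have "\<dots> = 0"
  proof (rule alternating_double_sum)
    fix i j :: nat assume ij: "j < i" "i \<le> n + 1 + 1"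
    have keep: "v \<in> keep i j \<longleftrightarrow> v \<in> keep j (i - 1)" for v
    proof (cases "v \<in> fst g")
      case True
      have "c v \<le> n + 1" by (rule c[OF True])
      then show ?thesis using True ij by (auto simp: keep_def kept_def collapse_def)
    qed (auto simp: keep_def kept_def)
    have eq: "collapse j (collapse i c) v = collapse (i - 1) (collapse j c) v" if "v \<in> keep i j" for v
      using that ij by (auto simp: keep_def kept_def collapse_def)
    have "a (induced g (keep i j)) (collapse j (collapse i c)) =
        a (induced g (keep i j)) (collapse (i - 1) (collapse j c))"
      by (rule natural_cong[OF a fin_graph_induced[OF g]]) (simp add: eq fst_induced)
    moreover have "keep i j = keep j (i - 1)" using keep by blast
    ultimately show "T i j = T j (i - 1)" by (simp add: T_def)
  qed
  finally show ?thesis .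
qed

section \<open>Antisymmetrization\<close>

lemma sign_cycle_of_list:
  "cs \<noteq> [] \<Longrightarrow> distinct cs \<Longrightarrow> sign (cycle_of_list cs) = (- 1) ^ (length cs - 1)"
  by (induction cs rule: cycle_of_list.induct)
    (auto simp: sign_compose permutation_swap_id permutation_of_cycle sign_swap_id)

lemma cycle_of_list_nth:
  assumes "distinct cs" "i < length cs"
  shows "cycle_of_list cs (cs ! i) = cs ! (Suc i mod length cs)"
proof -
  have "map (cycle_of_list cs) cs = rotate1 cs"
    using cyclic_rotation[OF assms(1), of 1] by simp
  then have "map (cycle_of_list cs) cs ! i = rotate1 cs ! i" by simp
  then show ?thesis using assms(2) by (simp add: nth_rotate1)
qed

text \<open>For a bijective colouring \<open>c\<close>, that is an enumeration of the vertices, this is the signed sum of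
  the values at all decompositions into singletons.\<close>

definition antisymmetrize :: "nat \<Rightarrow> (('a \<Rightarrow> nat) \<Rightarrow> 'k::comm_ring_1) \<Rightarrow> ('a \<Rightarrow> nat) \<Rightarrow> 'k" where
  "antisymmetrize n f c = (\<Sum>\<sigma> | \<sigma> permutes {..<n}. of_int (sign \<sigma>) * f (\<sigma> \<circ> c))"

lemma sign_permutes_compose:
  assumes "\<sigma> permutes S" "\<tau> permutes S" "finite S"
  shows "sign (\<sigma> \<circ> \<tau>) = sign \<sigma> * sign \<tau>"
  using assms by (intro sign_compose permutes_imp_permutation)

lemma antisym_compose:
  fixes f :: "('a \<Rightarrow> nat) \<Rightarrow> 'k::comm_ring_1"
  assumes "\<tau> permutes {..<n}"
  shows "antisymmetrize n f (\<tau> \<circ> c) = of_int (sign \<tau>) * antisymmetrize n f c"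
proof -
  have "antisymmetrize n f (\<tau> \<circ> c) = (\<Sum>\<sigma> | \<sigma> permutes {..<n}. of_int (sign \<tau>) * (of_int (sign (\<sigma> \<circ> \<tau>)) * f ((\<sigma> \<circ> \<tau>) \<circ> c)))"
    unfolding antisymmetrize_def
  proof (rule sum.cong[OF refl])
    fix \<sigma> assume "\<sigma> \<in> {\<sigma>. \<sigma> permutes {..<n}}"
    then have s: "sign (\<sigma> \<circ> \<tau>) = sign \<sigma> * sign \<tau>" using assms by (simp add: sign_permutes_compose)
    have "sign \<tau> * (sign \<sigma> * sign \<tau>) = sign \<sigma>"
      by (simp add: sign_def)
    then have "of_int (sign \<tau>) * of_int (sign (\<sigma> \<circ> \<tau>)) = (of_int (sign \<sigma>) :: 'k)"
      unfolding s of_int_mult[symmetric] by (rule arg_cong)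
    then show "of_int (sign \<sigma>) * f (\<sigma> \<circ> (\<tau> \<circ> c)) = of_int (sign \<tau>) * (of_int (sign (\<sigma> \<circ> \<tau>)) * f ((\<sigma> \<circ> \<tau>) \<circ> c))"
      by (simp only: comp_assoc mult.assoc[symmetric])
  qed
  also have "\<dots> = (\<Sum>\<sigma> | \<sigma> permutes {..<n}. of_int (sign \<tau>) * (of_int (sign \<sigma>) * f (\<sigma> \<circ> c)))"
    by (rule sum_permutations_compose_right[OF assms, symmetric])
  finally show ?thesis by (simp add: antisymmetrize_def sum_distrib_left)
qed

text \<open>Merging two neighbouring singletons gives a term symmetric in their two vertices, so it cancels
  against the transposed order. The two end faces remove the first and the last vertex of an order;
  because left and right restriction agree on graphs, a cyclic rotation of the order, of sign
  \<open>(-1)\<^sup>m\<close>, turns one into the other, and they cancel as well.\<close>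

lemma antisym_graph_coboundary:
  fixes b :: "'a graph \<Rightarrow> ('a \<Rightarrow> nat) \<Rightarrow> 'k::field_char_0"
  assumes b: "\<And>h. depends_on (fst h) (b h)" and c: "bij_betw c (fst g) {..<Suc m}"
  shows "antisymmetrize (Suc m) (graph_coboundary m b g) c = 0"
proof -
  let ?V = "fst g" and ?P = "{\<sigma>. \<sigma> permutes {..<Suc m}}"
  define S where "S i \<sigma> = induced g (kept ?V m i (\<sigma> \<circ> c))" for i \<sigma>
  define A where "A i = (\<Sum>\<sigma>\<in>?P. of_int (sign \<sigma>) * b (S i \<sigma>) (collapse i (\<sigma> \<circ> c)))" for i
  have cV: "c v < Suc m" if "v \<in> ?V" for v using c that by (auto simp: bij_betw_def)
  have "antisymmetrize (Suc m) (graph_coboundary m b g) c = (\<Sum>\<sigma>\<in>?P. \<Sum>i\<le>m + 1. (- 1) ^ i * (of_int (sign \<sigma>) * b (S i \<sigma>) (collapse i (\<sigma> \<circ> c))))"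
    unfolding antisymmetrize_def graph_coboundary_def S_def[symmetric] sum_distrib_left by (simp only: mult.left_commute)
  also have "\<dots> = (\<Sum>i\<le>m + 1. (- 1) ^ i * A i)"
    unfolding A_def sum_distrib_left by (rule sum.swap)
  finally have eq: "antisymmetrize (Suc m) (graph_coboundary m b g) c = (\<Sum>i\<le>m + 1. (- 1) ^ i * A i)" .
  have mid: "A i = 0" if i: "1 \<le> i" "i \<le> m" for i
  proof -
    let ?t = "transpose (i - 1) i"
    have t: "?t permutes {..<Suc m}" using i by (intro permutes_swap_id) auto
    have "A i = (\<Sum>\<sigma>\<in>?P. of_int (sign (?t \<circ> \<sigma>)) * b (S i (?t \<circ> \<sigma>)) (collapse i ((?t \<circ> \<sigma>) \<circ> c)))"
      unfolding A_def by (rule setum_permutations_compose_left[OF t])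
    also have "\<dots> = (\<Sum>\<sigma>\<in>?P. - (of_int (sign \<sigma>) * b (S i \<sigma>) (collapse i (\<sigma> \<circ> c))))"
    proof (rule sum.cong[OF refl])
      fix \<sigma> assume \<sigma>: "\<sigma> \<in> ?P"
      have "sign (?t \<circ> \<sigma>) = - sign \<sigma>"
        using sign_permutes_compose[OF t, of \<sigma>] \<sigma> i by (simp add: sign_swap_id)
      moreover have "S i (?t \<circ> \<sigma>) = S i \<sigma>"
        using i by (simp add: S_def kept_def)
      moreover have "collapse i ((?t \<circ> \<sigma>) \<circ> c) = collapse i (\<sigma> \<circ> c)"
        using i by (auto simp: collapse_def fun_eq_iff transpose_def)
      ultimately show "of_int (sign (?t \<circ> \<sigma>)) * b (S i (?t \<circ> \<sigma>)) (collapse i ((?t \<circ> \<sigma>) \<circ> c)) =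
         - (of_int (sign \<sigma>) * b (S i \<sigma>) (collapse i (\<sigma> \<circ> c)))" by (simp only: of_int_minus mult_minus_left)
    qed
    also have "\<dots> = - A i" by (simp add: A_def sum_negf)
    finally show ?thesis by simp
  qed
  have ends: "A 0 = (- 1) ^ m * A (m + 1)"
  proof -
    define r where "r = cycle_of_list [0..<Suc m]"
    have r: "r permutes {..<Suc m}" using cycle_permutes[of "[0..<Suc m]"] by (simp add: r_def atLeast0LessThan lessThan_Suc)
    have rk: "r k = (if k = m then 0 else Suc k)" if "k < Suc m" for k
      using cycle_of_list_nth[of "[0..<Suc m]" k] that by (auto simp: r_def simp del: upt_Suc)
    have "A 0 = (\<Sum>\<sigma>\<in>?P. of_int (sign (r \<circ> \<sigma>)) * b (S 0 (r \<circ> \<sigma>)) (collapse 0 ((r \<circ> \<sigma>) \<circ> c)))"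
      unfolding A_def by (rule setum_permutations_compose_left[OF r])
    also have "\<dots> = (\<Sum>\<sigma>\<in>?P. (- 1) ^ m * (of_int (sign \<sigma>) * b (S (m + 1) \<sigma>) (collapse (m + 1) (\<sigma> \<circ> c))))"
    proof (rule sum.cong[OF refl])
      fix \<sigma> assume \<sigma>: "\<sigma> \<in> ?P"
      have lt: "\<sigma> (c v) < Suc m" if "v \<in> ?V" for v
        using permutes_in_image[of \<sigma> "{..<Suc m}" "c v"] \<sigma> cV[OF that] by simp
      have "sign (r \<circ> \<sigma>) = (- 1) ^ m * sign \<sigma>"
        using sign_permutes_compose[OF r, of \<sigma>] \<sigma> sign_cycle_of_list[of "[0..<Suc m]"] by (simp add: r_def del: upt_Suc)
      moreover have "kept ?V m 0 ((r \<circ> \<sigma>) \<circ> c) = kept ?V m (m + 1) (\<sigma> \<circ> c)"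
        using lt by (auto simp: kept_def rk split: if_splits)
      then have "S 0 (r \<circ> \<sigma>) = S (m + 1) \<sigma>" by (simp add: S_def)
      moreover have "b (S (m + 1) \<sigma>) (collapse 0 ((r \<circ> \<sigma>) \<circ> c)) = b (S (m + 1) \<sigma>) (collapse (m + 1) (\<sigma> \<circ> c))"
      proof (rule depends_onD[OF b])
        fix v assume "v \<in> fst (S (m + 1) \<sigma>)"
        then have "v \<in> ?V" "\<sigma> (c v) \<noteq> m" by (auto simp: S_def fst_induced kept_def)
        then show "collapse 0 ((r \<circ> \<sigma>) \<circ> c) v = collapse (m + 1) (\<sigma> \<circ> c) v"
          using lt[of v] by (simp add: collapse_def rk)
      qed
      ultimately show "of_int (sign (r \<circ> \<sigma>)) * b (S 0 (r \<circ> \<sigma>)) (collapse 0 ((r \<circ> \<sigma>) \<circ> c)) =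
         (- 1) ^ m * (of_int (sign \<sigma>) * b (S (m + 1) \<sigma>) (collapse (m + 1) (\<sigma> \<circ> c)))" by simp
    qed
    finally show ?thesis by (simp add: A_def sum_distrib_left)
  qed
  have "(\<Sum>i\<le>m + 1. (- 1) ^ i * A i) = A 0 + (\<Sum>i\<in>{1..m}. (- 1) ^ i * A i) + (- 1) ^ (m + 1) * A (m + 1)"
  proof -
    have "{..m + 1} = insert (m + 1) (insert 0 {1..m})" by auto
    then show ?thesis by simp
  qed
  also have "(\<Sum>i\<in>{1..m}. (- 1) ^ i * A i) = 0" by (rule sum.neutral) (simp add: mid)
  finally show ?thesis unfolding eq ends by simp
qed

lemma antisym_diff: "antisymmetrize n (\<lambda>c. f c - g c) c = antisymmetrize n f c - antisymmetrize n g c"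
  by (simp add: antisymmetrize_def sum_subtractf algebra_simps)

lemma kept_eq_iff: "kept V n i c = V \<longleftrightarrow> face_ok V n i c"
  unfolding kept_def face_ok_def by blast

lemma collapse_less:
  "v \<in> kept V n i c \<Longrightarrow> i \<le> n + 1 \<Longrightarrow> c v \<le> n \<Longrightarrow> collapse i c v < n"
  by (auto simp: kept_def collapse_def)

text \<open>At the smallest number of vertices where a function does not vanish, its coboundary is the local one.\<close>

lemma graph_coboundary_vanishing_below:
  assumes b: "\<And>h c. fin_graph h \<Longrightarrow> card (fst h) < card (fst g) \<Longrightarrow> (\<And>v. v \<in> fst h \<Longrightarrow> c v < n) \<Longrightarrow> b h c = 0"
    and g: "fin_graph g" and c: "\<And>v. v \<in> fst g \<Longrightarrow> c v \<le> n"
  shows "graph_coboundary n b g c = local_coboundary (fst g) n (b g) c"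
  unfolding graph_coboundary_def local_coboundary_def
proof (rule sum.cong[OF refl])
  fix i assume i: "i \<in> {..n + 1}"
  let ?K = "kept (fst g) n i c"
  show "(- 1) ^ i * b (induced g ?K) (collapse i c) = (if face_ok (fst g) n i c then (- 1) ^ i * b g (collapse i c) else 0)"
  proof (cases "face_ok (fst g) n i c")
    case True
    then have "?K = fst g" by (simp add: kept_eq_iff)
    then show ?thesis using True induced_all[OF g] by simp
  next
    case False
    then have "?K \<noteq> fst g" by (simp add: kept_eq_iff)
    then have "card ?K < card (fst g)"
      using g kept_subset[of "fst g" n i c] by (intro psubset_card_mono) (auto simp: fin_graph_def)
    then have "b (induced g ?K) (collapse i c) = 0"
      using i c kept_subset[of "fst g" n i c]
      by (intro b fin_graph_induced[OF g]) (auto simp: fst_induced_kept intro!: collapse_less)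
    then show ?thesis using False by simp
  qed
qed

lemma antisym_local_coboundary:
  fixes b :: "('a \<Rightarrow> nat) \<Rightarrow> 'k::field_char_0"
  assumes b: "depends_on V b" and c: "bij_betw c V {..<Suc m}"
  shows "antisymmetrize (Suc m) (local_coboundary V m b) c = 0"
proof -
  \<comment> \<open>The local coboundary is the coboundary of a function supported on a single vertex set.\<close>
  let ?g = "(V, {}) :: 'a graph" and ?b = "\<lambda>h. if fst h = V then b else (\<lambda>_. 0)"
  have fin: "finite V" using c bij_betw_finite by blast
  have g: "fin_graph ?g" using fin by (simp add: fin_graph_def graphs_def)
  have "graph_coboundary m ?b ?g c = local_coboundary V m b c" for c
  proof -
    have "graph_coboundary m ?b ?g c = local_coboundary (fst ?g) m (?b ?g) c"
      unfolding graph_coboundary_def local_coboundary_def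
    proof (rule sum.cong[OF refl])
      fix i
      have "kept (fst ?g) m i c = V \<longleftrightarrow> face_ok (fst ?g) m i c" by (simp add: kept_eq_iff)
      then show "(- 1) ^ i * ?b (induced ?g (kept (fst ?g) m i c)) (collapse i c) =
         (if face_ok (fst ?g) m i c then (- 1) ^ i * ?b ?g (collapse i c) else 0)"
        unfolding fst_induced_kept by simp
    qed
    then show ?thesis by simp
  qed
  then have "local_coboundary V m b = graph_coboundary m ?b ?g" by auto
  moreover have "antisymmetrize (Suc m) (graph_coboundary m ?b ?g) c = 0"
    by (rule antisym_graph_coboundary) (use b c in \<open>auto simp: depends_on_def\<close>)
  ultimately show ?thesis by simp
qed

section \<open>Cocycles with vanishing antisymmetrization\<close>

text \<open>The multiple of the indicator function left over by the local computation is the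
  antisymmetrization at the enumeration \<open>xs\<close>, since antisymmetrization kills local coboundaries.\<close>

lemma local_solution:
  fixes f :: "('a \<Rightarrow> nat) \<Rightarrow> 'k::field_char_0"
  assumes K: "finite K" and f: "depends_on K f"
    and cocycle: "\<And>c. (\<And>v. v \<in> K \<Longrightarrow> c v \<le> Suc p) \<Longrightarrow> local_coboundary K (Suc p) f c = 0"
    and anti: "\<And>c. bij_betw c K {..<Suc p} \<Longrightarrow> antisymmetrize (Suc p) f c = 0"
  shows "\<exists>b. depends_on K b \<and> (\<forall>c. (\<forall>v\<in>K. c v < Suc p) \<longrightarrow> f c = local_coboundary K p b c)"
proof -
  obtain xs where xs: "set xs = K" "distinct xs" using finite_distinct_list[OF K] by blast
  obtain b k where b: "depends_on K b" and k: "Suc p \<noteq> length xs \<longrightarrow> k = 0"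
    and eq: "\<And>c. (\<forall>v\<in>K. c v < Suc p) \<Longrightarrow> f c = local_coboundary K p b c + (if enum_colouring xs c then k else 0)"
    using local_cohomology[OF xs(2), of f "Suc p"] f cocycle unfolding xs(1) by auto
  have "k = 0"
  proof (cases "Suc p = length xs")
    case True
    define c where "c = inv_into {..<Suc p} ((!) xs)"
    have nth: "bij_betw ((!) xs) {..<Suc p} K"
      using bij_betw_nth[OF xs(2)] True xs(1) by simp
    have c: "bij_betw c K {..<Suc p}" unfolding c_def by (rule bij_betw_inv_into[OF nth])
    have cx: "c (xs ! i) = i" if "i < Suc p" for i
      unfolding c_def using nth that by (intro inv_into_f_f) (auto simp: bij_betw_def)
    have "antisymmetrize (Suc p) f c = antisymmetrize (Suc p) (local_coboundary K p b) c +
      (\<Sum>\<sigma> | \<sigma> permutes {..<Suc p}. if \<sigma> = id then k else 0)"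
      unfolding antisymmetrize_def sum.distrib[symmetric]
    proof (rule sum.cong[OF refl])
      fix \<sigma> assume s: "\<sigma> \<in> {\<sigma>. \<sigma> permutes {..<Suc p}}"
      have "\<forall>v\<in>K. (\<sigma> \<circ> c) v < Suc p"
      proof
        fix v assume "v \<in> K"
        then have "c v \<in> {..<Suc p}" using c by (auto simp: bij_betw_def)
        then have "\<sigma> (c v) \<in> {..<Suc p}" using s permutes_in_image by fastforce
        then show "(\<sigma> \<circ> c) v < Suc p" by simp
      qed
      moreover have "enum_colouring xs (\<sigma> \<circ> c) \<longleftrightarrow> \<sigma> = id"
      proof
        assume en: "enum_colouring xs (\<sigma> \<circ> c)"
        show "\<sigma> = id"
        proof
          fix i show "\<sigma> i = id i"
          proof (cases "i < Suc p")
            case True2: True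
            then show ?thesis using en cx[of i] True by (auto simp: enum_colouring_def)
          next
            case False
            then show ?thesis using s by (auto simp: permutes_def)
          qed
        qed
      next
        assume "\<sigma> = id"
        then show "enum_colouring xs (\<sigma> \<circ> c)" using cx True by (auto simp: enum_colouring_def)
      qed
      ultimately show "of_int (sign \<sigma>) * f (\<sigma> \<circ> c) = of_int (sign \<sigma>) * local_coboundary K p b (\<sigma> \<circ> c) + (if \<sigma> = id then k else 0)"
        by (simp add: eq distrib_left)
    qed
    also have "antisymmetrize (Suc p) (local_coboundary K p b) c = 0" by (rule antisym_local_coboundary[OF b c])
    also have "(\<Sum>\<sigma> | \<sigma> permutes {..<Suc p}. if \<sigma> = id then k else 0) = k"
      by (subst sum.delta) (auto intro: finite_permutations permutes_id)
    finally show ?thesis using anti[OF c] by simp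
  qed (use k in auto)
  then show ?thesis using b eq by auto
qed

lemma local_coboundary_transport:
  assumes u: "bij_betw u V K"
  shows "local_coboundary V p (\<lambda>c. f (c \<circ> inv_into V u)) c = local_coboundary K p f (c \<circ> inv_into V u)"
proof -
  have V: "V = inv_into V u ` K" using bij_betw_inv_into[OF u] by (simp add: bij_betw_def)
  have "face_ok V p i c = face_ok K p i (c \<circ> inv_into V u)" for i
    by (subst (1) V) (simp add: face_ok_def)
  moreover have "collapse i c \<circ> inv_into V u = collapse i (c \<circ> inv_into V u)" for i
    by (simp add: fun_eq_iff collapse_def)
  ultimately show ?thesis by (simp only: local_coboundary_def)
qed

lemma local_coboundary_sum: "finite P \<Longrightarrow> local_coboundary V p (\<lambda>c. r * (\<Sum>x\<in>P. F x c)) c = r * (\<Sum>x\<in>P. local_coboundary V p (F x) c)"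
proof (induction P rule: finite_induct)
  case empty
  then show ?case by (simp add: local_coboundary_def)
next
  case (insert x P)
  have "local_coboundary V p (\<lambda>c. r * F x c) c = r * local_coboundary V p (F x) c"
    unfolding local_coboundary_def sum_distrib_left by (rule sum.cong) (auto simp: mult.left_commute)
  then show ?case using insert by (simp add: distrib_left local_coboundary_add)
qed

lemma relabel_relabel: "relabel \<tau> (relabel \<sigma> g) = relabel (\<tau> \<circ> \<sigma>) g"
  by (simp add: relabel_def image_comp comp_def image_image)

lemma relabel_cong_graph:
  "fin_graph g \<Longrightarrow> (\<And>x. x \<in> fst g \<Longrightarrow> \<sigma> x = \<tau> x) \<Longrightarrow> relabel \<sigma> g = relabel \<tau> g"
  by (rule relabel_cong) (auto simp: fin_graph_def)

text \<open>The local complexes are solved on one fixed vertex set \<open>K\<close> of size \<open>m\<close>, with arbitrary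
  choices. Averaging over all bijections from the given vertex set to \<open>K\<close>, which is possible in
  characteristic zero, makes the solution natural. The bijections are \<open>\<pi> \<circ> s V\<close> with \<open>s V\<close> a fixed one and
  \<open>\<pi>\<close> a permutation of \<open>K\<close>, so another choice of \<open>s V\<close> only reindexes the average.\<close>

lemma solve_at_size:
  fixes a :: "'a::infinite graph \<Rightarrow> ('a \<Rightarrow> nat) \<Rightarrow> 'k::field_char_0"
  assumes a: "natural a"
    and cocycle: "\<And>g c. fin_graph g \<Longrightarrow> (\<And>v. v \<in> fst g \<Longrightarrow> c v \<le> Suc p) \<Longrightarrow> graph_coboundary (Suc p) a g c = 0"
    and low: "\<And>h c. fin_graph h \<Longrightarrow> card (fst h) < m \<Longrightarrow> (\<And>v. v \<in> fst h \<Longrightarrow> c v < Suc p) \<Longrightarrow> a h c = 0"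
    and anti: "\<And>g c. fin_graph g \<Longrightarrow> bij_betw c (fst g) {..<Suc p} \<Longrightarrow> antisymmetrize (Suc p) (a g) c = 0"
  obtains b where "natural b" "\<And>h c. card (fst h) \<noteq> m \<Longrightarrow> b h c = 0"
    "\<And>g c. fin_graph g \<Longrightarrow> card (fst g) = m \<Longrightarrow> (\<And>v. v \<in> fst g \<Longrightarrow> c v < Suc p) \<Longrightarrow> graph_coboundary p b g c = a g c"
proof -
  obtain K :: "'a set" where K: "finite K" "card K = m"
    using infinite_arbitrarily_large[OF infinite_UNIV] by blast
  have "\<forall>h\<in>graphs K. \<exists>b. depends_on K b \<and> (\<forall>c. (\<forall>v\<in>K. c v < Suc p) \<longrightarrow> a h c = local_coboundary K p b c)"
  proof
    fix h assume h: "h \<in> graphs K"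
    then have V: "fst h = K" by (rule graphsD)
    have fg: "fin_graph h" using h K V by (simp add: fin_graph_def)
    show "\<exists>b. depends_on K b \<and> (\<forall>c. (\<forall>v\<in>K. c v < Suc p) \<longrightarrow> a h c = local_coboundary K p b c)"
    proof (rule local_solution[OF K(1)])
      show "depends_on K (a h)"
        unfolding depends_on_def using natural_cong[OF a fg] V by blast
      show "local_coboundary K (Suc p) (a h) c = 0" if c: "\<And>v. v \<in> K \<Longrightarrow> c v \<le> Suc p" for c
      proof -
        have "graph_coboundary (Suc p) a h c = local_coboundary (fst h) (Suc p) (a h) c"
          by (rule graph_coboundary_vanishing_below[OF _ fg]) (use low V K c in auto)
        then show ?thesis using cocycle[OF fg, of c] V c by simp
      qed
      show "antisymmetrize (Suc p) (a h) c = 0" if "bij_betw c K {..<Suc p}" for c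
        by (rule anti[OF fg]) (simp add: V that)
    qed
  qed
  from bchoice[OF this] obtain B where
    B0: "\<forall>h\<in>graphs K. depends_on K (B h) \<and> (\<forall>c. (\<forall>v\<in>K. c v < Suc p) \<longrightarrow> a h c = local_coboundary K p (B h) c)" ..
  have B: "depends_on K (B h)" if "h \<in> graphs K" for h
    using bspec[OF B0 that] by (rule conjunct1)
  have Bc: "a h c = local_coboundary K p (B h) c" if "h \<in> graphs K" "\<forall>v\<in>K. c v < Suc p" for h c
    by (rule mp[OF spec[OF conjunct2[OF bspec[OF B0 that(1)]]] that(2)])
  define s where "s V = (SOME s. bij_betw s V K)" for V :: "'a set"
  have s: "bij_betw (s V) V K" if "finite V" "card V = m" for V
    unfolding s_def by (rule someI_ex[OF finite_same_card_bij[OF that(1) K(1)]]) (simp add: that K)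
  define t where "t g c \<pi> = B (relabel (\<pi> \<circ> s (fst g)) g) (c \<circ> inv_into (fst g) (\<pi> \<circ> s (fst g)))" for g c \<pi>
  define b where "b g c = (if fin_graph g \<and> card (fst g) = m
    then (1 / fact m) * (\<Sum>\<pi> | \<pi> permutes K. t g c \<pi>) else 0)" for g c
  have u: "bij_betw (\<pi> \<circ> s V) V K" if "finite V" "card V = m" "\<pi> permutes K" for V \<pi>
    by (rule bij_betw_trans[OF s[OF that(1,2)] permutes_imp_bij[OF that(3)]])
  have gK: "relabel \<tau> g \<in> graphs K" if "fin_graph g" "bij_betw \<tau> (fst g) K" for g \<tau>
    using relabel_graphs[of \<tau> "fst g" g] that by (auto simp: fin_graph_def bij_betw_def)
  have "natural b"
    unfolding natural_def
  proof (intro allI impI)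
    fix g :: "'a graph" and \<sigma> :: "'a \<Rightarrow> 'a" and c c' :: "'a \<Rightarrow> nat"
    assume g: "fin_graph g" and \<sigma>: "inj_on \<sigma> (fst g)" and c: "\<forall>v\<in>fst g. c' (\<sigma> v) = c v"
    let ?V = "fst g" and ?V' = "\<sigma> ` fst g"
    have card: "card ?V' = card ?V" by (rule card_image[OF \<sigma>])
    have g': "fin_graph (relabel \<sigma> g)" by (rule fin_graph_relabel[OF g \<sigma>])
    show "b (relabel \<sigma> g) c' = b g c"
    proof (cases "card ?V = m")
      case True
      have fin: "finite ?V" "finite ?V'" using g by (auto simp: fin_graph_def)
      have card': "card ?V' = m" using card True by simp
      let ?\<rho> = "\<lambda>x. if x \<in> K then (s ?V' \<circ> \<sigma> \<circ> inv_into ?V (s ?V)) x else x"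
      have "bij_betw (s ?V' \<circ> \<sigma> \<circ> inv_into ?V (s ?V)) K K"
        using bij_betw_inv_into[OF s[OF fin(1) True]] inj_on_imp_bij_betw[OF \<sigma>] s[OF fin(2) card']
        by (metis bij_betw_trans comp_assoc)
      then have \<rho>: "?\<rho> permutes K"
        by (intro bij_imp_permutes) (auto cong: bij_betw_cong)
      have \<rho>s: "?\<rho> (s ?V v) = s ?V' (\<sigma> v)" if "v \<in> ?V" for v
        using s[OF fin(1) True] that by (auto simp: bij_betw_def)
      have "t (relabel \<sigma> g) c' \<pi> = t g c (\<pi> \<circ> ?\<rho>)" if \<pi>: "\<pi> permutes K" for \<pi>
      proof -
        have comp: "\<pi> \<circ> ?\<rho> permutes K" by (rule permutes_compose[OF \<rho> \<pi>])
        note u1 = u[OF fin(1) True comp] and u2 = u[OF fin(2) card' \<pi>]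
        have "relabel (\<pi> \<circ> s ?V') (relabel \<sigma> g) = relabel ((\<pi> \<circ> ?\<rho>) \<circ> s ?V) g"
          unfolding relabel_relabel by (rule relabel_cong_graph[OF g]) (simp add: \<rho>s[simplified])
        moreover have "B (relabel ((\<pi> \<circ> ?\<rho>) \<circ> s ?V) g) (c' \<circ> inv_into ?V' (\<pi> \<circ> s ?V')) =
          B (relabel ((\<pi> \<circ> ?\<rho>) \<circ> s ?V) g) (c \<circ> inv_into ?V ((\<pi> \<circ> ?\<rho>) \<circ> s ?V))"
        proof (rule depends_onD[OF B[OF gK[OF g u1]]])
          fix k assume "k \<in> K"
          then have "k \<in> ((\<pi> \<circ> ?\<rho>) \<circ> s ?V) ` ?V" using u1 by (simp add: bij_betw_def)
          then obtain v where v: "v \<in> ?V" "k = ((\<pi> \<circ> ?\<rho>) \<circ> s ?V) v" by blast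
          have 1: "inv_into ?V ((\<pi> \<circ> ?\<rho>) \<circ> s ?V) k = v"
            unfolding v(2) using u1 v(1) by (intro inv_into_f_f) (auto simp: bij_betw_def)
          have k2: "k = (\<pi> \<circ> s ?V') (\<sigma> v)" using v \<rho>s[OF v(1)] by simp
          have 2: "inv_into ?V' (\<pi> \<circ> s ?V') k = \<sigma> v"
            unfolding k2 by (rule inv_into_f_f[OF bij_betw_imp_inj_on[OF u2]]) (simp add: v(1))
          show "(c' \<circ> inv_into ?V' (\<pi> \<circ> s ?V')) k = (c \<circ> inv_into ?V ((\<pi> \<circ> ?\<rho>) \<circ> s ?V)) k"
            using c v(1) by (simp only: comp_apply[of c'] comp_apply[of c] 1 2)
        qed
        ultimately show ?thesis by (simp only: t_def fst_relabel)
      qed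
      then have "(\<Sum>\<pi> | \<pi> permutes K. t (relabel \<sigma> g) c' \<pi>) = (\<Sum>\<pi> | \<pi> permutes K. t g c (\<pi> \<circ> ?\<rho>))"
        by (intro sum.cong) auto
      also have "\<dots> = (\<Sum>\<pi> | \<pi> permutes K. t g c \<pi>)"
        by (rule sum_permutations_compose_right[OF \<rho>, symmetric])
      finally show ?thesis using g g' card by (simp only: b_def fst_relabel)
    qed (simp add: b_def card fst_relabel)
  qed
  moreover have supp: "b h c = 0" if "card (fst h) \<noteq> m" for h c using that by (simp add: b_def)
  moreover have "graph_coboundary p b g c = a g c"
    if g: "fin_graph g" and m: "card (fst g) = m" and c: "\<And>v. v \<in> fst g \<Longrightarrow> c v < Suc p" for g c
  proof -
    let ?V = "fst g"
    have fin: "finite ?V" using g by (simp add: fin_graph_def)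
    have "graph_coboundary p b g c = local_coboundary ?V p (b g) c"
      by (rule graph_coboundary_vanishing_below[OF _ g]) (use m c in \<open>auto simp: supp less_Suc_eq_le\<close>)
    also have "b g = (\<lambda>c. (1 / fact m) * (\<Sum>\<pi> | \<pi> permutes K. t g c \<pi>))"
      using g m by (simp add: b_def fun_eq_iff)
    also have "local_coboundary ?V p \<dots> c = (1 / fact m) * (\<Sum>\<pi> | \<pi> permutes K. local_coboundary ?V p (\<lambda>c. t g c \<pi>) c)"
      by (rule local_coboundary_sum) (simp add: finite_permutations K)
    also have "(\<Sum>\<pi> | \<pi> permutes K. local_coboundary ?V p (\<lambda>c. t g c \<pi>) c) = (\<Sum>\<pi> | \<pi> permutes K. a g c)"
    proof (rule sum.cong[OF refl])
      fix \<pi> assume "\<pi> \<in> {\<pi>. \<pi> permutes K}"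
      then have u: "bij_betw (\<pi> \<circ> s ?V) ?V K" using u[OF fin m] by simp
      let ?u = "\<pi> \<circ> s ?V"
      have "local_coboundary ?V p (\<lambda>c. t g c \<pi>) c = local_coboundary K p (B (relabel ?u g)) (c \<circ> inv_into ?V ?u)"
        unfolding t_def by (rule local_coboundary_transport[OF u])
      also have "\<dots> = a (relabel ?u g) (c \<circ> inv_into ?V ?u)"
      proof (rule Bc[symmetric, OF gK[OF g u]], intro ballI)
        fix k assume "k \<in> K"
        then have "inv_into ?V ?u k \<in> ?V" using bij_betw_inv_into[OF u] by (auto simp: bij_betw_def)
        then show "(c \<circ> inv_into ?V ?u) k < Suc p" using c by simp
      qed
      also have "\<dots> = a g c"
      proof (rule naturalD[OF a g])
        show inj: "inj_on ?u ?V" using u by (simp add: bij_betw_def)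
        show "(c \<circ> inv_into ?V ?u) (?u v) = c v" if "v \<in> ?V" for v
          using inv_into_f_f[OF inj that] by simp
      qed
      finally show "local_coboundary ?V p (\<lambda>c. t g c \<pi>) c = a g c" .
    qed
    also have "(1 / fact m) * \<dots> = a g c" using K by (simp add: card_permutations)
    finally show ?thesis .
  qed
  ultimately show thesis by (rule that)
qed

lemma graph_coboundary_add: "graph_coboundary n (\<lambda>g c. a g c + b g c) g c = graph_coboundary n a g c + graph_coboundary n b g c"
  by (simp add: graph_coboundary_def sum.distrib distrib_left del: sum.atMost_Suc)

lemma graph_coboundary_diff: "graph_coboundary n (\<lambda>g c. a g c - b g c) g c = graph_coboundary n a g c - graph_coboundary n b g c"
  by (simp add: graph_coboundary_def sum_subtractf right_diff_distrib del: sum.atMost_Suc)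

lemma natural_depends_on: "natural a \<Longrightarrow> fin_graph g \<Longrightarrow> depends_on (fst g) (a g)"
  unfolding depends_on_def using natural_cong by blast

lemma antisym_graph_coboundary_natural:
  fixes b :: "'a graph \<Rightarrow> ('a \<Rightarrow> nat) \<Rightarrow> 'k::field_char_0"
  assumes b: "natural b" and g: "fin_graph g" and c: "bij_betw c (fst g) {..<Suc m}"
  shows "antisymmetrize (Suc m) (graph_coboundary m b g) c = 0"
proof -
  let ?b = "\<lambda>h. if fin_graph h then b h else (\<lambda>_. 0)"
  have "graph_coboundary m b g = graph_coboundary m ?b g"
    using fin_graph_induced[OF g] by (simp add: graph_coboundary_def fun_eq_iff del: sum.atMost_Suc)
  moreover have "antisymmetrize (Suc m) (graph_coboundary m ?b g) c = 0"
    by (rule antisym_graph_coboundary[OF _ c]) (use natural_depends_on[OF b] in \<open>auto simp: depends_on_def\<close>)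
  ultimately show ?thesis by simp
qed

text \<open>A cocycle is solved one number of vertices after the other. Each correction leaves smaller graphs
  untouched, so the infinitely many corrections add up to one cochain \<open>b\<close>, whose value at a graph is
  already reached after finitely many steps.\<close>

theorem cocycle_with_zero_antisym_is_coboundary:
  fixes a :: "'a::infinite graph \<Rightarrow> ('a \<Rightarrow> nat) \<Rightarrow> 'k::field_char_0"
  assumes a: "natural a"
    and cocycle: "\<And>g c. fin_graph g \<Longrightarrow> (\<And>v. v \<in> fst g \<Longrightarrow> c v \<le> Suc p) \<Longrightarrow> graph_coboundary (Suc p) a g c = 0"
    and anti: "\<And>g c. fin_graph g \<Longrightarrow> bij_betw c (fst g) {..<Suc p} \<Longrightarrow> antisymmetrize (Suc p) (a g) c = 0"
  obtains b where "natural b"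
    "\<And>g c. fin_graph g \<Longrightarrow> (\<And>v. v \<in> fst g \<Longrightarrow> c v < Suc p) \<Longrightarrow> a g c = graph_coboundary p b g c"
proof -
  define P where "P m b \<longleftrightarrow> natural b \<and> (\<forall>g c. fin_graph g \<longrightarrow> card (fst g) < m \<longrightarrow>
    (\<forall>v\<in>fst g. c v < Suc p) \<longrightarrow> a g c = graph_coboundary p b g c)" for m and b :: "'a graph \<Rightarrow> ('a \<Rightarrow> nat) \<Rightarrow> 'k"
  have "\<exists>B. \<forall>m. P m (B m) \<and> (\<forall>h. card (fst h) < m \<longrightarrow> B (Suc m) h = B m h)"
  proof (rule dependent_nat_choice)
    show "\<exists>b. P 0 b" by (rule exI[of _ "\<lambda>_ _. 0"]) (simp add: P_def natural_def)
    fix b m assume b: "P m b"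
    then have nb: "natural b" by (simp add: P_def)
    have bP: "a g c = graph_coboundary p b g c"
      if "fin_graph g" "card (fst g) < m" "\<And>v. v \<in> fst g \<Longrightarrow> c v < Suc p" for g c
      by (rule b[unfolded P_def, THEN conjunct2, rule_format]) (fact that)+
    let ?a = "\<lambda>g c. a g c - graph_coboundary p b g c"
    obtain b' where b': "natural b'" "\<And>h c. card (fst h) \<noteq> m \<Longrightarrow> b' h c = 0"
      "\<And>g c. fin_graph g \<Longrightarrow> card (fst g) = m \<Longrightarrow> (\<And>v. v \<in> fst g \<Longrightarrow> c v < Suc p) \<Longrightarrow> graph_coboundary p b' g c = ?a g c"
    proof (rule solve_at_size[of ?a p m])
      show "natural ?a" by (rule natural_diff[OF a natural_graph_coboundary[OF nb]])
      show "graph_coboundary (Suc p) ?a g c = 0" if "fin_graph g" "\<And>v. v \<in> fst g \<Longrightarrow> c v \<le> Suc p" for g c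
        using cocycle[OF that] graph_coboundary_graph_coboundary[OF nb that(1), of c p] that(2) unfolding graph_coboundary_diff by simp
      show "?a h c = 0" if "fin_graph h" "card (fst h) < m" "\<And>v. v \<in> fst h \<Longrightarrow> c v < Suc p" for h c
        using bP[OF that] by simp
      show "antisymmetrize (Suc p) (?a g) c = 0" if "fin_graph g" "bij_betw c (fst g) {..<Suc p}" for g c
        using anti[OF that] antisym_graph_coboundary_natural[OF nb that] by (simp add: antisym_diff)
    qed blast
    let ?b = "\<lambda>g c. b g c + b' g c"
    have "P (Suc m) ?b"
      unfolding P_def
    proof (intro conjI allI impI)
      show "natural ?b" by (rule natural_add[OF nb b'(1)])
      fix g :: "'a graph" and c :: "'a \<Rightarrow> nat"
      assume g: "fin_graph g" and m: "card (fst g) < Suc m" and c: "\<forall>v\<in>fst g. c v < Suc p"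
      show "a g c = graph_coboundary p ?b g c"
      proof (cases "card (fst g) = m")
        case True
        then show ?thesis using b'(3)[OF g True, of c] c unfolding graph_coboundary_add by simp
      next
        case False
        then have lt: "card (fst g) < m" using m by simp
        have "graph_coboundary p b' g c = 0"
          unfolding graph_coboundary_def
        proof (rule sum.neutral, intro ballI)
          fix i
          have "card (fst (induced g (kept (fst g) p i c))) \<le> card (fst g)"
            using g by (intro card_mono) (auto simp: fin_graph_def fst_induced)
          then show "(- 1) ^ i * b' (induced g (kept (fst g) p i c)) (collapse i c) = 0"
            using b'(2) lt by simp
        qed
        then show ?thesis using bP[OF g lt, of c] c unfolding graph_coboundary_add by simp
      qed
    qed
    moreover have "\<forall>h. card (fst h) < m \<longrightarrow> ?b h = b h" using b'(2) by auto
    ultimately show "\<exists>y. P (Suc m) y \<and> (\<forall>h. card (fst h) < m \<longrightarrow> y h = b h)" by blast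
  qed
  then obtain B where B: "\<And>m. P m (B m)" and st: "\<And>m h. card (fst h) < m \<Longrightarrow> B (Suc m) h = B m h" by blast
  \<comment> \<open>\<open>B m\<close> is correct on graphs with fewer than \<open>m\<close> vertices and constant in \<open>m\<close> from there on.\<close>
  define b where "b g = B (Suc (card (fst g))) g" for g
  have b: "B m h = b h" if "card (fst h) < m" for m h
    using that
  proof (induction m)
    case (Suc m)
    then show ?case by (cases "card (fst h) = m") (auto simp: b_def st)
  qed simp
  have "natural b"
    unfolding natural_def
  proof (intro allI impI)
    fix g :: "'a graph" and \<sigma> :: "'a \<Rightarrow> 'a" and c c' :: "'a \<Rightarrow> nat"
    assume g: "fin_graph g" and \<sigma>: "inj_on \<sigma> (fst g)" and c: "\<forall>v\<in>fst g. c' (\<sigma> v) = c v"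
    have "natural (B (Suc (card (fst g))))" using B by (simp add: P_def)
    from naturalD[OF this g \<sigma>, of c' c] c show "b (relabel \<sigma> g) c' = b g c"
      by (simp add: b_def fst_relabel card_image[OF \<sigma>])
  qed
  moreover have "a g c = graph_coboundary p b g c" if g: "fin_graph g" and c: "\<And>v. v \<in> fst g \<Longrightarrow> c v < Suc p" for g c
  proof -
    have "a g c = graph_coboundary p (B (Suc (card (fst g)))) g c"
      by (rule B[unfolded P_def, THEN conjunct2, rule_format]) (use g c in auto)
    also have "\<dots> = graph_coboundary p b g c"
      unfolding graph_coboundary_def
    proof (rule sum.cong[OF refl])
      fix i
      have "card (fst (induced g (kept (fst g) p i c))) \<le> card (fst g)"
        using g by (intro card_mono) (auto simp: fin_graph_def fst_induced)
      then show "(- 1) ^ i * B (Suc (card (fst g))) (induced g (kept (fst g) p i c)) (collapse i c) =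
        (- 1) ^ i * b (induced g (kept (fst g) p i c)) (collapse i c)"
        using b[of "induced g (kept (fst g) p i c)" "Suc (card (fst g))"] by simp
    qed
    finally show ?thesis .
  qed
  ultimately show thesis by (rule that)
qed

section \<open>Cocycles from transversals\<close>

text \<open>The extension of a function of enumerated graphs on \<open>p\<close> vertices to all decompositions into \<open>p\<close>
  blocks: the sum over all ways of choosing one vertex from each block.\<close>

definition transversal_cochain :: "nat \<Rightarrow> ('a graph \<Rightarrow> ('a \<Rightarrow> nat) \<Rightarrow> 'k::comm_ring_1) \<Rightarrow> 'a graph \<Rightarrow> ('a \<Rightarrow> nat) \<Rightarrow> 'k" where
  "transversal_cochain p f g c = (\<Sum>T | T \<subseteq> fst g \<and> bij_betw c T {..<p}. f (induced g T) c)"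

lemma natural_transversal_cochain:
  assumes f: "natural f"
  shows "natural (transversal_cochain p f)"
  unfolding natural_def
proof (intro allI impI)
  fix g :: "'a graph" and \<sigma> :: "'a \<Rightarrow> 'a" and c c' :: "'a \<Rightarrow> nat"
  assume g: "fin_graph g" and \<sigma>: "inj_on \<sigma> (fst g)" and c: "\<forall>v\<in>fst g. c' (\<sigma> v) = c v"
  let ?S = "{T. T \<subseteq> fst g \<and> bij_betw c T {..<p}}"
  let ?S' = "{T. T \<subseteq> fst (relabel \<sigma> g) \<and> bij_betw c' T {..<p}}"
  have bij: "bij_betw c' (\<sigma> ` T) {..<p} \<longleftrightarrow> bij_betw c T {..<p}" if "T \<subseteq> fst g" for T
  proof -
    have "bij_betw c T {..<p} \<longleftrightarrow> bij_betw (c' \<circ> \<sigma>) T {..<p}"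
      by (rule bij_betw_cong) (use c that in auto)
    then show ?thesis
      using bij_betw_comp_iff[OF inj_on_imp_bij_betw[OF inj_on_subset[OF \<sigma> that]], of c' "{..<p}"] by simp
  qed
  have "?S' = (`) \<sigma> ` ?S"
  proof
    show "?S' \<subseteq> (`) \<sigma> ` ?S"
    proof
      fix T assume T: "T \<in> ?S'"
      then obtain U where "U \<subseteq> fst g" "T = \<sigma> ` U" by (auto simp: fst_relabel subset_image_iff)
      then show "T \<in> (`) \<sigma> ` ?S" using bij T by auto
    qed
    show "(`) \<sigma> ` ?S \<subseteq> ?S'" using bij by (auto simp: fst_relabel)
  qed
  moreover have "inj_on ((`) \<sigma>) ?S"
    using inj_on_image_Pow[OF \<sigma>] by (rule inj_on_subset) auto
  ultimately have "transversal_cochain p f (relabel \<sigma> g) c' = (\<Sum>T\<in>?S. f (induced (relabel \<sigma> g) (\<sigma> ` T)) c')"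
    unfolding transversal_cochain_def by (simp add: sum.reindex)
  also have "\<dots> = (\<Sum>T\<in>?S. f (induced g T) c)"
  proof (rule sum.cong[OF refl])
    fix T assume "T \<in> ?S"
    then have T: "T \<subseteq> fst g" by simp
    have "induced (relabel \<sigma> g) (\<sigma> ` T) = relabel \<sigma> (induced g T)"
      by (rule induced_relabel[OF _ \<sigma> T]) (use g in \<open>simp add: fin_graph_def\<close>)
    moreover have "f (relabel \<sigma> (induced g T)) c' = f (induced g T) c"
      by (rule naturalD[OF f fin_graph_induced[OF g]])
        (use T c inj_on_subset[OF \<sigma> T] in \<open>auto simp: fst_induced Int_absorb1\<close>)
    ultimately show "f (induced (relabel \<sigma> g) (\<sigma> ` T)) c' = f (induced g T) c" by simp
  qed
  finally show "transversal_cochain p f (relabel \<sigma> g) c' = transversal_cochain p f g c"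
    by (simp add: transversal_cochain_def)
qed

text \<open>A transversal of the \<open>i\<close>-th face is a set that meets every block once except for one of the two
  merged blocks, which it omits; an end face omits the deleted block.\<close>

lemma collapse_bij_iff:
  assumes c: "\<And>v. v \<in> V \<Longrightarrow> c v \<le> p" and i: "i \<le> p + 1"
  shows "T \<subseteq> kept V p i c \<and> bij_betw (collapse i c) T {..<p} \<longleftrightarrow>
    T \<subseteq> V \<and> (1 \<le> i \<and> bij_betw c T ({..p} - {i - 1}) \<or> i \<le> p \<and> bij_betw c T ({..p} - {i}))"
    (is "?L \<longleftrightarrow> ?R")
proof
  have skip: "bij_betw (\<lambda>k. if j \<le> k then k - 1 else k) ({..p} - {j'}) {..<p}"
    if "j' \<le> p" "j = j' \<or> j = Suc j'" for j j' :: nat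
    by (rule bij_betw_byWitness[where f' = "\<lambda>k. if j' \<le> k then k + 1 else k"]) (use that in auto)
  {
    assume R: ?R
    then consider (low) "1 \<le> i" "bij_betw c T ({..p} - {i - 1})" | (high) "i \<le> p" "bij_betw c T ({..p} - {i})" by blast
    then show ?L
    proof cases
      case low
      have "bij_betw ((\<lambda>k. if i \<le> k then k - 1 else k) \<circ> c) T {..<p}"
        by (rule bij_betw_trans[OF low(2) skip]) (use low i in auto)
      moreover have "T \<subseteq> kept V p i c" using R low i by (auto simp: kept_def bij_betw_def)
      ultimately show ?thesis by (simp add: collapse_def[abs_def] comp_def)
    next
      case high
      have "bij_betw ((\<lambda>k. if i \<le> k then k - 1 else k) \<circ> c) T {..<p}"
        by (rule bij_betw_trans[OF high(2) skip]) (use high i in auto)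
      moreover have "T \<subseteq> kept V p i c" using R high i by (auto simp: kept_def bij_betw_def)
      ultimately show ?thesis by (simp add: collapse_def[abs_def] comp_def)
    qed
  }
  assume L: ?L
  have T: "T \<subseteq> V" by (rule order_trans[OF conjunct1[OF L] kept_subset])
  have injc: "x = y" if "x \<in> T" "y \<in> T" "collapse i c x = collapse i c y" for x y
    by (rule inj_onD[OF bij_betw_imp_inj_on[OF conjunct2[OF L]] that(3,1,2)])
  have inj: "inj_on c T"
  proof (rule inj_onI)
    fix x y assume xy: "x \<in> T" "y \<in> T" "c x = c y"
    then have "collapse i c x = collapse i c y" by (simp only: collapse_def)
    then show "x = y" by (rule injc[OF xy(1,2)])
  qed
  have le: "c ` T \<subseteq> {..p}"
  proof
    fix k assume "k \<in> c ` T"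
    then obtain v where "v \<in> T" "k = c v" by blast
    then show "k \<in> {..p}" using c[of v] T by auto
  qed
  have fin: "finite (c ` T)" using le by (rule finite_subset) simp
  have "card (c ` T) = p"
    using card_image[OF inj] bij_betw_same_card[of "collapse i c" T "{..<p}"] L by simp
  then have "card ({..p} - c ` T) = 1" using card_Diff_subset[OF fin le] by simp
  then obtain j where j: "{..p} - c ` T = {j}" by (auto simp: card_1_singleton_iff)
  then have jp: "j \<le> p" and cT: "c ` T = {..p} - {j}" using le by auto
  have "j = i \<or> Suc j = i"
  proof (rule ccontr)
    assume no: "\<not> (j = i \<or> Suc j = i)"
    have no0: False if "i = 0"
    proof -
      have "0 \<in> c ` T" using cT no that by auto
      then show False using L that by (auto simp: kept_def)
    qed
    have noend: False if "i = p + 1"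
    proof -
      have "p \<in> c ` T" using cT no that by auto
      then show False using L that by (auto simp: kept_def)
    qed
    have "i - 1 \<in> c ` T" "i \<in> c ` T" using cT no no0 noend i by (auto simp: le_Suc_eq)
    then obtain x y where xy: "x \<in> T" "y \<in> T" "c x = i - 1" "c y = i" by auto
    then have "collapse i c x = collapse i c y" using no0 by (auto simp: collapse_def)
    then have "x = y" by (rule injc[OF xy(1,2)])
    then show False using xy no0 by (cases i) auto
  qed
  then show ?R using T inj cT jp by (auto simp: bij_betw_def)
qed

text \<open>With \<open>A j\<close> the sum over the sets omitting exactly the block \<open>j\<close>, the \<open>i\<close>-th face contributes
  \<open>A (i - 1) + A i\<close>, and the end faces \<open>A 0\<close> and \<open>A p\<close>; the alternating sum telescopes.\<close>

lemma transversal_cochain_cocycle: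
  fixes f :: "'a graph \<Rightarrow> ('a \<Rightarrow> nat) \<Rightarrow> 'k::comm_ring_1"
  assumes f: "natural f" and g: "fin_graph g" and c: "\<And>v. v \<in> fst g \<Longrightarrow> c v \<le> p"
  shows "graph_coboundary p (transversal_cochain p f) g c = 0"
proof -
  let ?T = "\<lambda>j. {T. T \<subseteq> fst g \<and> bij_betw c T ({..p} - {j})}"
  define A where "A j = (\<Sum>T\<in>?T j. f (induced g T) (collapse (j + 1) c))" for j
  have finT: "finite (?T j)" for j
    by (rule finite_subset[of _ "Pow (fst g)"]) (use g in \<open>auto simp: fin_graph_def\<close>)
  have face: "transversal_cochain p f (induced g (kept (fst g) p i c)) (collapse i c) =
      (if 1 \<le> i then A (i - 1) else 0) + (if i \<le> p then A i else 0)" if i: "i \<le> p + 1" for i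
  proof -
    let ?K = "kept (fst g) p i c"
    have "transversal_cochain p f (induced g ?K) (collapse i c) =
        (\<Sum>T | T \<subseteq> ?K \<and> bij_betw (collapse i c) T {..<p}. f (induced g T) (collapse i c))"
      unfolding transversal_cochain_def fst_induced_kept induced_induced
      by (rule sum.cong) (auto simp: Int_absorb1)
    also have "{T. T \<subseteq> ?K \<and> bij_betw (collapse i c) T {..<p}} =
        (if 1 \<le> i then ?T (i - 1) else {}) \<union> (if i \<le> p then ?T i else {})"
    proof -
      have "T \<subseteq> ?K \<and> bij_betw (collapse i c) T {..<p} \<longleftrightarrow>
        T \<in> (if 1 \<le> i then ?T (i - 1) else {}) \<union> (if i \<le> p then ?T i else {})" for T
      proof -
        have "T \<subseteq> ?K \<and> bij_betw (collapse i c) T {..<p} \<longleftrightarrow> T \<subseteq> fst g \<and>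
          (1 \<le> i \<and> bij_betw c T ({..p} - {i - 1}) \<or> i \<le> p \<and> bij_betw c T ({..p} - {i}))"
          by (rule collapse_bij_iff) (use c i in auto)
        then show ?thesis by auto
      qed
      then show ?thesis by blast
    qed
    also have "(\<Sum>T\<in>\<dots>. f (induced g T) (collapse i c)) =
        (\<Sum>T\<in>(if 1 \<le> i then ?T (i - 1) else {}). f (induced g T) (collapse i c)) +
        (\<Sum>T\<in>(if i \<le> p then ?T i else {}). f (induced g T) (collapse i c))"
    proof (rule sum.union_disjoint)
      have False if "1 \<le> i" "i \<le> p" "bij_betw c T ({..p} - {i - 1})" "bij_betw c T ({..p} - {i})" for T
      proof -
        have "i \<in> {..p} - {i - 1}" using that(1,2) by auto
        also have "\<dots> = {..p} - {i}" using that(3,4)[THEN bij_betw_imp_surj_on] by simp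
        finally show False by simp
      qed
      then show "(if 1 \<le> i then ?T (i - 1) else {}) \<inter> (if i \<le> p then ?T i else {}) = {}" by auto
    qed (use finT in auto)
    also have "(\<Sum>T\<in>(if 1 \<le> i then ?T (i - 1) else {}). f (induced g T) (collapse i c)) = (if 1 \<le> i then A (i - 1) else 0)"
      by (simp add: A_def)
    also have "(\<Sum>T\<in>(if i \<le> p then ?T i else {}). f (induced g T) (collapse i c)) = (if i \<le> p then A i else 0)"
    proof -
      have "f (induced g T) (collapse i c) = f (induced g T) (collapse (i + 1) c)" if T: "T \<in> ?T i" for T
      proof (rule natural_cong[OF f fin_graph_induced[OF g]])
        fix v assume "v \<in> fst (induced g T)"
        then have "c v \<noteq> i" using T by (auto simp: fst_induced bij_betw_def)
        then show "collapse i c v = collapse (i + 1) c v" by (simp add: collapse_def)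
      qed
      then show ?thesis by (simp add: A_def)
    qed
    finally show ?thesis .
  qed
  have "graph_coboundary p (transversal_cochain p f) g c =
    (\<Sum>i\<le>p + 1. (- 1) ^ i * ((if 1 \<le> i then A (i - 1) else 0) + (if i \<le> p then A i else 0)))"
    unfolding graph_coboundary_def by (rule sum.cong) (simp_all add: face)
  also have "\<dots> = (\<Sum>i\<le>p + 1. (- 1) ^ i * (if 1 \<le> i then A (i - 1) else 0)) + (\<Sum>i\<le>p + 1. (- 1) ^ i * (if i \<le> p then A i else 0))"
    by (simp only: distrib_left sum.distrib)
  also have "(\<Sum>i\<le>p + 1. (- 1) ^ i * (if 1 \<le> i then A (i - 1) else 0)) = (\<Sum>i\<le>p. (- 1) ^ Suc i * A i)"
    unfolding Suc_eq_plus1[symmetric] sum.atMost_Suc_shift by simp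
  also have "(\<Sum>i\<le>p + 1. (- 1) ^ i * (if i \<le> p then A i else 0)) = (\<Sum>i\<le>p. (- 1) ^ i * A i)"
    by simp
  finally show ?thesis by (simp add: sum_negf)
qed

lemma transversal_cochain_full:
  assumes g: "fin_graph g" and c: "bij_betw c (fst g) {..<p}"
  shows "transversal_cochain p f g c = f g c"
proof -
  have "{T. T \<subseteq> fst g \<and> bij_betw c T {..<p}} = {fst g}"
  proof (rule subset_antisym; rule subsetI)
    fix T assume "T \<in> {T. T \<subseteq> fst g \<and> bij_betw c T {..<p}}"
    then have "T \<subseteq> fst g" "card T = card (fst g)"
      using bij_betw_same_card[OF c] bij_betw_same_card[of c T] by auto
    then show "T \<in> {fst g}" using card_subset_eq g by (auto simp: fin_graph_def)
  qed (use c in auto)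
  then show ?thesis by (simp add: transversal_cochain_def induced_all[OF g])
qed

section \<open>Graphs with vertices 0, ..., p - 1\<close>

definition even_graphs :: "nat \<Rightarrow> nat graph set" where
  "even_graphs p = {G \<in> graphs {..<p}. \<forall>\<tau>. automorphism \<tau> G \<longrightarrow> evenperm \<tau>}"

definition iso_rel :: "nat \<Rightarrow> (nat graph \<times> nat graph) set" where
  "iso_rel p = {(G, H). G \<in> even_graphs p \<and> H \<in> even_graphs p \<and> (\<exists>\<tau>. \<tau> permutes {..<p} \<and> relabel \<tau> G = H)}"

lemma relabel_inv:
  assumes "\<tau> permutes S" "relabel \<tau> G = H"
  shows "relabel (inv_into UNIV \<tau>) H = G"
  using assms by (auto simp: relabel_relabel permutes_inv_o relabel_id)

lemma equiv_iso_rel: "equiv (even_graphs p) (iso_rel p)"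
proof (rule equivI)
  show "iso_rel p \<subseteq> even_graphs p \<times> even_graphs p" by (auto simp: iso_rel_def)
  show "refl_on (even_graphs p) (iso_rel p)"
    by (auto simp: refl_on_def iso_rel_def intro!: exI[of _ id] permutes_id relabel_id)
  show "sym (iso_rel p)"
  proof (rule symI)
    fix G H assume "(G, H) \<in> iso_rel p"
    then obtain \<tau> where \<tau>: "\<tau> permutes {..<p}" "relabel \<tau> G = H" "G \<in> even_graphs p" "H \<in> even_graphs p"
      by (auto simp: iso_rel_def)
    show "(H, G) \<in> iso_rel p"
      unfolding iso_rel_def using permutes_inv[OF \<tau>(1)] relabel_inv[OF \<tau>(1,2)] \<tau>(3,4) by blast
  qed
  show "trans (iso_rel p)"
  proof (rule transI)
    fix G H L assume "(G, H) \<in> iso_rel p" "(H, L) \<in> iso_rel p"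
    then obtain \<tau> \<sigma> where \<tau>: "\<tau> permutes {..<p}" "relabel \<tau> G = H" "\<sigma> permutes {..<p}" "relabel \<sigma> H = L"
      and e: "G \<in> even_graphs p" "L \<in> even_graphs p"
      by (auto simp: iso_rel_def)
    have "relabel (\<sigma> \<circ> \<tau>) G = L" using \<tau> by (simp flip: relabel_relabel)
    then show "(G, L) \<in> iso_rel p"
      unfolding iso_rel_def using permutes_compose[OF \<tau>(1,3)] e by blast
  qed
qed

lemma graphs_permutes: "G \<in> graphs S \<Longrightarrow> \<tau> permutes S \<Longrightarrow> relabel \<tau> G \<in> graphs S"
  using relabel_graphs[of \<tau> S G] by (simp add: permutes_inj_on permutes_image)

lemma finite_graphs: "finite I \<Longrightarrow> finite (graphs I)"
  by (rule finite_subset[of _ "{I} \<times> Pow (Pow I)"]) (auto simp: graphs_def)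

lemma finite_even_graphs: "finite (even_graphs p)"
  by (rule finite_subset[OF _ finite_graphs[of "{..<p}"]]) (auto simp: even_graphs_def)

lemma even_graphs_relabel:
  assumes G: "G \<in> even_graphs p" and \<tau>: "\<tau> permutes {..<p}"
  shows "relabel \<tau> G \<in> even_graphs p"
proof -
  have g: "G \<in> graphs {..<p}" using G by (simp add: even_graphs_def)
  have "evenperm \<sigma>" if "automorphism \<sigma> (relabel \<tau> G)" for \<sigma>
  proof -
    have \<sigma>: "\<sigma> permutes {..<p}" "relabel \<sigma> (relabel \<tau> G) = relabel \<tau> G"
      using that graphsD(1)[OF graphs_permutes[OF g \<tau>]] by (auto simp: automorphism_def)
    let ?\<rho> = "inv_into UNIV \<tau> \<circ> \<sigma> \<circ> \<tau>"
    have i: "inv_into UNIV \<tau> permutes {..<p}" by (rule permutes_inv[OF \<tau>])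
    have "relabel ?\<rho> G = relabel (inv_into UNIV \<tau>) (relabel \<sigma> (relabel \<tau> G))"
      by (simp add: relabel_relabel comp_assoc)
    then have "relabel ?\<rho> G = G" using \<sigma> relabel_inv[OF \<tau>] by simp
    moreover have r: "?\<rho> permutes {..<p}" using \<tau> i \<sigma> by (intro permutes_compose)
    ultimately have "evenperm ?\<rho>" using G graphsD(1)[OF g] by (auto simp: even_graphs_def automorphism_def)
    then have "sign ?\<rho> = 1" by (simp add: sign_def)
    moreover have "sign ?\<rho> = sign (inv_into UNIV \<tau>) * sign \<sigma> * sign \<tau>"
      using \<tau> i \<sigma> by (simp add: sign_permutes_compose[of _ "{..<p}"] permutes_compose)
    moreover have "sign (inv_into UNIV \<tau>) = sign \<tau>"
      using \<tau> by (intro sign_inverse permutes_imp_permutation[of "{..<p}"]) auto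
    ultimately have "sign \<sigma> = 1" by (auto simp: sign_def split: if_splits)
    then show ?thesis by (simp add: sign_def split: if_splits)
  qed
  then show ?thesis using graphs_permutes[OF g \<tau>] by (simp add: even_graphs_def)
qed

definition std_set :: "nat \<Rightarrow> 'a::infinite set" where
  "std_set p = (SOME K. finite K \<and> card K = p)"

definition std_colouring :: "nat \<Rightarrow> 'a::infinite \<Rightarrow> nat" where
  "std_colouring p = (SOME e. bij_betw e (std_set p) {..<p})"

text \<open>All graphs on \<open>p\<close> vertices of type \<open>'a\<close> are compared with graphs on the numbers below \<open>p\<close> through
  one fixed set of size \<open>p\<close> and one fixed enumeration of it.\<close>

definition lift_graph :: "nat \<Rightarrow> nat graph \<Rightarrow> 'a::infinite graph" where
  "lift_graph p G = relabel (inv_into (std_set p) (std_colouring p)) G"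

lemma std_set: "finite (std_set p :: 'a::infinite set)" "card (std_set p :: 'a set) = p"
proof -
  have "\<exists>K :: 'a set. finite K \<and> card K = p"
    using infinite_arbitrarily_large[OF infinite_UNIV] by blast
  from someI_ex[OF this] show "finite (std_set p :: 'a set)" "card (std_set p :: 'a set) = p"
    by (simp_all add: std_set_def)
qed

lemma std_colouring: "bij_betw (std_colouring p) (std_set p :: 'a::infinite set) {..<p}"
proof -
  have "\<exists>e. bij_betw e (std_set p :: 'a set) {..<p}"
    by (rule finite_same_card_bij) (simp_all add: std_set)
  from someI_ex[OF this] show ?thesis by (simp add: std_colouring_def)
qed

lemma lift_graph_graphs:
  assumes "G \<in> graphs {..<p}" shows "(lift_graph p G :: 'a::infinite graph) \<in> graphs (std_set p)"
proof -
  have "bij_betw (inv_into (std_set p) (std_colouring p)) {..<p} (std_set p :: 'a set)"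
    by (rule bij_betw_inv_into[OF std_colouring])
  then show ?thesis using relabel_graphs[OF _ assms] by (metis bij_betw_def lift_graph_def)
qed

lemma lift_graph_fin:
  assumes "G \<in> graphs {..<p}" shows "fin_graph (lift_graph p G :: 'a::infinite graph)"
proof -
  have h: "(lift_graph p G :: 'a graph) \<in> graphs (std_set p)" by (rule lift_graph_graphs[OF assms])
  then show ?thesis using graphsD(1)[OF h] std_set(1)[where 'a = 'a] by (simp add: fin_graph_def)
qed

lemma antisym_eq_lift:
  fixes a :: "'a::infinite graph \<Rightarrow> ('a \<Rightarrow> nat) \<Rightarrow> 'k::comm_ring_1"
  assumes a: "natural a" and h: "fin_graph h" and c: "bij_betw c (fst h) {..<p}"
  shows "antisymmetrize p (a h) c = antisymmetrize p (a (lift_graph p (relabel c h))) (std_colouring p)"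
  unfolding antisymmetrize_def
proof (rule sum.cong[OF refl])
  fix \<sigma>
  let ?e = "std_colouring p :: 'a \<Rightarrow> nat" and ?K = "std_set p :: 'a set"
  let ?u = "inv_into ?K ?e \<circ> c"
  have b: "bij_betw ?u (fst h) ?K" by (rule bij_betw_trans[OF c bij_betw_inv_into[OF std_colouring]])
  have "a (relabel ?u h) (\<sigma> \<circ> ?e) = a h (\<sigma> \<circ> c)"
  proof (rule naturalD[OF a h bij_betw_imp_inj_on[OF b]])
    fix v assume "v \<in> fst h"
    then have "c v \<in> ?e ` ?K" using c std_colouring[of p] by (metis bij_betw_def image_eqI)
    then show "(\<sigma> \<circ> ?e) (?u v) = (\<sigma> \<circ> c) v" by (simp add: f_inv_into_f)
  qed
  then show "of_int (sign \<sigma>) * a h (\<sigma> \<circ> c) = of_int (sign \<sigma>) * a (lift_graph p (relabel c h)) (\<sigma> \<circ> ?e)"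
    by (simp only: lift_graph_def relabel_relabel)
qed

lemma relabel_std_lift:
  assumes "G \<in> graphs {..<p}"
  shows "relabel (std_colouring p) (lift_graph p G :: 'a::infinite graph) = G"
proof -
  let ?e = "std_colouring p :: 'a \<Rightarrow> nat" and ?K = "std_set p :: 'a set"
  have "relabel (?e \<circ> inv_into ?K ?e) G = relabel id G"
  proof (rule relabel_cong[OF assms])
    fix x assume "x \<in> {..<p}"
    then have "x \<in> ?e ` ?K" using std_colouring[of p] by (metis bij_betw_def)
    then show "(?e \<circ> inv_into ?K ?e) x = id x" by (simp add: f_inv_into_f)
  qed
  then show ?thesis by (simp add: lift_graph_def relabel_relabel relabel_id)
qed

definition antisym_at :: "nat \<Rightarrow> ('a::infinite graph \<Rightarrow> ('a \<Rightarrow> nat) \<Rightarrow> 'k::comm_ring_1) \<Rightarrow> nat graph \<Rightarrow> 'k" where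
  "antisym_at p a G = antisymmetrize p (a (lift_graph p G)) (std_colouring p)"

text \<open>As a function of numbered graphs the antisymmetrization changes by the sign under renumbering. So
  it vanishes at graphs with an odd automorphism and is determined by one value for every other
  isomorphism class.\<close>

lemma antisym_at_relabel:
  fixes a :: "'a::infinite graph \<Rightarrow> ('a \<Rightarrow> nat) \<Rightarrow> 'k::comm_ring_1"
  assumes a: "natural a" and G: "G \<in> graphs {..<p}" and \<tau>: "\<tau> permutes {..<p}"
  shows "antisym_at p a (relabel \<tau> G) = of_int (sign \<tau>) * antisym_at p a G"
proof -
  let ?h = "lift_graph p G :: 'a graph" and ?e = "std_colouring p :: 'a \<Rightarrow> nat"
  have V: "fst ?h = std_set p" by (rule graphsD(1)[OF lift_graph_graphs[OF G]])
  have "antisymmetrize p (a ?h) (\<tau> \<circ> ?e) = antisymmetrize p (a (lift_graph p (relabel (\<tau> \<circ> ?e) ?h))) ?e"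
    by (rule antisym_eq_lift[OF a lift_graph_fin[OF G]])
      (unfold V, rule bij_betw_trans[OF std_colouring permutes_imp_bij[OF \<tau>]])
  also have "relabel (\<tau> \<circ> ?e) ?h = relabel \<tau> G"
    using relabel_std_lift[OF G, where 'a = 'a] by (simp flip: relabel_relabel)
  finally show ?thesis unfolding antisym_at_def antisym_compose[OF \<tau>] by (rule sym)
qed

definition class_rep :: "nat graph set \<Rightarrow> nat graph" where
  "class_rep C = (SOME G. G \<in> C)"

lemma class_rep:
  assumes "C \<in> even_graphs p // iso_rel p"
  shows "class_rep C \<in> C" "class_rep C \<in> even_graphs p" "iso_rel p `` {class_rep C} = C"
proof -
  obtain G where G: "G \<in> even_graphs p" "C = iso_rel p `` {G}" using assms by (auto elim: quotientE)
  then have "G \<in> C" using equiv_class_self[OF equiv_iso_rel] by blast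
  then show 1: "class_rep C \<in> C" unfolding class_rep_def by (rule someI)
  then have "(G, class_rep C) \<in> iso_rel p" using G by auto
  then show "class_rep C \<in> even_graphs p" by (auto simp: iso_rel_def)
  show "iso_rel p `` {class_rep C} = C"
    using equiv_class_eq[OF equiv_iso_rel \<open>(G, class_rep C) \<in> iso_rel p\<close>] G(2) by simp
qed

lemma antisym_zero_if_zero_on_classes:
  fixes a :: "'a::infinite graph \<Rightarrow> ('a \<Rightarrow> nat) \<Rightarrow> 'k::field_char_0"
  assumes a: "natural a" and z: "\<And>C. C \<in> even_graphs p // iso_rel p \<Longrightarrow> antisym_at p a (class_rep C) = 0"
    and h: "fin_graph h" and c: "bij_betw c (fst h) {..<p}"
  shows "antisymmetrize p (a h) c = 0"
proof -
  let ?G = "relabel c h"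
  have "h \<in> graphs (fst h)" using h by (simp add: fin_graph_def)
  then have G: "?G \<in> graphs {..<p}" using relabel_graphs[of c "fst h" h] c by (simp add: bij_betw_def)
  have "antisym_at p a ?G = 0"
  proof (cases "?G \<in> even_graphs p")
    case True
    let ?C = "iso_rel p `` {?G}"
    have C: "?C \<in> even_graphs p // iso_rel p" using True by (rule quotientI)
    have "(?G, class_rep ?C) \<in> iso_rel p" using class_rep(1)[OF C] by simp
    then obtain \<tau> where "\<tau> permutes {..<p}" "relabel \<tau> ?G = class_rep ?C" by (auto simp: iso_rel_def)
    then have "of_int (sign \<tau>) * antisym_at p a ?G = 0"
      using antisym_at_relabel[OF a G] z[OF C] by metis
    then show ?thesis by (auto simp: sign_def split: if_splits)
  next
    case False
    then obtain \<tau> where \<tau>: "automorphism \<tau> ?G" "\<not> evenperm \<tau>" using G by (auto simp: even_graphs_def)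
    then have "\<tau> permutes {..<p}" "relabel \<tau> ?G = ?G" using graphsD(1)[OF G] by (auto simp: automorphism_def)
    then have "antisym_at p a ?G = - antisym_at p a ?G"
      using antisym_at_relabel[OF a G, of \<tau>] \<tau>(2) by (simp add: sign_def)
    then show ?thesis by simp
  qed
  then show ?thesis using antisym_eq_lift[OF a h c] by (simp add: antisym_at_def)
qed

text \<open>The values \<open>y\<close> on classes extend to a sign-equivariant function \<open>F\<close> of numbered graphs: the sum of the
  signs of all renumberings \<open>\<tau>\<close> that turn the representative into the given graph. This does not
  vanish at the representative, because all its automorphisms are even; there it is their number
  \<open>n C\<close>, by which \<open>F\<close> is normalized. The factor \<open>fact p\<close> compensates for antisymmetrizing a function that is
  already antisymmetric.\<close>

lemma cocycle_with_prescribed_antisym: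
  fixes y :: "nat graph set \<Rightarrow> 'k::field_char_0"
  obtains a :: "'a::infinite graph \<Rightarrow> ('a \<Rightarrow> nat) \<Rightarrow> 'k"
  where "natural a" "\<And>g c. fin_graph g \<Longrightarrow> (\<And>v. v \<in> fst g \<Longrightarrow> c v \<le> p) \<Longrightarrow> graph_coboundary p a g c = 0"
    "\<And>C. C \<in> even_graphs p // iso_rel p \<Longrightarrow> antisym_at p a (class_rep C) = y C"
proof -
  let ?Q = "even_graphs p // iso_rel p" and ?P = "{\<tau>. \<tau> permutes {..<p}}"
  define w where "w C G = (\<Sum>\<tau>\<in>?P. if relabel \<tau> (class_rep C) = G then of_int (sign \<tau>) else 0 :: 'k)" for C G
  define n where "n C = card {\<tau> \<in> ?P. relabel \<tau> (class_rep C) = class_rep C}" for C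
  define F where "F G = (\<Sum>C\<in>?Q. y C / (of_nat (n C) * fact p) * w C G)" for G
  define f where "f h c = F (relabel c h)" for h :: "'a graph" and c
  have finQ: "finite ?Q" by (rule finite_quotient[OF finite_even_graphs]) (auto simp: iso_rel_def)
  have finP: "finite ?P" by (simp add: finite_permutations)
  have "natural f"
    unfolding natural_def f_def
  proof (intro allI impI)
    fix g :: "'a graph" and \<sigma> :: "'a \<Rightarrow> 'a" and c c' :: "'a \<Rightarrow> nat"
    assume g: "fin_graph g" and c: "\<forall>v\<in>fst g. c' (\<sigma> v) = c v"
    have "relabel (c' \<circ> \<sigma>) g = relabel c g"
      by (rule relabel_cong) (use g c in \<open>auto simp: fin_graph_def\<close>)
    then show "F (relabel c' (relabel \<sigma> g)) = F (relabel c g)" by (simp add: relabel_relabel)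
  qed
  have w_relabel: "w C (relabel \<rho> G) = of_int (sign \<rho>) * w C G" if \<rho>: "\<rho> permutes {..<p}" for C \<rho> G
  proof -
    have "w C (relabel \<rho> G) = (\<Sum>\<tau>\<in>?P. if relabel (\<rho> \<circ> \<tau>) (class_rep C) = relabel \<rho> G then of_int (sign (\<rho> \<circ> \<tau>)) else 0)"
      unfolding w_def by (rule setum_permutations_compose_left[OF \<rho>])
    also have "\<dots> = (\<Sum>\<tau>\<in>?P. of_int (sign \<rho>) * (if relabel \<tau> (class_rep C) = G then of_int (sign \<tau>) else 0))"
    proof (rule sum.cong[OF refl])
      fix \<tau> assume "\<tau> \<in> ?P"
      then have "sign (\<rho> \<circ> \<tau>) = sign \<rho> * sign \<tau>" using \<rho> by (simp add: sign_permutes_compose)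
      moreover have "relabel (\<rho> \<circ> \<tau>) (class_rep C) = relabel \<rho> G \<longleftrightarrow> relabel \<tau> (class_rep C) = G"
        using relabel_inv[OF \<rho> refl, of G] relabel_inv[OF \<rho> refl, of "relabel \<tau> (class_rep C)"]
        unfolding relabel_relabel[symmetric, of \<rho> \<tau>] by metis
      ultimately show "(if relabel (\<rho> \<circ> \<tau>) (class_rep C) = relabel \<rho> G then of_int (sign (\<rho> \<circ> \<tau>)) else 0) =
         of_int (sign \<rho>) * (if relabel \<tau> (class_rep C) = G then of_int (sign \<tau>) else (0 :: 'k))" by simp
    qed
    finally show ?thesis by (simp add: w_def sum_distrib_left)
  qed
  have F_relabel: "F (relabel \<rho> G) = of_int (sign \<rho>) * F G" if \<rho>: "\<rho> permutes {..<p}" for \<rho> G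
    unfolding F_def w_relabel[OF \<rho>] sum_distrib_left by (simp only: mult.left_commute)
  have F_rep: "F (class_rep C) = y C / fact p" if C: "C \<in> ?Q" for C
  proof -
    have w0: "w C' (class_rep C) = 0" if C': "C' \<in> ?Q" "C' \<noteq> C" for C'
      unfolding w_def
    proof (rule sum.neutral, intro ballI)
      fix \<tau> assume \<tau>: "\<tau> \<in> ?P"
      have "relabel \<tau> (class_rep C') \<noteq> class_rep C"
      proof
        assume "relabel \<tau> (class_rep C') = class_rep C"
        then have "(class_rep C', class_rep C) \<in> iso_rel p"
          using class_rep(2)[OF C] class_rep(2)[OF C'(1)] \<tau> by (auto simp: iso_rel_def)
        then have "iso_rel p `` {class_rep C'} = iso_rel p `` {class_rep C}"
          by (rule equiv_class_eq[OF equiv_iso_rel])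
        then show False using class_rep(3)[OF C] class_rep(3)[OF C'(1)] C'(2) by simp
      qed
      then show "(if relabel \<tau> (class_rep C') = class_rep C then of_int (sign \<tau>) else (0 :: 'k)) = 0" by simp
    qed
    have "w C (class_rep C) = of_nat (n C)"
    proof -
      have ev: "sign \<tau> = 1" if "\<tau> \<in> ?P" "relabel \<tau> (class_rep C) = class_rep C" for \<tau>
        using class_rep(2)[OF C] that graphsD(1)[of "class_rep C" "{..<p}"]
        by (auto simp: even_graphs_def automorphism_def sign_def)
      have "w C (class_rep C) = (\<Sum>\<tau>\<in>?P. if relabel \<tau> (class_rep C) = class_rep C then 1 else 0)"
        unfolding w_def by (rule sum.cong) (auto simp: ev)
      also have "\<dots> = of_nat (n C)"
        using finP by (simp add: n_def sum.If_cases Int_def)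
      finally show ?thesis .
    qed
    moreover have "n C \<noteq> 0"
    proof -
      have "id \<in> {\<tau> \<in> ?P. relabel \<tau> (class_rep C) = class_rep C}" by (simp add: permutes_id relabel_id)
      then show ?thesis unfolding n_def using finP by (metis (no_types, lifting) card_0_eq empty_iff finite_Collect_conjI mem_Collect_eq finite_subset Collect_mono)
    qed
    moreover have "F (class_rep C) = (\<Sum>C'\<in>?Q. if C' = C then y C / (of_nat (n C) * fact p) * w C (class_rep C) else 0)"
      unfolding F_def by (rule sum.cong) (auto simp: w0)
    ultimately show ?thesis using C finQ by simp
  qed
  let ?a = "transversal_cochain p f"
  have "antisym_at p ?a (class_rep C) = y C" if C: "C \<in> ?Q" for C
  proof -
    have G: "class_rep C \<in> graphs {..<p}" using class_rep(2)[OF C] by (simp add: even_graphs_def)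
    let ?h = "lift_graph p (class_rep C) :: 'a graph" and ?e = "std_colouring p :: 'a \<Rightarrow> nat"
    have V: "fst ?h = std_set p" by (rule graphsD(1)[OF lift_graph_graphs[OF G]])
    have "antisym_at p ?a (class_rep C) = (\<Sum>\<sigma>\<in>?P. y C / fact p)"
      unfolding antisym_at_def antisymmetrize_def
    proof (rule sum.cong[OF refl])
      fix \<sigma> assume "\<sigma> \<in> ?P"
      then have \<sigma>: "\<sigma> permutes {..<p}" by simp
      have "?a ?h (\<sigma> \<circ> ?e) = f ?h (\<sigma> \<circ> ?e)"
        by (rule transversal_cochain_full[OF lift_graph_fin[OF G]])
          (unfold V, rule bij_betw_trans[OF std_colouring permutes_imp_bij[OF \<sigma>]])
      also have "\<dots> = F (relabel \<sigma> (relabel ?e ?h))" by (simp add: f_def relabel_relabel)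
      also have "\<dots> = of_int (sign \<sigma>) * (y C / fact p)"
        unfolding relabel_std_lift[OF G] F_relabel[OF \<sigma>] F_rep[OF C] ..
      finally show "of_int (sign \<sigma>) * ?a ?h (\<sigma> \<circ> ?e) = y C / fact p"
        by (simp add: sign_def)
    qed
    then show ?thesis by (simp add: card_permutations)
  qed
  with natural_transversal_cochain[OF \<open>natural f\<close>] transversal_cochain_cocycle[OF \<open>natural f\<close>]
  show thesis by (intro that[of ?a]) blast+
qed

section \<open>Dimensions of free modules and of quotients\<close>

definition single :: "'b \<Rightarrow> 'b \<Rightarrow> 'k::field" where
  "single g = (\<lambda>h. if h = g then 1 else 0)"

lemma single_carrier: "g \<in> B \<Longrightarrow> (single g :: 'b \<Rightarrow> 'k::field) \<in> carrier (free_mod B)"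
  by (auto simp: free_mod_def single_def)

lemma inj_single: "inj (single :: 'b \<Rightarrow> 'b \<Rightarrow> 'k::field)"
proof (rule injI)
  fix x y :: 'b assume "(single x :: 'b \<Rightarrow> 'k) = single y"
  then have "(single x :: 'b \<Rightarrow> 'k) x = single y x" by simp
  then show "x = y" by (simp add: single_def split: if_splits)
qed

lemma free_mod_dim:
  fixes B :: "'b set"
  assumes B: "finite B"
  shows "vectorspace.fin_dim class_ring (free_mod B :: ('k::field, 'b \<Rightarrow> 'k) module)"
    "vectorspace.dim class_ring (free_mod B :: ('k::field, 'b \<Rightarrow> 'k) module) = card B"
proof -
  let ?V = "free_mod B :: ('k, 'b \<Rightarrow> 'k) module"
  interpret V: vectorspace class_ring ?V by (rule free_mod_vectorspace)
  let ?A = "single ` B :: ('b \<Rightarrow> 'k) set"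
  have A: "finite ?A" "?A \<subseteq> carrier ?V" using B single_carrier by auto
  have lincomb: "V.lincomb a (single ` S) = (\<lambda>q. if q \<in> S then a (single q) else 0)"
    if "S \<subseteq> B" for a :: "('b \<Rightarrow> 'k) \<Rightarrow> 'k" and S
    using finite_subset[OF that B] that
  proof (induction S rule: finite_induct)
    case empty
    have "V.lincomb a {} = \<zero>\<^bsub>?V\<^esub>" by (simp add: V.lincomb_def)
    also have "\<dots> = (\<lambda>q. 0)" by (simp add: free_mod_def)
    finally show ?case by simp
  next
    case (insert x S)
    have "V.lincomb a (insert (single x) (single ` S)) =
      a (single x) \<odot>\<^bsub>?V\<^esub> single x \<oplus>\<^bsub>?V\<^esub> V.lincomb a (single ` S)"
    proof (rule V.lincomb_insert2)
      show "finite (single ` S :: ('b \<Rightarrow> 'k) set)" using insert.hyps(1) by simp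
      show "(single ` S :: ('b \<Rightarrow> 'k) set) \<subseteq> carrier ?V"
        using insert.prems single_carrier[of _ B] by blast
      show "single x \<in> carrier ?V" using insert.prems by (intro single_carrier) simp
      show "(single x :: 'b \<Rightarrow> 'k) \<notin> single ` S"
        using insert.hyps(2) by (simp only: inj_image_mem_iff[OF inj_single] not_False_eq_True)
    qed simp
    also have "\<dots> = (\<lambda>q. a (single x) * single x q + V.lincomb a (single ` S) q)"
      by (simp add: free_mod_def)
    also have "\<dots> = (\<lambda>q. if q \<in> insert x S then a (single q) else 0)"
      using insert by (auto simp: single_def fun_eq_iff)
    finally show ?case by simp
  qed
  have "V.basis ?A"
    unfolding V.basis_def
  proof (intro conjI)
    show "V.lin_indpt ?A"
    proof (rule V.finite_lin_indpt2[OF A])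
      fix a :: "('b \<Rightarrow> 'k) \<Rightarrow> 'k" assume "V.lincomb a ?A = \<zero>\<^bsub>?V\<^esub>"
      then have "(\<lambda>q. if q \<in> B then a (single q) else 0) = (\<lambda>q. 0)"
        unfolding lincomb[OF order_refl] by (simp add: free_mod_def)
      then have "a (single q) = 0" if "q \<in> B" for q using that by (metis (full_types))
      then show "\<forall>v\<in>?A. a v = \<zero>\<^bsub>class_ring\<^esub>" by auto
    qed
    show "V.gen_set ?A"
    proof
      show "V.span ?A \<subseteq> carrier ?V" by (rule V.span_is_subset2[OF A(2)])
      show "carrier ?V \<subseteq> V.span ?A"
      proof
        fix v assume v: "v \<in> carrier ?V"
        let ?a = "\<lambda>f. v (inv_into UNIV single f)"
        have iv: "inv_into UNIV (single :: 'b \<Rightarrow> 'b \<Rightarrow> 'k) (single x) = x" for x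
          by (rule inv_f_f[OF inj_single])
        have "V.lincomb ?a ?A = v"
          unfolding lincomb[OF order_refl] using free_mod_carrierD(2)[OF v]
          by (auto simp: fun_eq_iff iv)
        moreover have "V.lincomb ?a ?A \<in> V.span ?A"
          unfolding V.span_def using A by auto
        ultimately show "v \<in> V.span ?A" by simp
      qed
    qed
  qed (rule A(2))
  then show "V.fin_dim" "V.dim = card B"
    using A V.dim_basis[OF A(1)] card_image[OF inj_on_subset[OF inj_single subset_UNIV]]
    unfolding V.fin_dim_def V.basis_def by auto
qed

text \<open>Transport of structure: the axioms for \<open>N\<close> follow from those for \<open>W\<close>, so the quotient by a
  kernel need not be verified separately to be a vector space.\<close>

lemma vectorspace_transport:
  fixes W :: "('k::field, 'w, 'm) module_scheme" and N :: "('k, 'n, 'l) module_scheme"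
  assumes W: "vectorspace class_ring W" and T: "bij_betw T (carrier W) (carrier N)"
    and add: "\<And>x y. x \<in> carrier W \<Longrightarrow> y \<in> carrier W \<Longrightarrow> T (x \<oplus>\<^bsub>W\<^esub> y) = T x \<oplus>\<^bsub>N\<^esub> T y"
    and smult: "\<And>a x. x \<in> carrier W \<Longrightarrow> T (a \<odot>\<^bsub>W\<^esub> x) = a \<odot>\<^bsub>N\<^esub> T x"
    and zero: "T \<zero>\<^bsub>W\<^esub> = \<zero>\<^bsub>N\<^esub>"
  shows "vectorspace class_ring N"
proof -
  interpret W: vectorspace class_ring W by (rule W)
  have im: "carrier N = T ` carrier W" using T by (simp add: bij_betw_def)
  have grp: "abelian_group N"
  proof (rule abelian_groupI)
    fix x y z assume "x \<in> carrier N" "y \<in> carrier N" "z \<in> carrier N"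
    then obtain x' y' z' where d: "x = T x'" "y = T y'" "z = T z'" "x' \<in> carrier W" "y' \<in> carrier W" "z' \<in> carrier W"
      unfolding im by blast
    show "x \<oplus>\<^bsub>N\<^esub> y \<in> carrier N" unfolding im using d by (simp flip: add)
    show "x \<oplus>\<^bsub>N\<^esub> y \<oplus>\<^bsub>N\<^esub> z = x \<oplus>\<^bsub>N\<^esub> (y \<oplus>\<^bsub>N\<^esub> z)" using d by (simp flip: add add: W.M.a_assoc)
    show "x \<oplus>\<^bsub>N\<^esub> y = y \<oplus>\<^bsub>N\<^esub> x" using d by (simp flip: add add: W.M.a_comm)
  next
    show "\<zero>\<^bsub>N\<^esub> \<in> carrier N" unfolding im by (simp flip: zero)
    fix x assume "x \<in> carrier N"
    then obtain x' where d: "x = T x'" "x' \<in> carrier W" unfolding im by blast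
    show "\<zero>\<^bsub>N\<^esub> \<oplus>\<^bsub>N\<^esub> x = x" using d by (simp flip: add zero)
    have "T (\<ominus>\<^bsub>W\<^esub> x') \<oplus>\<^bsub>N\<^esub> x = \<zero>\<^bsub>N\<^esub>" using d by (simp flip: add zero add: W.M.l_neg)
    then show "\<exists>y\<in>carrier N. y \<oplus>\<^bsub>N\<^esub> x = \<zero>\<^bsub>N\<^esub>" unfolding im using d by blast
  qed
  have "module class_ring N"
  proof (rule moduleI[OF class_cring.is_cring grp])
    fix a b :: 'k and x y assume "x \<in> carrier N" "y \<in> carrier N"
    then obtain x' y' where d: "x = T x'" "y = T y'" "x' \<in> carrier W" "y' \<in> carrier W"
      unfolding im by blast
    have c: "a \<odot>\<^bsub>W\<^esub> x' \<in> carrier W" for a using W.smult_closed[of a x'] d by simp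
    have c': "a \<odot>\<^bsub>W\<^esub> y' \<in> carrier W" for a using W.smult_closed[of a y'] d by simp
    show "a \<odot>\<^bsub>N\<^esub> (x \<oplus>\<^bsub>N\<^esub> y) = a \<odot>\<^bsub>N\<^esub> x \<oplus>\<^bsub>N\<^esub> a \<odot>\<^bsub>N\<^esub> y"
      using d c c' W.smult_r_distr[of a x' y'] by (simp flip: add smult)
  next
    fix a b :: 'k and x assume "x \<in> carrier N"
    then obtain x' where d: "x = T x'" "x' \<in> carrier W" unfolding im by blast
    have c: "a \<odot>\<^bsub>W\<^esub> x' \<in> carrier W" for a using W.smult_closed[of a x'] d by simp
    show "a \<odot>\<^bsub>N\<^esub> x \<in> carrier N" unfolding im using d c by (simp flip: smult)
    show "(a \<oplus>\<^bsub>class_ring\<^esub> b) \<odot>\<^bsub>N\<^esub> x = a \<odot>\<^bsub>N\<^esub> x \<oplus>\<^bsub>N\<^esub> b \<odot>\<^bsub>N\<^esub> x"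
      using d c W.smult_l_distr[of a b x'] by (simp flip: add smult)
    show "(a \<otimes>\<^bsub>class_ring\<^esub> b) \<odot>\<^bsub>N\<^esub> x = a \<odot>\<^bsub>N\<^esub> (b \<odot>\<^bsub>N\<^esub> x)"
      using d c W.smult_assoc1[of a b x'] by (simp flip: smult)
    show "\<one>\<^bsub>class_ring\<^esub> \<odot>\<^bsub>N\<^esub> x = x"
      using d W.smult_one[of x'] by (simp flip: smult)
  qed
  then show ?thesis using class_field by (rule vectorspace.intro)
qed

text \<open>The fibres of \<open>\<phi>\<close> are the cosets of its kernel, so sending a point of \<open>W\<close> to its fibre is an
  isomorphism onto the quotient.\<close>

lemma dim_quot_mod:
  fixes M :: "('k::field, 'v) module" and W :: "('k, 'w) module"
  assumes M: "vectorspace class_ring M" and W: "vectorspace class_ring W"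
    and fd: "vectorspace.fin_dim class_ring W"
    and \<phi>: "\<phi> \<in> module_hom class_ring M W" and surj: "\<phi> ` carrier M = carrier W"
  shows "vectorspace.fin_dim class_ring (quot_mod M {v \<in> carrier M. \<phi> v = \<zero>\<^bsub>W\<^esub>}) \<and>
    vectorspace.dim class_ring (quot_mod M {v \<in> carrier M. \<phi> v = \<zero>\<^bsub>W\<^esub>}) = vectorspace.dim class_ring W"
proof -
  interpret M: vectorspace class_ring M by (rule M)
  interpret W: vectorspace class_ring W by (rule W)
  let ?B = "{v \<in> carrier M. \<phi> v = \<zero>\<^bsub>W\<^esub>}"
  let ?N = "quot_mod M ?B"
  define T where "T w = {v \<in> carrier M. \<phi> v = w}" for w
  have add: "\<phi> (x \<oplus>\<^bsub>M\<^esub> y) = \<phi> x \<oplus>\<^bsub>W\<^esub> \<phi> y" if "x \<in> carrier M" "y \<in> carrier M" for x y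
    using \<phi> that by (simp add: module_hom_def)
  have sm: "\<phi> (a \<odot>\<^bsub>M\<^esub> x) = a \<odot>\<^bsub>W\<^esub> \<phi> x" if "x \<in> carrier M" for a x
    using \<phi> that by (simp add: module_hom_def)
  have cl: "\<phi> x \<in> carrier W" if "x \<in> carrier M" for x
    using \<phi> that by (auto simp: module_hom_def)
  have csm: "a \<odot>\<^bsub>M\<^esub> x \<in> carrier M" if "x \<in> carrier M" for a x
    using M.smult_closed[of a x] that by simp
  have coset: "?B +>\<^bsub>M\<^esub> v = T (\<phi> v)" if v: "v \<in> carrier M" for v
  proof (rule subset_antisym; rule subsetI)
    fix u assume "u \<in> ?B +>\<^bsub>M\<^esub> v"
    then show "u \<in> T (\<phi> v)" using v by (auto simp: a_r_coset_def r_coset_def T_def add cl)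
  next
    fix u assume "u \<in> T (\<phi> v)"
    then have u: "u \<in> carrier M" "\<phi> u = \<phi> v" by (auto simp: T_def)
    let ?b = "u \<ominus>\<^bsub>M\<^esub> v"
    have b: "?b \<in> carrier M" using u v by simp
    have ub: "u = ?b \<oplus>\<^bsub>M\<^esub> v" using u v by (simp add: M.M.minus_eq M.M.a_assoc M.M.l_neg)
    have "\<phi> u = \<phi> ?b \<oplus>\<^bsub>W\<^esub> \<phi> v" using add[OF b v] ub by simp
    then have "\<phi> ?b \<oplus>\<^bsub>W\<^esub> \<phi> v = \<zero>\<^bsub>W\<^esub> \<oplus>\<^bsub>W\<^esub> \<phi> v" using u(2) cl[OF v] by simp
    then have "\<phi> ?b = \<zero>\<^bsub>W\<^esub>"
      using W.M.add.right_cancel[OF cl[OF v] cl[OF b] W.M.zero_closed] by blast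
    then show "u \<in> ?B +>\<^bsub>M\<^esub> v" using b ub by (auto simp: a_r_coset_def r_coset_def)
  qed
  have carr: "carrier ?N = T ` carrier W"
  proof -
    have "carrier ?N = (\<lambda>v. ?B +>\<^bsub>M\<^esub> v) ` carrier M"
      by (auto simp: quot_mod_def A_RCOSETS_def RCOSETS_def a_r_coset_def)
    also have "\<dots> = (\<lambda>v. T (\<phi> v)) ` carrier M" by (rule image_cong) (auto simp: coset)
    finally show ?thesis by (simp add: surj[symmetric] image_image)
  qed
  have rep: "\<exists>v\<in>carrier M. \<phi> v = w" if "w \<in> carrier W" for w using that unfolding surj[symmetric] by auto
  have inj: "inj_on T (carrier W)"
  proof (rule inj_onI)
    fix x y assume xy: "x \<in> carrier W" "y \<in> carrier W" "T x = T y"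
    obtain v where "v \<in> carrier M" "\<phi> v = x" using rep[OF xy(1)] by blast
    then have "v \<in> T y" using xy(3) by (auto simp: T_def)
    then show "x = y" using \<open>\<phi> v = x\<close> by (simp add: T_def)
  qed
  have bij: "bij_betw T (carrier W) (carrier ?N)" using inj carr by (simp add: bij_betw_def)
  have Tadd: "T (x \<oplus>\<^bsub>W\<^esub> y) = T x \<oplus>\<^bsub>?N\<^esub> T y" if xy: "x \<in> carrier W" "y \<in> carrier W" for x y
  proof -
    obtain v where v: "v \<in> carrier M" "\<phi> v = y" using rep[OF xy(2)] by blast
    have "T (x \<oplus>\<^bsub>W\<^esub> y) = T x <+>\<^bsub>M\<^esub> T y"
    proof (rule subset_antisym; rule subsetI)
      fix u assume "u \<in> T (x \<oplus>\<^bsub>W\<^esub> y)"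
      then have u: "u \<in> carrier M" "\<phi> u = x \<oplus>\<^bsub>W\<^esub> y" by (auto simp: T_def)
      let ?b = "u \<ominus>\<^bsub>M\<^esub> v"
      have b: "?b \<in> carrier M" using u v by simp
      have ub: "u = ?b \<oplus>\<^bsub>M\<^esub> v" using u v by (simp add: M.M.minus_eq M.M.a_assoc M.M.l_neg)
      have "x \<oplus>\<^bsub>W\<^esub> y = \<phi> ?b \<oplus>\<^bsub>W\<^esub> y" using add[OF b v(1)] ub u(2) v(2) by simp
      then have "\<phi> ?b = x" using cl[OF b] xy by simp
      then show "u \<in> T x <+>\<^bsub>M\<^esub> T y"
        unfolding set_add_def set_mult_def T_def using b ub v by auto
    qed (auto simp: set_add_def set_mult_def T_def add)
    then show ?thesis by (simp add: quot_mod_def)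
  qed
  have Tsm: "T (a \<odot>\<^bsub>W\<^esub> x) = a \<odot>\<^bsub>?N\<^esub> T x" if x: "x \<in> carrier W" for a x
  proof -
    have "a \<odot>\<^bsub>?N\<^esub> T x = (\<Union>v\<in>T x. ?B +>\<^bsub>M\<^esub> (a \<odot>\<^bsub>M\<^esub> v))" by (simp add: quot_mod_def)
    also have "\<dots> = (\<Union>v\<in>T x. T (a \<odot>\<^bsub>W\<^esub> x))"
      by (rule SUP_cong) (auto simp: T_def[of x] coset csm sm)
    also have "\<dots> = T (a \<odot>\<^bsub>W\<^esub> x)" using rep[OF x] by (auto simp: T_def[of x])
    finally show ?thesis by simp
  qed
  have Tz: "T \<zero>\<^bsub>W\<^esub> = \<zero>\<^bsub>?N\<^esub>" by (simp add: quot_mod_def T_def)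
  have N: "vectorspace class_ring ?N" by (rule vectorspace_transport[OF W bij Tadd Tsm Tz])
  have hom: "T \<in> module_hom class_ring W ?N"
    unfolding module_hom_def using Tadd Tsm carr by auto
  interpret N: vectorspace class_ring ?N by (rule N)
  interpret T: linear_map class_ring W ?N T
    by (intro linear_map.intro mod_hom.intro mod_hom_axioms.intro W N hom W.module_axioms N.module_axioms)
  show ?thesis using T.surj_fin_dim[OF fd] T.dim_eq[OF fd inj] carr by simp
qed

section \<open>Coefficients of cochains\<close>

definition blocks :: "nat \<Rightarrow> 'a set \<Rightarrow> ('a \<Rightarrow> nat) \<Rightarrow> 'a set list" where
  "blocks n V c = map (\<lambda>i. {v \<in> V. c v = i}) [0..<n]"

definition colour :: "'a set list \<Rightarrow> 'a \<Rightarrow> nat" where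
  "colour F v = (LEAST i. i < length F \<and> v \<in> F ! i)"

lemma length_blocks [simp]: "length (blocks n V c) = n"
  by (simp add: blocks_def)

lemma blocks_nth: "i < n \<Longrightarrow> blocks n V c ! i = {v \<in> V. c v = i}"
  by (simp add: blocks_def)

lemma blocks_decomps:
  assumes "\<And>v. v \<in> V \<Longrightarrow> c v < n" shows "blocks n V c \<in> decomps n V"
proof -
  have "\<Union> (set (blocks n V c)) = V" using assms by (fastforce simp: blocks_def)
  then show ?thesis by (auto simp: decomps_def blocks_nth)
qed

lemma decompsD:
  assumes "F \<in> decomps n I"
  shows "length F = n" "\<And>i. i < n \<Longrightarrow> F ! i \<subseteq> I" "\<And>v. v \<in> I \<Longrightarrow> \<exists>i<n. v \<in> F ! i"
    "\<And>v i j. i < n \<Longrightarrow> j < n \<Longrightarrow> v \<in> F ! i \<Longrightarrow> v \<in> F ! j \<Longrightarrow> i = j"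
proof -
  show len: "length F = n" using assms by (simp add: decomps_def)
  have un: "\<Union> (set F) = I" using assms by (simp add: decomps_def)
  show "F ! i \<subseteq> I" if "i < n" for i using un len nth_mem[of i F] that by blast
  show "\<exists>i<n. v \<in> F ! i" if "v \<in> I" for v using that un len by (auto simp: in_set_conv_nth)
  show "i = j" if "i < n" "j < n" "v \<in> F ! i" "v \<in> F ! j" for v i j
    using assms that by (auto simp: decomps_def)
qed

lemma colour_unique:
  assumes F: "F \<in> decomps n I" and i: "i < n" "v \<in> F ! i"
  shows "colour F v = i"
  unfolding colour_def
proof (rule Least_equality)
  show "i < length F \<and> v \<in> F ! i" using i decompsD(1)[OF F] by simp
  show "i \<le> j" if "j < length F \<and> v \<in> F ! j" for j
    using decompsD(4)[OF F i(1), of j v] i that decompsD(1)[OF F] by simp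
qed

lemma colour_iff:
  assumes F: "F \<in> decomps n I" and v: "v \<in> I" and i: "i < n"
  shows "colour F v = i \<longleftrightarrow> v \<in> F ! i"
proof -
  obtain j where "j < n" "v \<in> F ! j" using decompsD(3)[OF F v] by blast
  then show ?thesis using colour_unique[OF F] i by auto
qed

lemma colour_less:
  assumes F: "F \<in> decomps n I" and v: "v \<in> I" shows "colour F v < n"
proof -
  obtain j where "j < n" "v \<in> F ! j" using decompsD(3)[OF F v] by blast
  then show ?thesis using colour_unique[OF F] by simp
qed

lemma blocks_colour: "F \<in> decomps n I \<Longrightarrow> blocks n I (colour F) = F"
proof (rule nth_equalityI)
  assume F: "F \<in> decomps n I"
  show "length (blocks n I (colour F)) = length F" using decompsD(1)[OF F] by simp
  show "blocks n I (colour F) ! i = F ! i" if "i < length (blocks n I (colour F))" for i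
  proof -
    have i: "i < n" using that by simp
    show ?thesis using colour_iff[OF F _ i] decompsD(2)[OF F i] by (auto simp: blocks_nth[OF i])
  qed
qed

lemma colour_blocks:
  assumes c: "\<And>v. v \<in> V \<Longrightarrow> c v < n" and v: "v \<in> V"
  shows "colour (blocks n V c) v = c v"
  by (rule colour_unique[OF blocks_decomps[OF c] c[OF v]]) (simp_all add: blocks_nth c v)

lemma finite_decomps: "finite I \<Longrightarrow> finite (decomps n I)"
  by (rule finite_subset[OF _ finite_lists_length_eq[of "Pow I" n]]) (auto simp: decomps_def)

text \<open>A cochain is determined by its values on basis elements, which form a natural function of coloured
  graphs; \<open>of_coeffs\<close> is the inverse passage.\<close>

definition coefficients :: "nat \<Rightarrow> ('a, 'k::field, 'a graph \<Rightarrow> 'k) cochain \<Rightarrow> 'a graph \<Rightarrow> ('a \<Rightarrow> nat) \<Rightarrow> 'k" where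
  "coefficients n \<alpha> g c = \<alpha> (fst g) (single g) (blocks n (fst g) c)"

definition of_coeffs :: "nat \<Rightarrow> ('a graph \<Rightarrow> ('a \<Rightarrow> nat) \<Rightarrow> 'k::field) \<Rightarrow> ('a, 'k, 'a graph \<Rightarrow> 'k) cochain" where
  "of_coeffs n a I z F = (if finite I \<and> z \<in> carrier (free_mod (graphs I)) \<and> F \<in> decomps n I
     then \<Sum>g\<in>graphs I. z g * a g (colour F) else 0)"

lemma carrier_cochains:
  fixes \<alpha> :: "('a::infinite, 'k::field, 'a graph \<Rightarrow> 'k) cochain"
  shows "\<alpha> \<in> carrier (cochains Gr n) \<longleftrightarrow>
    (\<forall>I. finite I \<longrightarrow> \<alpha> I \<in> module_hom class_ring (free_mod (graphs I)) (free_mod (decomps n I))) \<and>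
    (\<forall>I \<sigma> z. finite I \<longrightarrow> inj_on \<sigma> I \<longrightarrow> z \<in> carrier (free_mod (graphs I)) \<longrightarrow>
       \<alpha> (\<sigma> ` I) (lin (relabel \<sigma>) z) = lin (map ((`) \<sigma>)) (\<alpha> I z)) \<and>
    (\<forall>I z. \<not> (finite I \<and> z \<in> carrier (free_mod (graphs I))) \<longrightarrow> \<alpha> I z = (\<lambda>_. 0))"
  by (simp add: cochains_def hom_mod_def species_hom_def E_power_def) (simp add: free_mod_def)

lemma module_hom_free_modI:
  assumes "\<And>z. z \<in> carrier (free_mod A) \<Longrightarrow> f z \<in> carrier (free_mod B)"
    "\<And>y z. y \<in> carrier (free_mod A) \<Longrightarrow> z \<in> carrier (free_mod A) \<Longrightarrow> f (\<lambda>b. y b + z b) = (\<lambda>b. f y b + f z b)"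
    "\<And>r z. z \<in> carrier (free_mod A) \<Longrightarrow> f (\<lambda>b. r * z b) = (\<lambda>b. r * f z b)"
  shows "f \<in> module_hom class_ring (free_mod A :: ('k::field, _) module) (free_mod B)"
  using assms by (auto simp: module_hom_def free_mod_def)

lemma module_hom_free_modD:
  assumes "f \<in> module_hom class_ring (free_mod A :: ('k::field, _) module) (free_mod B)"
  shows "z \<in> carrier (free_mod A) \<Longrightarrow> f z \<in> carrier (free_mod B)"
    "y \<in> carrier (free_mod A) \<Longrightarrow> z \<in> carrier (free_mod A) \<Longrightarrow> f (\<lambda>b. y b + z b) = (\<lambda>b. f y b + f z b)"
    "z \<in> carrier (free_mod A) \<Longrightarrow> f (\<lambda>b. r * z b) = (\<lambda>b. r * f z b)"
  using assms by (auto simp: module_hom_def free_mod_def)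

lemma free_mod_add_closed:
  assumes "y \<in> carrier (free_mod B)" "z \<in> carrier (free_mod B)"
  shows "(\<lambda>b. y b + z b) \<in> carrier (free_mod B)"
proof -
  have "{b. y b + z b \<noteq> 0} \<subseteq> {b. y b \<noteq> 0} \<union> {b. z b \<noteq> 0}" by auto
  then show ?thesis
    using assms finite_subset[of "{b. y b + z b \<noteq> 0}" "{b. y b \<noteq> 0} \<union> {b. z b \<noteq> 0}"]
    unfolding free_mod_def by auto
qed

lemma free_mod_smult_closed:
  assumes "z \<in> carrier (free_mod B)"
  shows "(\<lambda>b. r * z b) \<in> carrier (free_mod B)"
proof -
  have "{b. r * z b \<noteq> 0} \<subseteq> {b. z b \<noteq> 0}" by auto
  then show ?thesis
    using assms finite_subset[of "{b. r * z b \<noteq> 0}" "{b. z b \<noteq> 0}"] unfolding free_mod_def by auto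
qed

lemma module_hom_sum:
  fixes f :: "('b \<Rightarrow> 'k::field) \<Rightarrow> 'c \<Rightarrow> 'k"
  assumes f: "f \<in> module_hom class_ring (free_mod A) (free_mod B)" and A: "finite A"
    and z: "z \<in> carrier (free_mod A)"
  shows "f z F = (\<Sum>g\<in>A. z g * f (single g) F)"
proof -
  have car: "y \<in> carrier (free_mod A)" if "\<And>g. g \<notin> A \<Longrightarrow> y g = 0" for y :: "'b \<Rightarrow> 'k"
    using that finite_subset[OF _ A, of "{b. y b \<noteq> 0}"] by (auto simp: free_mod_def)
  have "f (\<lambda>g. if g \<in> S then z g else 0) F = (\<Sum>g\<in>S. z g * f (single g) F)" if "S \<subseteq> A" for S
    using finite_subset[OF that A] that
  proof (induction S rule: finite_induct)
    case empty
    have "f (\<lambda>b. 0 * z b) F = 0 * f z F" using module_hom_free_modD(3)[OF f z, of 0] by simp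
    then show ?case by simp
  next
    case (insert x S)
    let ?y = "\<lambda>g. if g \<in> S then z g else 0"
    have s: "single x \<in> carrier (free_mod A)" using insert by (intro single_carrier) auto
    have xs: "(\<lambda>b. z x * single x b) \<in> carrier (free_mod A)"
      using insert by (intro car) (auto simp: single_def)
    have y: "?y \<in> carrier (free_mod A)" using insert by (intro car) auto
    have "(\<lambda>g. if g \<in> insert x S then z g else 0) = (\<lambda>g. z x * single x g + ?y g)"
      using insert by (auto simp: single_def fun_eq_iff)
    then have "f (\<lambda>g. if g \<in> insert x S then z g else 0) F = z x * f (single x) F + f ?y F"
      using module_hom_free_modD(2)[OF f xs y] module_hom_free_modD(3)[OF f s, of "z x"] by simp
    then show ?case using insert by simp
  qed
  from this[OF order_refl] have "f (\<lambda>g. if g \<in> A then z g else 0) F = (\<Sum>g\<in>A. z g * f (single g) F)" .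
  moreover have "(\<lambda>g. if g \<in> A then z g else 0) = z"
    using free_mod_carrierD(2)[OF z] by (auto simp: fun_eq_iff)
  ultimately show ?thesis by simp
qed

lemma lin_inj_image:
  assumes "\<And>b'. f b' \<noteq> 0 \<Longrightarrow> \<phi> b' = \<phi> b \<Longrightarrow> b' = b"
  shows "lin \<phi> f (\<phi> b) = f b"
proof -
  have "{b'. f b' \<noteq> 0 \<and> \<phi> b' = \<phi> b} = (if f b = 0 then {} else {b})" using assms by auto
  then show ?thesis by (simp add: lin_def)
qed

lemma lin_single: "lin \<phi> (single g) = (single (\<phi> g) :: _ \<Rightarrow> 'k::field)"
proof
  fix h
  have "{b. single g b \<noteq> (0 :: 'k) \<and> \<phi> b = h} = (if \<phi> g = h then {g} else {})"
    by (auto simp: single_def)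
  then show "lin \<phi> (single g) h = (single (\<phi> g) h :: 'k)" by (simp add: lin_def single_def)
qed

lemma sum_lin:
  assumes A: "finite A" and B: "finite B" and \<phi>: "\<phi> ` A \<subseteq> B" and z: "z \<in> carrier (free_mod A)"
  shows "(\<Sum>h\<in>B. lin \<phi> z h * w h) = (\<Sum>g\<in>A. z g * w (\<phi> g))"
proof -
  have s: "{b. z b \<noteq> 0} \<subseteq> A" using free_mod_carrierD(2)[OF z] by auto
  have "(\<Sum>h\<in>B. lin \<phi> z h * w h) = (\<Sum>h\<in>B. \<Sum>g\<in>A. if \<phi> g = h then z g * w h else 0)"
    unfolding lin_sup[OF A s] sum_distrib_right by (intro sum.cong refl) auto
  also have "\<dots> = (\<Sum>g\<in>A. \<Sum>h\<in>B. if \<phi> g = h then z g * w h else 0)" by (rule sum.swap)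
  also have "\<dots> = (\<Sum>g\<in>A. z g * w (\<phi> g))"
  proof (rule sum.cong[OF refl])
    fix g assume "g \<in> A"
    then have "\<phi> g \<in> B" using \<phi> by auto
    then show "(\<Sum>h\<in>B. if \<phi> g = h then z g * w h else 0) = z g * w (\<phi> g)"
      using B by (simp add: sum.delta')
  qed
  finally show ?thesis .
qed

lemma map_image_inj:
  assumes \<sigma>: "inj_on \<sigma> I" and F: "\<And>B. B \<in> set F \<Longrightarrow> B \<subseteq> I" and G: "\<And>B. B \<in> set G \<Longrightarrow> B \<subseteq> I"
    and eq: "map ((`) \<sigma>) F = map ((`) \<sigma>) G"
  shows "F = G"
proof (rule nth_equalityI)
  show len: "length F = length G" using eq by (metis length_map)
  fix i assume i: "i < length F"
  have "\<sigma> ` (F ! i) = \<sigma> ` (G ! i)" using arg_cong[OF eq, of "\<lambda>l. l ! i"] i len by simp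
  then show "F ! i = G ! i"
    using inj_on_image_eq_iff[OF \<sigma> F[OF nth_mem[OF i]] G[OF nth_mem]] i len by simp
qed

lemma decomps_subset: "F \<in> decomps n I \<Longrightarrow> B \<in> set F \<Longrightarrow> B \<subseteq> I"
  by (auto simp: decomps_def)

text \<open>Relabelling acts injectively on decompositions, so comparing one coefficient on both sides of the
  naturality square suffices.\<close>

lemma natural_coeffs:
  fixes \<alpha> :: "('a::infinite, 'k::field, 'a graph \<Rightarrow> 'k) cochain"
  assumes \<alpha>: "\<alpha> \<in> carrier (cochains Gr n)"
  shows "natural (coefficients n \<alpha>)"
  unfolding natural_def
proof (intro allI impI)
  fix g :: "'a graph" and \<sigma> :: "'a \<Rightarrow> 'a" and c c' :: "'a \<Rightarrow> nat"
  assume g: "fin_graph g" and \<sigma>: "inj_on \<sigma> (fst g)" and c: "\<forall>v\<in>fst g. c' (\<sigma> v) = c v"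
  let ?V = "fst g"
  have fin: "finite ?V" and gg: "g \<in> graphs ?V" using g by (auto simp: fin_graph_def)
  have sc: "(single g :: _ \<Rightarrow> 'k) \<in> carrier (free_mod (graphs ?V))" by (rule single_carrier[OF gg])
  have hom: "\<alpha> ?V \<in> module_hom class_ring (free_mod (graphs ?V)) (free_mod (decomps n ?V))"
    using \<alpha> fin by (simp add: carrier_cochains)
  have "\<alpha> (\<sigma> ` ?V) (lin (relabel \<sigma>) (single g)) = lin (map ((`) \<sigma>)) (\<alpha> ?V (single g))"
    using \<alpha> fin \<sigma> sc unfolding carrier_cochains by blast
  then have eq: "\<alpha> (\<sigma> ` ?V) (single (relabel \<sigma> g)) = lin (map ((`) \<sigma>)) (\<alpha> ?V (single g))"
    by (simp only: lin_single)
  have b: "blocks n (\<sigma> ` ?V) c' = map ((`) \<sigma>) (blocks n ?V c)"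
    using c by (auto simp: blocks_def)
  have "lin (map ((`) \<sigma>)) (\<alpha> ?V (single g)) (map ((`) \<sigma>) (blocks n ?V c)) = \<alpha> ?V (single g) (blocks n ?V c)"
  proof (rule lin_inj_image)
    fix F assume F: "\<alpha> ?V (single g) F \<noteq> 0" and e: "map ((`) \<sigma>) F = map ((`) \<sigma>) (blocks n ?V c)"
    have "F \<in> decomps n ?V"
      using free_mod_carrierD(2)[OF module_hom_free_modD(1)[OF hom sc] F] .
    then show "F = blocks n ?V c"
      by (intro map_image_inj[OF \<sigma> _ _ e]) (auto dest: decomps_subset simp: blocks_def)
  qed
  then show "coefficients n \<alpha> (relabel \<sigma> g) c' = coefficients n \<alpha> g c"
    by (simp only: coefficients_def fst_relabel eq b)
qed

lemma of_coeffs_carrier: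
  fixes a :: "'a::infinite graph \<Rightarrow> ('a \<Rightarrow> nat) \<Rightarrow> 'k::field"
  assumes a: "natural a"
  shows "of_coeffs n a \<in> carrier (cochains Gr n)"
  unfolding carrier_cochains
proof (intro conjI allI impI)
  fix I :: "'a set" assume I: "finite I"
  show "of_coeffs n a I \<in> module_hom class_ring (free_mod (graphs I)) (free_mod (decomps n I))"
  proof (rule module_hom_free_modI)
    fix z :: "'a graph \<Rightarrow> 'k"
    have "{F. of_coeffs n a I z F \<noteq> 0} \<subseteq> decomps n I" by (auto simp: of_coeffs_def)
    then show "of_coeffs n a I z \<in> carrier (free_mod (decomps n I))"
      using finite_subset[OF _ finite_decomps[OF I]] by (auto simp: free_mod_def)
  next
    fix y z :: "'a graph \<Rightarrow> 'k" assume "y \<in> carrier (free_mod (graphs I))" "z \<in> carrier (free_mod (graphs I))"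
    then show "of_coeffs n a I (\<lambda>b. y b + z b) = (\<lambda>F. of_coeffs n a I y F + of_coeffs n a I z F)"
      using I free_mod_add_closed by (auto simp: of_coeffs_def fun_eq_iff distrib_right sum.distrib)
  next
    fix r and z :: "'a graph \<Rightarrow> 'k" assume "z \<in> carrier (free_mod (graphs I))"
    then show "of_coeffs n a I (\<lambda>b. r * z b) = (\<lambda>F. r * of_coeffs n a I z F)"
      using I free_mod_smult_closed by (auto simp: of_coeffs_def fun_eq_iff sum_distrib_left mult.assoc)
  qed
  fix \<sigma> :: "'a \<Rightarrow> 'a" and z :: "'a graph \<Rightarrow> 'k"
  assume \<sigma>: "inj_on \<sigma> I" and z: "z \<in> carrier (free_mod (graphs I))"
  have fin': "finite (\<sigma> ` I)" using I by simp
  have sub: "relabel \<sigma> ` graphs I \<subseteq> graphs (\<sigma> ` I)" using relabel_graphs[OF \<sigma>] by auto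
  have lz: "lin (relabel \<sigma>) z \<in> carrier (free_mod (graphs (\<sigma> ` I)))"
    by (rule module_hom_free_modD(1)[OF lin_hom[OF sub] z])
  show "of_coeffs n a (\<sigma> ` I) (lin (relabel \<sigma>) z) = lin (map ((`) \<sigma>)) (of_coeffs n a I z)"
  proof
    fix F'
    show "of_coeffs n a (\<sigma> ` I) (lin (relabel \<sigma>) z) F' = lin (map ((`) \<sigma>)) (of_coeffs n a I z) F'"
    proof (cases "F' \<in> decomps n (\<sigma> ` I)")
      case True
      define c where "c v = colour F' (\<sigma> v)" for v
      define F where "F = blocks n I c"
      have cn: "c v < n" if "v \<in> I" for v unfolding c_def by (rule colour_less[OF True]) (simp add: that)
      have F: "F \<in> decomps n I" unfolding F_def by (rule blocks_decomps[OF cn])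
      have "map ((`) \<sigma>) F = blocks n (\<sigma> ` I) (colour F')" by (auto simp: F_def blocks_def c_def)
      then have F': "F' = map ((`) \<sigma>) F" using blocks_colour[OF True] by simp
      have "of_coeffs n a (\<sigma> ` I) (lin (relabel \<sigma>) z) F' =
        (\<Sum>h\<in>graphs (\<sigma> ` I). lin (relabel \<sigma>) z h * a h (colour F'))"
        using True lz I by (simp add: of_coeffs_def)
      also have "\<dots> = (\<Sum>g\<in>graphs I. z g * a (relabel \<sigma> g) (colour F'))"
        by (rule sum_lin[OF finite_graphs[OF I] finite_graphs[OF fin'] sub z])
      also have "\<dots> = (\<Sum>g\<in>graphs I. z g * a g (colour F))"
      proof (rule sum.cong[OF refl])
        fix g assume g: "g \<in> graphs I"
        have "a (relabel \<sigma> g) (colour F') = a g (colour F)"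
        proof (rule naturalD[OF a])
          show "fin_graph g" using g I graphsD(1)[OF g] by (simp add: fin_graph_def)
          show "inj_on \<sigma> (fst g)" using \<sigma> graphsD(1)[OF g] by simp
          show "colour F' (\<sigma> v) = colour F v" if "v \<in> fst g" for v
            using colour_blocks[of I c n v] cn that graphsD(1)[OF g] by (simp add: F_def c_def)
        qed
        then show "z g * a (relabel \<sigma> g) (colour F') = z g * a g (colour F)" by simp
      qed
      also have "\<dots> = of_coeffs n a I z F" using F z I by (simp add: of_coeffs_def)
      also have "\<dots> = lin (map ((`) \<sigma>)) (of_coeffs n a I z) F'"
        unfolding F'
      proof (rule lin_inj_image[symmetric])
        fix G assume "of_coeffs n a I z G \<noteq> 0" and e: "map ((`) \<sigma>) G = map ((`) \<sigma>) F"
        then have "G \<in> decomps n I" by (auto simp: of_coeffs_def split: if_splits)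
        then show "G = F"
          by (intro map_image_inj[OF \<sigma> decomps_subset decomps_subset[OF F] e])
      qed
      finally show ?thesis .
    next
      case False
      have "lin (map ((`) \<sigma>)) (of_coeffs n a I z) F' = 0"
      proof (rule ccontr)
        assume "lin (map ((`) \<sigma>)) (of_coeffs n a I z) F' \<noteq> 0"
        then obtain F where F: "F' = map ((`) \<sigma>) F" "of_coeffs n a I z F \<noteq> 0"
          using lin_supp[of "map ((`) \<sigma>)" "of_coeffs n a I z"] by blast
        then have D: "F \<in> decomps n I" by (auto simp: of_coeffs_def split: if_splits)
        have "F' = blocks n (\<sigma> ` I) (colour F \<circ> inv_into I \<sigma>)"
          unfolding F(1) by (subst blocks_colour[OF D, symmetric]) (auto simp: blocks_def inv_into_f_f[OF \<sigma>])
        moreover have "(colour F \<circ> inv_into I \<sigma>) v < n" if "v \<in> \<sigma> ` I" for v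
          using that colour_less[OF D] by (auto simp: inv_into_f_f[OF \<sigma>])
        ultimately show False using blocks_decomps[of "\<sigma> ` I"] False by metis
      qed
      then show ?thesis using False by (simp add: of_coeffs_def)
    qed
  qed
qed (auto simp: of_coeffs_def fun_eq_iff)

lemma coefficients_of_coeffs:
  fixes a :: "'a::infinite graph \<Rightarrow> ('a \<Rightarrow> nat) \<Rightarrow> 'k::field"
  assumes a: "natural a" and g: "fin_graph g" and c: "\<And>v. v \<in> fst g \<Longrightarrow> c v < n"
  shows "coefficients n (of_coeffs n a) g c = a g c"
proof -
  have fin: "finite (fst g)" and gg: "g \<in> graphs (fst g)" using g by (auto simp: fin_graph_def)
  have "coefficients n (of_coeffs n a) g c = (\<Sum>h\<in>graphs (fst g). single g h * a h (colour (blocks n (fst g) c)))"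
  proof -
    have "(single g :: _ \<Rightarrow> 'k) \<in> carrier (free_mod (graphs (fst g)))" by (rule single_carrier[OF gg])
    moreover have "blocks n (fst g) c \<in> decomps n (fst g)" by (rule blocks_decomps[OF c])
    ultimately show ?thesis using fin by (simp add: coefficients_def of_coeffs_def)
  qed
  also have "\<dots> = (\<Sum>h\<in>graphs (fst g). if h = g then a g (colour (blocks n (fst g) c)) else 0)"
    by (rule sum.cong) (auto simp: single_def)
  also have "\<dots> = a g (colour (blocks n (fst g) c))"
    using finite_graphs[OF fin] gg by simp
  also have "\<dots> = a g c" by (rule natural_cong[OF a g]) (rule colour_blocks[OF c])
  finally show ?thesis .
qed

lemma of_coeffs_coefficients:
  fixes \<alpha> :: "('a::infinite, 'k::field, 'a graph \<Rightarrow> 'k) cochain"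
  assumes \<alpha>: "\<alpha> \<in> carrier (cochains Gr n)"
  shows "of_coeffs n (coefficients n \<alpha>) = \<alpha>"
proof (intro ext)
  fix I z F
  show "of_coeffs n (coefficients n \<alpha>) I z F = \<alpha> I z F"
  proof (cases "finite I \<and> z \<in> carrier (free_mod (graphs I))")
    case True
    have hom: "\<alpha> I \<in> module_hom class_ring (free_mod (graphs I)) (free_mod (decomps n I))"
      using \<alpha> True by (simp add: carrier_cochains)
    show ?thesis
    proof (cases "F \<in> decomps n I")
      case F: True
      have "\<alpha> I z F = (\<Sum>g\<in>graphs I. z g * \<alpha> I (single g) F)"
        using module_hom_sum[OF hom finite_graphs] True by simp
      also have "\<dots> = (\<Sum>g\<in>graphs I. z g * coefficients n \<alpha> g (colour F))"
        by (rule sum.cong) (auto simp: coefficients_def graphsD(1) blocks_colour[OF F])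
      finally show ?thesis using True F by (simp add: of_coeffs_def)
    next
      case False
      then have "\<alpha> I z F = 0" using free_mod_carrierD(2)[OF module_hom_free_modD(1)[OF hom]] True by blast
      then show ?thesis using False by (simp add: of_coeffs_def)
    qed
  next
    case False
    have "\<alpha> I z = (\<lambda>_. 0)"
      by (rule \<alpha>[unfolded carrier_cochains, THEN conjunct2, THEN conjunct2, THEN spec, THEN spec, THEN mp, OF False])
    then show ?thesis using False by (auto simp: of_coeffs_def)
  qed
qed

lemma of_coeffs_cong:
  assumes "\<And>g c. fin_graph g \<Longrightarrow> (\<And>v. v \<in> fst g \<Longrightarrow> c v < n) \<Longrightarrow> a g c = b g c"
  shows "of_coeffs n a = of_coeffs n b"
proof (intro ext)
  fix I z F
  have "a g (colour F) = b g (colour F)" if "finite I" "F \<in> decomps n I" "g \<in> graphs I" for g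
    by (rule assms) (use that graphsD(1)[OF that(3)] colour_less[OF that(2)] in \<open>auto simp: fin_graph_def\<close>)
  then show "of_coeffs n a I z F = of_coeffs n b I z F" by (auto simp: of_coeffs_def)
qed

section \<open>The cohomology of graphs\<close>

lemma blocks_faces:
  assumes F: "F \<in> decomps (n + 1) I"
  shows "kept I n 0 (colour F) = I - hd F" "blocks n (I - hd F) (collapse 0 (colour F)) = tl F"
    "kept I n (n + 1) (colour F) = I - last F" "blocks n (I - last F) (collapse (n + 1) (colour F)) = butlast F"
    "1 \<le> i \<Longrightarrow> i \<le> n \<Longrightarrow> kept I n i (colour F) = I"
    "1 \<le> i \<Longrightarrow> i \<le> n \<Longrightarrow> blocks n I (collapse i (colour F)) = take (i - 1) F @ (F ! (i - 1) \<union> F ! i) # drop (i + 1) F"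
proof -
  have len: "length F = n + 1" by (rule decompsD(1)[OF F])
  then have ne: "F \<noteq> []" by auto
  have hd: "hd F = F ! 0" and last: "last F = F ! n" using ne len by (simp_all add: hd_conv_nth last_conv_nth)
  have iff: "colour F v = j \<longleftrightarrow> v \<in> F ! j" if "v \<in> I" "j < n + 1" for v j by (rule colour_iff[OF F that])
  have sub: "F ! j \<subseteq> I" if "j < n + 1" for j by (rule decompsD(2)[OF F that])
  have lt: "colour F v < n + 1" if "v \<in> I" for v by (rule colour_less[OF F that])
  show "kept I n 0 (colour F) = I - hd F" using iff[of _ 0] unfolding kept_def hd by fastforce
  show "kept I n (n + 1) (colour F) = I - last F" using iff[of _ n] unfolding kept_def last by fastforce
  show "kept I n i (colour F) = I" if "1 \<le> i" "i \<le> n" using that by (auto simp: kept_def)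
  show "blocks n (I - hd F) (collapse 0 (colour F)) = tl F"
  proof (rule nth_equalityI)
    fix j assume "j < length (blocks n (I - hd F) (collapse 0 (colour F)))"
    then have j: "j < n" by simp
    have "v \<in> I - hd F \<and> collapse 0 (colour F) v = j \<longleftrightarrow> v \<in> F ! Suc j" for v
    proof (cases "v \<in> I")
      case True
      have "v \<in> I - hd F \<longleftrightarrow> colour F v \<noteq> 0" using iff[OF True, of 0] True by (simp add: hd)
      then show ?thesis using iff[OF True, of "Suc j"] j by (auto simp: collapse_def)
    qed (use sub[of "Suc j"] j in auto)
    then show "blocks n (I - hd F) (collapse 0 (colour F)) ! j = tl F ! j"
      using j len by (simp add: blocks_nth nth_tl)
  qed (simp add: len)
  show "blocks n (I - last F) (collapse (n + 1) (colour F)) = butlast F"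
  proof (rule nth_equalityI)
    fix j assume "j < length (blocks n (I - last F) (collapse (n + 1) (colour F)))"
    then have j: "j < n" by simp
    have "v \<in> I - last F \<and> collapse (n + 1) (colour F) v = j \<longleftrightarrow> v \<in> F ! j" for v
    proof (cases "v \<in> I")
      case True
      have "v \<in> I - last F \<longleftrightarrow> colour F v \<noteq> n" using iff[OF True, of n] True by (simp add: last)
      then show ?thesis using iff[OF True, of j] j lt[OF True] by (auto simp: collapse_def)
    qed (use sub[of j] j in auto)
    then show "blocks n (I - last F) (collapse (n + 1) (colour F)) ! j = butlast F ! j"
      using j len by (simp add: blocks_nth nth_butlast)
  qed (simp add: len)
  show "blocks n I (collapse i (colour F)) = take (i - 1) F @ (F ! (i - 1) \<union> F ! i) # drop (i + 1) F"
    if i: "1 \<le> i" "i \<le> n"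
  proof (rule nth_equalityI)
    show "length (blocks n I (collapse i (colour F))) = length (take (i - 1) F @ (F ! (i - 1) \<union> F ! i) # drop (i + 1) F)"
      using i len by simp
    fix j assume "j < length (blocks n I (collapse i (colour F)))"
    then have j: "j < n" by simp
    define M where "M = (if j < i - 1 then F ! j else if j = i - 1 then F ! (i - 1) \<union> F ! i else F ! Suc j)"
    have "(take (i - 1) F @ (F ! (i - 1) \<union> F ! i) # drop (i + 1) F) ! j = M"
      using i j len by (auto simp: M_def nth_append nth_Cons')
    moreover have "v \<in> I \<and> collapse i (colour F) v = j \<longleftrightarrow> v \<in> M" for v
    proof (cases "v \<in> I")
      case True
      show ?thesis
        using iff[OF True, of j] iff[OF True, of "i - 1"] iff[OF True, of i] iff[OF True, of "Suc j"] i j True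
        by (auto simp: M_def collapse_def)
    next
      case False
      then show ?thesis using sub[of j] sub[of "i - 1"] sub[of i] sub[of "Suc j"] i j by (auto simp: M_def)
    qed
    ultimately show "blocks n I (collapse i (colour F)) ! j =
        (take (i - 1) F @ (F ! (i - 1) \<union> F ! i) # drop (i + 1) F) ! j"
      using j by (simp add: blocks_nth)
  qed
qed

text \<open>By linearity a coface is determined at single graphs, where it is the coefficient at the face of
  \<open>F\<close>; that face is the decomposition of the collapsed colouring.\<close>

lemma coface_coefficients:
  fixes \<alpha> :: "('a::infinite, 'k::field, 'a graph \<Rightarrow> 'k) cochain"
  assumes \<alpha>: "\<alpha> \<in> carrier (cochains Gr n)" and I: "finite I" and z: "z \<in> carrier (free_mod (graphs I))"
    and F: "F \<in> decomps (n + 1) I" and i: "i \<le> n + 1"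
  shows "coface Gr n i \<alpha> I z F =
    (\<Sum>g\<in>graphs I. z g * coefficients n \<alpha> (induced g (kept I n i (colour F))) (collapse i (colour F)))"
proof -
  have hom: "\<alpha> J \<in> module_hom class_ring (free_mod (graphs J)) (free_mod (decomps n J))" if "finite J" for J
    using \<alpha> that by (simp add: carrier_cochains)
  have end_face: "\<alpha> J (lin (\<lambda>g. induced g J) z) G =
      (\<Sum>g\<in>graphs I. z g * coefficients n \<alpha> (induced g J) c)"
    if J: "J \<subseteq> I" and G: "blocks n J c = G" for J G c
  proof -
    have fin: "finite J" using J I by (rule finite_subset)
    have sub: "(\<lambda>g. induced g J) ` graphs I \<subseteq> graphs J" using induced_graphs J by auto
    have "lin (\<lambda>g. induced g J) z \<in> carrier (free_mod (graphs J))"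
      by (rule module_hom_free_modD(1)[OF lin_hom[OF sub] z])
    then have "\<alpha> J (lin (\<lambda>g. induced g J) z) G = (\<Sum>h\<in>graphs J. lin (\<lambda>g. induced g J) z h * \<alpha> J (single h) G)"
      by (rule module_hom_sum[OF hom[OF fin] finite_graphs[OF fin]])
    also have "\<dots> = (\<Sum>g\<in>graphs I. z g * \<alpha> J (single (induced g J)) G)"
      by (rule sum_lin[OF finite_graphs[OF I] finite_graphs[OF fin] sub z])
    also have "\<dots> = (\<Sum>g\<in>graphs I. z g * coefficients n \<alpha> (induced g J) c)"
    proof (rule sum.cong[OF refl])
      fix g assume "g \<in> graphs I"
      then have "fst (induced g J) = J" using induced_graphs[of g I J] J graphsD(1) by blast
      then show "z g * \<alpha> J (single (induced g J)) G = z g * coefficients n \<alpha> (induced g J) c"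
        by (simp add: coefficients_def G)
    qed
    finally show ?thesis .
  qed
  consider (first) "i = 0" | (mid) "1 \<le> i" "i \<le> n" | (last) "i = n + 1" using i by linarith
  then show ?thesis
  proof cases
    case first
    show ?thesis unfolding first blocks_faces(1)[OF F]
      using end_face[OF Diff_subset blocks_faces(2)[OF F]] by (simp add: coface_def)
  next
    case last
    show ?thesis unfolding last blocks_faces(3)[OF F]
      using end_face[OF Diff_subset blocks_faces(4)[OF F]] by (simp add: coface_def)
  next
    case mid
    let ?G = "take (i - 1) F @ (F ! (i - 1) \<union> F ! i) # drop (i + 1) F"
    have "coface Gr n i \<alpha> I z F = \<alpha> I z ?G" using mid by (simp add: coface_def)
    also have "\<dots> = (\<Sum>g\<in>graphs I. z g * \<alpha> I (single g) ?G)"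
      by (rule module_hom_sum[OF hom[OF I] finite_graphs[OF I] z])
    also have "\<dots> = (\<Sum>g\<in>graphs I. z g * coefficients n \<alpha> (induced g I) (collapse i (colour F)))"
    proof (rule sum.cong[OF refl])
      fix g assume g: "g \<in> graphs I"
      then have "induced g I = g" using induced_all[of g] I graphsD(1)[OF g] by (simp add: fin_graph_def)
      then show "z g * \<alpha> I (single g) ?G = z g * coefficients n \<alpha> (induced g I) (collapse i (colour F))"
        by (simp add: coefficients_def graphsD(1)[OF g] blocks_faces(6)[OF F mid])
    qed
    finally show ?thesis by (simp add: blocks_faces(5)[OF F mid])
  qed
qed

lemma coboundary_eq_of_coeffs:
  fixes \<alpha> :: "('a::infinite, 'k::field, 'a graph \<Rightarrow> 'k) cochain"
  assumes \<alpha>: "\<alpha> \<in> carrier (cochains Gr n)"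
  shows "coboundary Gr n \<alpha> = of_coeffs (n + 1) (graph_coboundary n (coefficients n \<alpha>))"
proof (intro ext)
  fix I z F
  show "coboundary Gr n \<alpha> I z F = of_coeffs (n + 1) (graph_coboundary n (coefficients n \<alpha>)) I z F"
  proof (cases "finite I \<and> z \<in> carrier (free_mod (graphs I)) \<and> F \<in> decomps (n + 1) I")
    case True
    let ?t = "\<lambda>i g. coefficients n \<alpha> (induced g (kept I n i (colour F))) (collapse i (colour F))"
    have "coboundary Gr n \<alpha> I z F = (\<Sum>i\<le>n + 1. (- 1) ^ i * coface Gr n i \<alpha> I z F)"
      using True by (simp add: coboundary_def)
    also have "\<dots> = (\<Sum>i\<le>n + 1. (- 1) ^ i * (\<Sum>g\<in>graphs I. z g * ?t i g))"
      by (rule sum.cong) (use True coface_coefficients[OF \<alpha>] in auto)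
    also have "\<dots> = (\<Sum>i\<le>n + 1. \<Sum>g\<in>graphs I. z g * ((- 1) ^ i * ?t i g))"
      by (simp only: sum_distrib_left mult.left_commute)
    also have "\<dots> = (\<Sum>g\<in>graphs I. \<Sum>i\<le>n + 1. z g * ((- 1) ^ i * ?t i g))" by (rule sum.swap)
    also have "\<dots> = (\<Sum>g\<in>graphs I. z g * graph_coboundary n (coefficients n \<alpha>) g (colour F))"
    proof (rule sum.cong[OF refl])
      fix g assume "g \<in> graphs I"
      then have "fst g = I" by (rule graphsD(1))
      then show "(\<Sum>i\<le>n + 1. z g * ((- 1) ^ i * ?t i g)) = z g * graph_coboundary n (coefficients n \<alpha>) g (colour F)"
        unfolding graph_coboundary_def sum_distrib_left by simp
    qed
    finally show ?thesis using True by (simp add: of_coeffs_def)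
  next
    case False
    then show ?thesis by (auto simp: coboundary_def of_coeffs_def)
  qed
qed

lemma graph_coboundary_cong:
  assumes "\<And>h d. fin_graph h \<Longrightarrow> (\<And>v. v \<in> fst h \<Longrightarrow> d v < n) \<Longrightarrow> a h d = b h d"
    and g: "fin_graph g" and c: "\<And>v. v \<in> fst g \<Longrightarrow> c v \<le> n"
  shows "graph_coboundary n a g c = graph_coboundary n b g c"
  unfolding graph_coboundary_def
proof (rule sum.cong[OF refl])
  fix i assume i: "i \<in> {..n + 1}"
  have "a (induced g (kept (fst g) n i c)) (collapse i c) = b (induced g (kept (fst g) n i c)) (collapse i c)"
  proof (rule assms(1)[OF fin_graph_induced[OF g]])
    fix v assume v: "v \<in> fst (induced g (kept (fst g) n i c))"
    then have "v \<in> kept (fst g) n i c" "v \<in> fst g" by (auto simp: fst_induced)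
    then show "collapse i c v < n" using i c[of v] by (intro collapse_less) auto
  qed
  then show "(- 1) ^ i * a (induced g (kept (fst g) n i c)) (collapse i c) =
    (- 1) ^ i * b (induced g (kept (fst g) n i c)) (collapse i c)" by simp
qed

lemma coboundary_of_coeffs:
  fixes a :: "'a::infinite graph \<Rightarrow> ('a \<Rightarrow> nat) \<Rightarrow> 'k::field"
  assumes a: "natural a"
  shows "coboundary Gr n (of_coeffs n a) = of_coeffs (n + 1) (graph_coboundary n a)"
  unfolding coboundary_eq_of_coeffs[OF of_coeffs_carrier[OF a]]
  by (intro of_coeffs_cong graph_coboundary_cong coefficients_of_coeffs[OF a]) (auto simp: less_Suc_eq_le)

lemma of_coeffs_inject:
  fixes a b :: "'a::infinite graph \<Rightarrow> ('a \<Rightarrow> nat) \<Rightarrow> 'k::field"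
  assumes a: "natural a" and b: "natural b" and eq: "of_coeffs n a = of_coeffs n b"
    and g: "fin_graph g" "\<And>v. v \<in> fst g \<Longrightarrow> c v < n"
  shows "a g c = b g c"
  using coefficients_of_coeffs[OF a g] coefficients_of_coeffs[OF b g] eq by simp

definition natural_cocycles :: "nat \<Rightarrow> ('a graph \<Rightarrow> ('a \<Rightarrow> nat) \<Rightarrow> 'k::comm_ring_1) set" where
  "natural_cocycles n = {a. natural a \<and>
    (\<forall>g c. fin_graph g \<longrightarrow> (\<forall>v\<in>fst g. c v \<le> n) \<longrightarrow> graph_coboundary n a g c = 0)}"

lemma natural_cocyclesD:
  assumes "a \<in> natural_cocycles n" "fin_graph g" "\<And>v. v \<in> fst g \<Longrightarrow> c v \<le> n"
  shows "graph_coboundary n a g c = 0"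
  by (rule assms(1)[unfolded natural_cocycles_def, THEN CollectD, THEN conjunct2, rule_format])
    (fact assms)+

lemma natural_zero: "natural (\<lambda>_ _. 0)"
  by (simp add: natural_def)

lemma of_coeffs_zero: "of_coeffs n (\<lambda>_ _. 0) = (\<lambda>_ _ _. 0)"
  by (simp add: of_coeffs_def fun_eq_iff)

lemma cochains_simps:
  "\<zero>\<^bsub>cochains Gr n\<^esub> = (\<lambda>_ _ _. 0)"
  "\<alpha> \<oplus>\<^bsub>cochains Gr n\<^esub> \<beta> = (\<lambda>I z F. \<alpha> I z F + \<beta> I z F)"
  "r \<odot>\<^bsub>cochains Gr n\<^esub> \<alpha> = (\<lambda>I z F. r * \<alpha> I z F)"
  by (simp_all add: cochains_def hom_mod_def E_power_def free_mod_def)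

lemma cocycles_eq:
  "cocycles (Gr :: ('a::infinite, 'k::field, 'a graph \<Rightarrow> 'k) bicomodule) n = of_coeffs n ` natural_cocycles n"
proof (rule subset_antisym; rule subsetI)
  fix \<alpha> :: "('a, 'k, 'a graph \<Rightarrow> 'k) cochain"
  assume "\<alpha> \<in> cocycles Gr n"
  then have \<alpha>: "\<alpha> \<in> carrier (cochains Gr n)" and z: "coboundary Gr n \<alpha> = (\<lambda>_ _ _. 0)"
    by (auto simp: cocycles_def cochains_simps)
  let ?a = "coefficients n \<alpha>"
  have nat: "natural ?a" by (rule natural_coeffs[OF \<alpha>])
  have "of_coeffs (n + 1) (graph_coboundary n ?a) = of_coeffs (n + 1) (\<lambda>_ _. 0)"
    using z unfolding coboundary_eq_of_coeffs[OF \<alpha>] of_coeffs_zero .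
  then have "graph_coboundary n ?a g c = 0" if "fin_graph g" "\<forall>v\<in>fst g. c v \<le> n" for g c
    by (rule of_coeffs_inject[OF natural_graph_coboundary[OF nat] natural_zero _ that(1)]) (use that(2) in auto)
  then have "?a \<in> natural_cocycles n" using nat by (simp add: natural_cocycles_def)
  then show "\<alpha> \<in> of_coeffs n ` natural_cocycles n" using of_coeffs_coefficients[OF \<alpha>] by force
next
  fix \<alpha> :: "('a, 'k, 'a graph \<Rightarrow> 'k) cochain"
  assume "\<alpha> \<in> of_coeffs n ` natural_cocycles n"
  then obtain a where a: "natural a" "\<alpha> = of_coeffs n a"
    and c: "\<And>g c. fin_graph g \<Longrightarrow> \<forall>v\<in>fst g. c v \<le> n \<Longrightarrow> graph_coboundary n a g c = 0"
    by (auto simp: natural_cocycles_def)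
  have "coboundary Gr n \<alpha> = of_coeffs (n + 1) (graph_coboundary n a)" unfolding a(2) by (rule coboundary_of_coeffs[OF a(1)])
  also have "\<dots> = of_coeffs (n + 1) (\<lambda>_ _. 0)" by (rule of_coeffs_cong) (use c in \<open>simp add: less_Suc_eq_le\<close>)
  finally show "\<alpha> \<in> cocycles Gr n"
    using of_coeffs_carrier[OF a(1), of n] by (simp add: cocycles_def cochains_simps of_coeffs_zero a(2))
qed

lemma of_coeffs_add: "of_coeffs n (\<lambda>g c. a g c + b g c) = (\<lambda>I z F. of_coeffs n a I z F + of_coeffs n b I z F)"
  by (simp add: of_coeffs_def fun_eq_iff distrib_left sum.distrib)

lemma of_coeffs_scale: "of_coeffs n (\<lambda>g c. r * a g c) = (\<lambda>I z F. r * of_coeffs n a I z F)"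
  by (simp add: of_coeffs_def fun_eq_iff sum_distrib_left mult.left_commute)

lemma graph_coboundary_scale: "graph_coboundary n (\<lambda>g c. r * a g c) g c = r * graph_coboundary n a g c"
  unfolding graph_coboundary_def sum_distrib_left by (simp only: mult.left_commute)

lemma natural_scale: "natural a \<Longrightarrow> natural (\<lambda>g c. r * a g c)"
  unfolding natural_def by metis

lemma natural_cocycles_add: "a \<in> natural_cocycles n \<Longrightarrow> b \<in> natural_cocycles n \<Longrightarrow> (\<lambda>g c. a g c + b g c) \<in> natural_cocycles n"
  by (simp add: natural_cocycles_def natural_add graph_coboundary_add)

lemma natural_cocycles_scale: "a \<in> natural_cocycles n \<Longrightarrow> (\<lambda>g c. r * a g c) \<in> natural_cocycles n"
  by (simp add: natural_cocycles_def graph_coboundary_scale natural_scale)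

lemma cocycles_vectorspace:
  "vectorspace class_ring ((cochains (Gr :: ('a::infinite, 'k::field, 'a graph \<Rightarrow> 'k) bicomodule) n)
     \<lparr>carrier := cocycles Gr n\<rparr>)" (is "vectorspace class_ring ?M")
proof -
  have add: "(\<lambda>I z F. \<alpha> I z F + \<beta> I z F) \<in> cocycles Gr n" if "\<alpha> \<in> cocycles Gr n" "\<beta> \<in> cocycles Gr n"
    for \<alpha> \<beta> :: "('a, 'k, 'a graph \<Rightarrow> 'k) cochain"
    using that unfolding cocycles_eq by (auto simp flip: of_coeffs_add intro: natural_cocycles_add)
  have sm: "(\<lambda>I z F. r * \<alpha> I z F) \<in> cocycles Gr n" if "\<alpha> \<in> cocycles Gr n"
    for r and \<alpha> :: "('a, 'k, 'a graph \<Rightarrow> 'k) cochain"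
    using that unfolding cocycles_eq by (auto simp flip: of_coeffs_scale intro: natural_cocycles_scale)
  have z: "(\<lambda>_ _ _. 0) \<in> cocycles (Gr :: ('a, 'k, 'a graph \<Rightarrow> 'k) bicomodule) n"
  proof -
    have "(\<lambda>_ _. 0) \<in> natural_cocycles n" by (simp add: natural_cocycles_def natural_zero graph_coboundary_def)
    from imageI[OF this, of "of_coeffs n"] show ?thesis by (simp only: cocycles_eq of_coeffs_zero)
  qed
  have grp: "abelian_group ?M"
  proof (rule abelian_groupI)
    fix \<alpha> assume "\<alpha> \<in> carrier ?M"
    then have "(\<lambda>I z F. - 1 * \<alpha> I z F) \<in> carrier ?M" using sm[of \<alpha> "- 1"] by simp
    then show "\<exists>\<beta>\<in>carrier ?M. \<beta> \<oplus>\<^bsub>?M\<^esub> \<alpha> = \<zero>\<^bsub>?M\<^esub>"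
      by (rule rev_bexI) (simp add: cochains_simps)
  qed (simp_all add: cochains_simps add z add.assoc, simp add: add.commute)
  have "module class_ring ?M"
    by (rule moduleI[OF class_cring.is_cring grp]) (simp_all add: cochains_simps sm algebra_simps)
  then show ?thesis using class_field by (rule vectorspace.intro)
qed

text \<open>The linear map \<open>\<phi>\<close> from cocycles to functions on the classes takes the antisymmetrization at
  the representatives. It is onto, by the transversal cochains, and its kernel consists of the
  coboundaries.\<close>

theorem dim_cohomology_Gr:
  fixes p :: nat
  defines "H \<equiv> cohomology (Gr :: ('a::infinite, 'k::field_char_0, 'a graph \<Rightarrow> 'k) bicomodule) p"
  shows "vectorspace.fin_dim class_ring H \<and> vectorspace.dim class_ring H = card (even_graphs p // iso_rel p)"
proof -
  let ?Gr = "Gr :: ('a, 'k, 'a graph \<Rightarrow> 'k) bicomodule"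
  let ?Q = "even_graphs p // iso_rel p"
  let ?M = "(cochains ?Gr p)\<lparr>carrier := cocycles ?Gr p\<rparr>" and ?W = "free_mod ?Q :: ('k, nat graph set \<Rightarrow> 'k) module"
  have finQ: "finite ?Q" by (rule finite_quotient[OF finite_even_graphs]) (auto simp: iso_rel_def)
  define \<psi> where "\<psi> a = (\<lambda>C. if C \<in> ?Q then antisym_at p a (class_rep C) else 0)"
    for a :: "'a graph \<Rightarrow> ('a \<Rightarrow> nat) \<Rightarrow> 'k"
  define \<phi> where "\<phi> \<alpha> = \<psi> (coefficients p \<alpha>)" for \<alpha>
  have \<psi>_cong: "\<psi> a = \<psi> b"
    if "\<And>g c. fin_graph g \<Longrightarrow> (\<And>v. v \<in> fst g \<Longrightarrow> c v < p) \<Longrightarrow> a g c = b g c" for a b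
  proof
    fix C
    have "antisym_at p a (class_rep C) = antisym_at p b (class_rep C)" if C: "C \<in> ?Q"
      unfolding antisym_at_def antisymmetrize_def
    proof (rule sum.cong[OF refl])
      fix \<sigma> assume \<sigma>: "\<sigma> \<in> {\<sigma>. \<sigma> permutes {..<p}}"
      have G: "class_rep C \<in> graphs {..<p}" using class_rep(2)[OF C] by (simp add: even_graphs_def)
      let ?h = "lift_graph p (class_rep C) :: 'a graph"
      have "a ?h (\<sigma> \<circ> std_colouring p) = b ?h (\<sigma> \<circ> std_colouring p)"
      proof (rule \<open>\<And>g c. fin_graph g \<Longrightarrow> (\<And>v. v \<in> fst g \<Longrightarrow> c v < p) \<Longrightarrow> a g c = b g c\<close>[OF lift_graph_fin[OF G]])
        fix v assume "v \<in> fst ?h"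
        then have "v \<in> std_set p" using graphsD(1)[OF lift_graph_graphs[OF G, where 'a = 'a]] by simp
        then have "std_colouring p v \<in> {..<p}" using std_colouring[of p, where 'a = 'a] by (metis bij_betw_apply)
        then have "\<sigma> (std_colouring p v) \<in> {..<p}" using \<sigma> permutes_in_image by fastforce
        then show "(\<sigma> \<circ> std_colouring p) v < p" by simp
      qed
      then show "of_int (sign \<sigma>) * a ?h (\<sigma> \<circ> std_colouring p) = of_int (sign \<sigma>) * b ?h (\<sigma> \<circ> std_colouring p)"
        by simp
    qed
    then show "\<psi> a C = \<psi> b C" by (simp add: \<psi>_def)
  qed
  have \<phi>_of: "\<phi> (of_coeffs p a) = \<psi> a" if "natural a" for a
    unfolding \<phi>_def by (rule \<psi>_cong) (rule coefficients_of_coeffs[OF that])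
  have \<psi>_carrier: "\<psi> a \<in> carrier ?W" for a
  proof -
    have sub: "{C. \<psi> a C \<noteq> 0} \<subseteq> ?Q" by (auto simp: \<psi>_def)
    then show ?thesis using finite_subset[OF sub finQ] by (simp add: free_mod_def)
  qed
  have hom: "\<phi> \<in> module_hom class_ring ?M ?W"
    unfolding module_hom_def
  proof (intro CollectI conjI allI impI)
    show "\<phi> \<in> carrier ?M \<rightarrow> carrier ?W" using \<psi>_carrier by (simp add: \<phi>_def)
    fix \<alpha> \<beta> :: "('a, 'k, 'a graph \<Rightarrow> 'k) cochain" and r
    show "\<phi> (\<alpha> \<oplus>\<^bsub>?M\<^esub> \<beta>) = \<phi> \<alpha> \<oplus>\<^bsub>?W\<^esub> \<phi> \<beta>"
      by (simp add: cochains_simps free_mod_def \<phi>_def \<psi>_def coefficients_def antisym_at_def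
          antisymmetrize_def fun_eq_iff distrib_left sum.distrib)
    show "\<phi> (r \<odot>\<^bsub>?M\<^esub> \<alpha>) = r \<odot>\<^bsub>?W\<^esub> \<phi> \<alpha>"
      by (simp add: cochains_simps free_mod_def \<phi>_def \<psi>_def coefficients_def antisym_at_def
          antisymmetrize_def fun_eq_iff sum_distrib_left mult.left_commute)
  qed
  have surj: "\<phi> ` carrier ?M = carrier ?W"
  proof (rule subset_antisym; rule subsetI)
    fix y assume "y \<in> \<phi> ` carrier ?M"
    then show "y \<in> carrier ?W" using \<psi>_carrier by (auto simp: \<phi>_def)
  next
    fix y assume y: "y \<in> carrier ?W"
    obtain a :: "'a graph \<Rightarrow> ('a \<Rightarrow> nat) \<Rightarrow> 'k" where a: "natural a"
      and cocycle: "\<And>g c. fin_graph g \<Longrightarrow> (\<And>v. v \<in> fst g \<Longrightarrow> c v \<le> p) \<Longrightarrow> graph_coboundary p a g c = 0"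
      and ay: "\<And>C. C \<in> ?Q \<Longrightarrow> antisym_at p a (class_rep C) = y C"
      using cocycle_with_prescribed_antisym[where p = p and y = y] by blast
    have "a \<in> natural_cocycles p"
      unfolding natural_cocycles_def by (intro CollectI conjI allI impI a cocycle) simp_all
    then have "of_coeffs p a \<in> carrier ?M" by (simp add: cocycles_eq)
    moreover have "\<psi> a = y" using ay free_mod_carrierD(2)[OF y] by (auto simp: \<psi>_def fun_eq_iff)
    ultimately show "y \<in> \<phi> ` carrier ?M" using \<phi>_of[OF a] by (intro image_eqI[of y \<phi> "of_coeffs p a"]) simp_all
  qed
  have kernel: "{\<alpha> \<in> carrier ?M. \<phi> \<alpha> = \<zero>\<^bsub>?W\<^esub>} = coboundaries ?Gr p"
  proof (rule subset_antisym; rule subsetI)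
    fix \<alpha> assume "\<alpha> \<in> {\<alpha> \<in> carrier ?M. \<phi> \<alpha> = \<zero>\<^bsub>?W\<^esub>}"
    then obtain a where ac: "a \<in> natural_cocycles p" and \<alpha>: "\<alpha> = of_coeffs p a" and z: "\<phi> \<alpha> = (\<lambda>_. 0)"
      by (auto simp: cocycles_eq free_mod_def)
    have a: "natural a" using ac by (simp add: natural_cocycles_def)
    have "antisym_at p a (class_rep C) = 0" if "C \<in> ?Q" for C
      using fun_cong[OF z, of C] that unfolding \<alpha> \<phi>_of[OF a] by (simp add: \<psi>_def)
    then have anti: "antisymmetrize p (a g) c = 0" if "fin_graph g" "bij_betw c (fst g) {..<p}" for g c
      by (rule antisym_zero_if_zero_on_classes[OF a _ that])
    show "\<alpha> \<in> coboundaries ?Gr p"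
    proof (cases p)
      case 0
      have "a g c = 0" if "fin_graph g" "\<And>v. v \<in> fst g \<Longrightarrow> c v < 0" for g c
      proof -
        have "fst g = {}" using that(2) by auto
        then have "antisymmetrize 0 (a g) c = 0" using anti[OF that(1), of c] 0 by (simp add: bij_betw_def)
        then show ?thesis by (simp add: antisymmetrize_def)
      qed
      then have "\<alpha> = of_coeffs 0 (\<lambda>_ _. 0)" unfolding \<alpha> 0 by (rule of_coeffs_cong)
      then show ?thesis using 0 by (simp add: of_coeffs_zero cochains_simps)
    next
      case (Suc q)
      obtain b where b: "natural b"
        and ab: "\<And>g c. fin_graph g \<Longrightarrow> (\<And>v. v \<in> fst g \<Longrightarrow> c v < Suc q) \<Longrightarrow> a g c = graph_coboundary q b g c"
      proof (rule cocycle_with_zero_antisym_is_coboundary[OF a])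
        show "graph_coboundary (Suc q) a g c = 0" if "fin_graph g" "\<And>v. v \<in> fst g \<Longrightarrow> c v \<le> Suc q" for g c
          by (rule natural_cocyclesD[OF ac[unfolded Suc] that])
        show "antisymmetrize (Suc q) (a g) c = 0" if "fin_graph g" "bij_betw c (fst g) {..<Suc q}" for g c
          using anti[OF that(1), of c] that(2) Suc by simp
      qed blast
      have "\<alpha> = of_coeffs (q + 1) (graph_coboundary q b)"
        unfolding \<alpha> Suc by (subst of_coeffs_cong[OF ab]) simp_all
      then have "\<alpha> = coboundary Gr q (of_coeffs q b)" using coboundary_of_coeffs[OF b] by simp
      then show ?thesis using of_coeffs_carrier[OF b, of q] Suc by simp
    qed
  next
    fix \<alpha> assume "\<alpha> \<in> coboundaries ?Gr p"
    show "\<alpha> \<in> {\<alpha> \<in> carrier ?M. \<phi> \<alpha> = \<zero>\<^bsub>?W\<^esub>}"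
    proof (cases p)
      case 0
      then have \<alpha>: "\<alpha> = of_coeffs p (\<lambda>_ _. 0)" using \<open>\<alpha> \<in> _\<close> by (simp add: cochains_simps of_coeffs_zero)
      have "(\<lambda>_ _. 0) \<in> natural_cocycles p" by (simp add: natural_cocycles_def natural_zero graph_coboundary_def)
      moreover have "\<phi> \<alpha> = (\<lambda>_. 0)"
        unfolding \<alpha> \<phi>_of[OF natural_zero] by (simp add: \<psi>_def antisym_at_def antisymmetrize_def fun_eq_iff)
      ultimately show ?thesis using \<alpha> by (auto simp: cocycles_eq free_mod_def)
    next
      case (Suc q)
      then obtain \<beta> where \<beta>: "\<beta> \<in> carrier (cochains ?Gr q)" "\<alpha> = coboundary Gr q \<beta>"
        using \<open>\<alpha> \<in> _\<close> by auto
      let ?b = "coefficients q \<beta>"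
      have b: "natural ?b" by (rule natural_coeffs[OF \<beta>(1)])
      have \<alpha>: "\<alpha> = of_coeffs p (graph_coboundary q ?b)" using coboundary_eq_of_coeffs[OF \<beta>(1)] \<beta>(2) Suc by simp
      have "graph_coboundary q ?b \<in> natural_cocycles p"
        unfolding natural_cocycles_def Suc Suc_eq_plus1
        by (intro CollectI conjI allI impI natural_graph_coboundary[OF b] graph_coboundary_graph_coboundary[OF b]) simp_all
      moreover have "\<phi> \<alpha> = (\<lambda>_. 0)"
        unfolding \<alpha> \<phi>_of[OF natural_graph_coboundary[OF b]]
      proof
        fix C
        have "antisym_at p (graph_coboundary q ?b) (class_rep C) = 0" if C: "C \<in> ?Q"
        proof -
          have G: "class_rep C \<in> graphs {..<p}" using class_rep(2)[OF C] by (simp add: even_graphs_def)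
          let ?h = "lift_graph p (class_rep C) :: 'a graph"
          have c: "bij_betw (std_colouring p) (fst ?h) {..<Suc q}"
            using std_colouring[of p, where 'a = 'a] graphsD(1)[OF lift_graph_graphs[OF G, where 'a = 'a]] Suc by simp
          show ?thesis
            unfolding antisym_at_def using antisym_graph_coboundary_natural[OF b lift_graph_fin[OF G] c] Suc by simp
        qed
        then show "\<psi> (graph_coboundary q ?b) C = 0" by (simp add: \<psi>_def)
      qed
      ultimately show ?thesis using \<alpha> by (auto simp: cocycles_eq free_mod_def)
    qed
  qed
  have "vectorspace.fin_dim class_ring (quot_mod ?M {\<alpha> \<in> carrier ?M. \<phi> \<alpha> = \<zero>\<^bsub>?W\<^esub>}) \<and>
    vectorspace.dim class_ring (quot_mod ?M {\<alpha> \<in> carrier ?M. \<phi> \<alpha> = \<zero>\<^bsub>?W\<^esub>}) = vectorspace.dim class_ring ?W"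
    by (rule dim_quot_mod[OF cocycles_vectorspace free_mod_vectorspace free_mod_dim(1)[OF finQ] hom surj])
  then show ?thesis unfolding H_def cohomology_def kernel free_mod_dim(2)[OF finQ] .
qed

section \<open>A signed orbit count\<close>

text \<open>Automorphisms of the relabelled graph are conjugate, through \<open>u\<close>, to automorphisms of \<open>g\<close>, and
  conjugation preserves the sign.\<close>

lemma automorphisms_even_relabel:
  fixes g :: "'a graph" and u :: "'a \<Rightarrow> 'b"
  assumes g: "g \<in> graphs I" and I: "finite I" and u: "bij_betw u I J"
    and ev: "\<And>\<sigma>. automorphism \<sigma> g \<Longrightarrow> evenperm \<sigma>" and \<tau>: "automorphism \<tau> (relabel u g)"
  shows "evenperm \<tau>"
proof -
  have V: "fst g = I" by (rule graphsD(1)[OF g])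
  have uJ: "u ` I = J" using u by (simp add: bij_betw_def)
  then have \<tau>J: "\<tau> permutes J" "relabel \<tau> (relabel u g) = relabel u g"
    using \<tau> V by (auto simp: automorphism_def fst_relabel)
  let ?w = "inv_into I u"
  have w: "bij_betw ?w J I" by (rule bij_betw_inv_into[OF u])
  let ?s = "map_permutation J ?w \<tau>"
  have s: "?s permutes I" by (rule map_permutation_permutes[OF w \<tau>J(1)])
  have wu: "?w (u x) = x" if "x \<in> I" for x using u that by (simp add: bij_betw_def)
  have "?s x = (?w \<circ> (\<tau> \<circ> u)) x" if x: "x \<in> I" for x
  proof -
    have ux: "u x \<in> J" using x uJ by auto
    have "?s (?w (u x)) = ?w (\<tau> (u x))"
      using w ux by (intro map_permutation_apply) (auto simp: bij_betw_def)
    then show ?thesis using wu[OF x] by simp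
  qed
  then have "relabel ?s g = relabel (?w \<circ> (\<tau> \<circ> u)) g" by (rule relabel_cong[OF g])
  also have "\<dots> = relabel ?w (relabel \<tau> (relabel u g))" by (simp only: relabel_relabel)
  also have "\<dots> = relabel (?w \<circ> u) g" unfolding \<tau>J(2) by (simp only: relabel_relabel)
  also have "\<dots> = relabel id g" by (rule relabel_cong[OF g]) (simp add: wu)
  finally have "automorphism ?s g" using s by (simp add: automorphism_def V relabel_id)
  then have "evenperm ?s" by (rule ev)
  then show ?thesis
    using evenperm_map_permutation[of ?w J \<tau>] w \<tau>J(1) finite_imageI[OF I, of u] uJ
    by (simp add: bij_betw_def)
qed

lemma card_quotient_eq:
  assumes R: "equiv X R" and S: "equiv Y S" and h: "\<And>x. x \<in> X \<Longrightarrow> h x \<in> Y"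
    and iff: "\<And>x y. x \<in> X \<Longrightarrow> y \<in> X \<Longrightarrow> (x, y) \<in> R \<longleftrightarrow> (h x, h y) \<in> S"
    and onto: "\<And>y. y \<in> Y \<Longrightarrow> \<exists>x\<in>X. (h x, y) \<in> S"
  shows "card (X // R) = card (Y // S)"
proof -
  let ?f = "\<lambda>x. R `` {x}" and ?g = "\<lambda>x. S `` {h x}"
  have X: "X // R = ?f ` X" by (auto simp: quotient_def)
  have Y: "Y // S = ?g ` X"
  proof (rule subset_antisym; rule subsetI)
    fix C assume "C \<in> Y // S"
    then obtain y where y: "y \<in> Y" "C = S `` {y}" by (auto elim: quotientE)
    obtain x where x: "x \<in> X" "(h x, y) \<in> S" using onto[OF y(1)] by blast
    then have "C = ?g x" using equiv_class_eq[OF S x(2)] y(2) by simp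
    then show "C \<in> ?g ` X" using x(1) by blast
  next
    fix C assume "C \<in> ?g ` X"
    then show "C \<in> Y // S" using h by (auto intro: quotientI)
  qed
  have same: "?f x = ?f y \<longleftrightarrow> ?g x = ?g y" if "x \<in> X" "y \<in> X" for x y
    using eq_equiv_class_iff[OF R that] eq_equiv_class_iff[OF S h[OF that(1)] h[OF that(2)]] iff[OF that] by simp
  have "bij_betw (\<lambda>C. ?g (inv_into X ?f C)) (?f ` X) (?g ` X)"
  proof (rule bij_betw_imageI)
    have inv: "inv_into X ?f (?f x) \<in> X" "?f (inv_into X ?f (?f x)) = ?f x" if "x \<in> X" for x
      using inv_into_into[OF imageI[OF that]] f_inv_into_f[OF imageI[OF that], of ?f] by blast+
    have gi: "?g (inv_into X ?f (?f x)) = ?g x" if "x \<in> X" for x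
      using same[OF inv(1)[OF that] that] inv(2)[OF that] by blast
    show "inj_on (\<lambda>C. ?g (inv_into X ?f C)) (?f ` X)"
    proof (rule inj_onI)
      fix C D assume CD: "C \<in> ?f ` X" "D \<in> ?f ` X" and eq: "?g (inv_into X ?f C) = ?g (inv_into X ?f D)"
      then obtain x y where xy: "x \<in> X" "C = ?f x" "y \<in> X" "D = ?f y" by blast
      have "?g x = ?g y" using eq gi xy by simp
      then show "C = D" using same[OF xy(1,3)] xy(2,4) by simp
    qed
    show "(\<lambda>C. ?g (inv_into X ?f C)) ` ?f ` X = ?g ` X"
      unfolding image_image by (rule image_cong) (auto simp: gi)
  qed
  then show ?thesis unfolding X Y by (rule bij_betw_same_card)
qed

lemma graph_iso_trans: "graph_iso g h \<Longrightarrow> graph_iso h k \<Longrightarrow> graph_iso g k"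
  unfolding graph_iso_def using bij_betw_trans relabel_relabel by metis

lemma graph_iso_sym:
  assumes "graph_iso g h" "g \<in> graphs I" shows "graph_iso h g"
proof -
  obtain \<sigma> where \<sigma>: "bij_betw \<sigma> (fst g) (fst h)" "relabel \<sigma> g = h" using assms by (auto simp: graph_iso_def)
  let ?w = "inv_into (fst g) \<sigma>"
  have I: "fst g = I" by (rule graphsD(1)[OF assms(2)])
  have "relabel (?w \<circ> \<sigma>) g = relabel id g"
    by (rule relabel_cong[OF assms(2)]) (use \<sigma>(1) I in \<open>auto simp: bij_betw_def\<close>)
  then have "relabel ?w h = g" using \<sigma>(2) by (simp add: relabel_id flip: relabel_relabel)
  then show ?thesis using bij_betw_inv_into[OF \<sigma>(1)] by (auto simp: graph_iso_def)
qed

lemma equiv_graph_iso: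
  "equiv (no_odd_aut_graphs p) {(g, h). g \<in> no_odd_aut_graphs p \<and> h \<in> no_odd_aut_graphs p \<and> graph_iso g h}"
    (is "equiv ?Y ?S")
proof (rule equivI)
  show "?S \<subseteq> ?Y \<times> ?Y" by auto
  show "refl_on ?Y ?S"
    by (rule refl_onI) (auto simp: graph_iso_def relabel_id intro!: exI[of _ id])
  show "sym ?S"
    by (rule symI) (auto simp: no_odd_aut_graphs_def intro: graph_iso_sym)
  show "trans ?S" by (rule transI) (auto intro: graph_iso_trans)
qed

lemma card_no_odd_aut_classes:
  "card (no_odd_aut_classes p :: 'a::infinite graph set set) = card (even_graphs p // iso_rel p)"
  unfolding no_odd_aut_classes_def
proof (rule card_quotient_eq[OF equiv_iso_rel equiv_graph_iso, symmetric, where h = "lift_graph p"])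
  let ?K = "std_set p :: 'a set" and ?e = "std_colouring p :: 'a \<Rightarrow> nat"
  let ?w = "inv_into ?K ?e"
  have w: "bij_betw ?w {..<p} ?K" by (rule bij_betw_inv_into[OF std_colouring])
  show lift: "(lift_graph p G :: 'a graph) \<in> no_odd_aut_graphs p" if G: "G \<in> even_graphs p" for G
  proof -
    have g: "G \<in> graphs {..<p}" using G by (simp add: even_graphs_def)
    have "evenperm \<tau>" if "automorphism \<tau> (lift_graph p G :: 'a graph)" for \<tau>
      by (rule automorphisms_even_relabel[OF g _ w]) (use G that in \<open>auto simp: even_graphs_def lift_graph_def\<close>)
    then show ?thesis using lift_graph_graphs[OF g] std_set[where 'a = 'a] by (auto simp: no_odd_aut_graphs_def)
  qed
  show "(G, H) \<in> iso_rel p \<longleftrightarrow> (lift_graph p G, lift_graph p H) \<in>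
      {(g, h). g \<in> (no_odd_aut_graphs p :: 'a graph set) \<and> h \<in> no_odd_aut_graphs p \<and> graph_iso g h}"
    if GH: "G \<in> even_graphs p" "H \<in> even_graphs p" for G H
  proof -
    have g: "G \<in> graphs {..<p}" "H \<in> graphs {..<p}" using GH by (auto simp: even_graphs_def)
    have V: "fst (lift_graph p G :: 'a graph) = ?K" "fst (lift_graph p H :: 'a graph) = ?K"
      using g graphsD(1)[OF lift_graph_graphs] by blast+
    have eG: "relabel ?e (lift_graph p G) = G" and eH: "relabel ?e (lift_graph p H) = H"
      using g by (auto intro: relabel_std_lift)
    have "(\<exists>\<tau>. \<tau> permutes {..<p} \<and> relabel \<tau> G = H) \<longleftrightarrow> graph_iso (lift_graph p G :: 'a graph) (lift_graph p H)"
    proof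
      assume "\<exists>\<tau>. \<tau> permutes {..<p} \<and> relabel \<tau> G = H"
      then obtain \<tau> where \<tau>: "\<tau> permutes {..<p}" "relabel \<tau> G = H" by blast
      have "bij_betw (?w \<circ> (\<tau> \<circ> ?e)) ?K ?K"
        by (rule bij_betw_trans[OF bij_betw_trans[OF std_colouring permutes_imp_bij[OF \<tau>(1)]] w])
      moreover have "relabel (?w \<circ> (\<tau> \<circ> ?e)) (lift_graph p G) = lift_graph p H"
        using eG \<tau>(2) by (simp add: lift_graph_def flip: relabel_relabel)
      ultimately show "graph_iso (lift_graph p G :: 'a graph) (lift_graph p H)"
        unfolding graph_iso_def V by blast
    next
      assume "graph_iso (lift_graph p G :: 'a graph) (lift_graph p H)"
      then obtain \<sigma> where \<sigma>: "bij_betw \<sigma> ?K ?K" "relabel \<sigma> (lift_graph p G :: 'a graph) = lift_graph p H"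
        unfolding graph_iso_def V by blast
      let ?t = "\<lambda>x. if x \<in> {..<p} then (?e \<circ> (\<sigma> \<circ> ?w)) x else x"
      have "bij_betw ?t {..<p} {..<p} \<longleftrightarrow> bij_betw (?e \<circ> (\<sigma> \<circ> ?w)) {..<p} {..<p}"
        by (rule bij_betw_cong) simp
      moreover have "bij_betw (?e \<circ> (\<sigma> \<circ> ?w)) {..<p} {..<p}"
        by (rule bij_betw_trans[OF bij_betw_trans[OF w \<sigma>(1)] std_colouring])
      ultimately have "?t permutes {..<p}" by (intro bij_imp_permutes) simp_all
      moreover have "relabel ?t G = relabel (?e \<circ> (\<sigma> \<circ> ?w)) G" by (rule relabel_cong[OF g(1)]) simp
      moreover have "\<dots> = relabel ?e (relabel \<sigma> (relabel ?w G))" by (simp only: relabel_relabel)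
      moreover have "\<dots> = H" using \<sigma>(2) eH by (simp add: lift_graph_def)
      ultimately show "\<exists>\<tau>. \<tau> permutes {..<p} \<and> relabel \<tau> G = H" by metis
    qed
    then show ?thesis using GH lift by (auto simp: iso_rel_def)
  qed
  show "\<exists>G\<in>even_graphs p. (lift_graph p G, g) \<in>
      {(g, h). g \<in> no_odd_aut_graphs p \<and> h \<in> no_odd_aut_graphs p \<and> graph_iso g h}"
    if g: "g \<in> no_odd_aut_graphs p" for g :: "'a graph"
  proof -
    obtain I where I: "finite I" "card I = p" "g \<in> graphs I" and ev: "\<And>\<sigma>. automorphism \<sigma> g \<Longrightarrow> evenperm \<sigma>"
      using g by (auto simp: no_odd_aut_graphs_def)
    have "\<exists>c. bij_betw c I {..<p}" using finite_same_card_bij[of I "{..<p}"] I by simp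
    then obtain c where c: "bij_betw c I {..<p}" by blast
    have V: "fst g = I" by (rule graphsD(1)[OF I(3)])
    let ?G = "relabel c g"
    have gg: "?G \<in> graphs {..<p}" using relabel_graphs[OF _ I(3), of c] c by (simp add: bij_betw_def)
    have G: "?G \<in> even_graphs p"
      unfolding even_graphs_def using gg automorphisms_even_relabel[OF I(3,1) c ev] by blast
    have "bij_betw (?w \<circ> c) I ?K" by (rule bij_betw_trans[OF c w])
    then have "graph_iso g (lift_graph p ?G)"
      using graphsD(1)[OF lift_graph_graphs[OF gg, where 'a = 'a]] V
      by (auto simp: graph_iso_def lift_graph_def relabel_relabel)
    then have "graph_iso (lift_graph p ?G) g" by (rule graph_iso_sym[OF _ I(3)])
    then show ?thesis using G g lift[OF G] by blast
  qed
qed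

text \<open>Composition with an odd automorphism is a sign-reversing bijection of the automorphism group.\<close>

lemma sum_sign_stabilizer:
  assumes G: "G \<in> graphs {..<p}"
  shows "(\<Sum>\<pi> | \<pi> permutes {..<p} \<and> relabel \<pi> G = G. sign \<pi>) =
    (if G \<in> even_graphs p then int (card {\<pi>. \<pi> permutes {..<p} \<and> relabel \<pi> G = G}) else 0)"
proof (cases "G \<in> even_graphs p")
  case True
  then have "sign \<pi> = 1" if "\<pi> permutes {..<p} \<and> relabel \<pi> G = G" for \<pi>
    using that graphsD(1)[OF G] by (auto simp: even_graphs_def automorphism_def sign_def)
  then show ?thesis using True by simp
next
  case False
  then obtain \<tau> where "automorphism \<tau> G" and odd: "\<not> evenperm \<tau>" using G by (auto simp: even_graphs_def)
  then have \<tau>: "\<tau> permutes {..<p}" "relabel \<tau> G = G" using graphsD(1)[OF G] by (auto simp: automorphism_def)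
  let ?A = "{\<pi>. \<pi> permutes {..<p} \<and> relabel \<pi> G = G}"
  have i: "inv_into UNIV \<tau> permutes {..<p}" "relabel (inv_into UNIV \<tau>) G = G"
    using permutes_inv[OF \<tau>(1)] relabel_inv[OF \<tau>] by auto
  have "sum sign ?A = (\<Sum>\<pi>\<in>?A. - sign \<pi>)"
  proof (rule sum.reindex_bij_witness[where i = "\<lambda>\<pi>. \<tau> \<circ> \<pi>" and j = "\<lambda>\<pi>. inv_into UNIV \<tau> \<circ> \<pi>"])
    fix \<pi> assume \<pi>: "\<pi> \<in> ?A"
    show "\<tau> \<circ> (inv_into UNIV \<tau> \<circ> \<pi>) = \<pi>" "inv_into UNIV \<tau> \<circ> (\<tau> \<circ> \<pi>) = \<pi>"
      by (simp_all add: o_assoc permutes_inv_o[OF \<tau>(1)])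
    show "inv_into UNIV \<tau> \<circ> \<pi> \<in> ?A" "\<tau> \<circ> \<pi> \<in> ?A"
      using \<pi> \<tau> i by (auto intro: permutes_compose simp flip: relabel_relabel)
    have "sign (inv_into UNIV \<tau>) = - 1"
      using sign_inverse[of \<tau>] permutes_imp_permutation[OF _ \<tau>(1)] odd by (simp add: sign_def)
    then show "- sign (inv_into UNIV \<tau> \<circ> \<pi>) = sign \<pi>"
      using sign_permutes_compose[OF i(1), of \<pi>] \<pi> by simp
  qed
  then show ?thesis using False by (simp add: sum_negf)
qed

text \<open>Counting the pairs of a permutation and a fixed graph by graphs instead of permutations, the
  graphs with an odd automorphism cancel; each remaining orbit contributes \<open>fact p\<close>, by the
  orbit-stabilizer theorem.\<close>

lemma signed_burnside:
  "(\<Sum>\<pi> | \<pi> permutes {..<p}. sign \<pi> * int (card {G \<in> graphs {..<p}. relabel \<pi> G = G})) =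
    int (fact p * card (even_graphs p // iso_rel p))"
proof -
  let ?P = "{\<pi>. \<pi> permutes {..<p}}" and ?A = "graphs {..<p} :: nat graph set"
  have finP: "finite ?P" by (simp add: finite_permutations)
  have finA: "finite ?A" by (rule finite_graphs) simp
  let ?s = "\<lambda>G. card {\<pi>. \<pi> permutes {..<p} \<and> relabel \<pi> G = G}"
  have "(\<Sum>\<pi>\<in>?P. sign \<pi> * int (card {G \<in> ?A. relabel \<pi> G = G})) =
      (\<Sum>\<pi>\<in>?P. \<Sum>G\<in>?A. if relabel \<pi> G = G then sign \<pi> else 0)"
    using finA by (intro sum.cong refl) (simp add: sum.If_cases Int_def)
  also have "\<dots> = (\<Sum>G\<in>?A. \<Sum>\<pi>\<in>?P. if relabel \<pi> G = G then sign \<pi> else 0)" by (rule sum.swap)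
  also have "\<dots> = (\<Sum>G\<in>?A. if G \<in> even_graphs p then int (?s G) else 0)"
  proof (rule sum.cong[OF refl])
    fix G assume G: "G \<in> ?A"
    have "(\<Sum>\<pi>\<in>?P. if relabel \<pi> G = G then sign \<pi> else 0) =
        (\<Sum>\<pi> | \<pi> permutes {..<p} \<and> relabel \<pi> G = G. sign \<pi>)"
      using finP by (simp add: sum.If_cases Int_def)
    then show "(\<Sum>\<pi>\<in>?P. if relabel \<pi> G = G then sign \<pi> else 0) = (if G \<in> even_graphs p then int (?s G) else 0)"
      using sum_sign_stabilizer[OF G] by simp
  qed
  also have "\<dots> = (\<Sum>G\<in>even_graphs p. int (?s G))"
    using finA by (intro sum.mono_neutral_cong_right) (auto simp: even_graphs_def)
  also have "\<dots> = (\<Sum>G\<in>\<Union> (even_graphs p // iso_rel p). int (?s G))"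
    by (simp add: Union_quotient[OF equiv_iso_rel])
  also have "\<dots> = (\<Sum>C\<in>even_graphs p // iso_rel p. \<Sum>G\<in>C. int (?s G))"
  proof (rule sum.Union_disjoint[unfolded comp_def])
    show "\<forall>C\<in>even_graphs p // iso_rel p. finite C"
      using finite_even_graphs finite_equiv_class[OF finite_even_graphs] equiv_iso_rel
      by (metis equiv_type)
    show "\<forall>C\<in>even_graphs p // iso_rel p. \<forall>D\<in>even_graphs p // iso_rel p. C \<noteq> D \<longrightarrow> C \<inter> D = {}"
      using quotient_disj[OF equiv_iso_rel] by blast
  qed
  also have "\<dots> = (\<Sum>C\<in>even_graphs p // iso_rel p. int (fact p))"
  proof (rule sum.cong[OF refl])
    fix C assume C: "C \<in> even_graphs p // iso_rel p"
    let ?G = "class_rep C"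
    have G: "?G \<in> even_graphs p" by (rule class_rep(2)[OF C])
    have CG: "C = (\<lambda>\<pi>. relabel \<pi> ?G) ` ?P"
    proof -
      have "C = iso_rel p `` {?G}" by (rule class_rep(3)[OF C, symmetric])
      also have "\<dots> = (\<lambda>\<pi>. relabel \<pi> ?G) ` ?P"
        using G even_graphs_relabel[OF G] unfolding iso_rel_def by blast
      finally show ?thesis .
    qed
    have "(\<Sum>H\<in>C. int (?s H)) = (\<Sum>H\<in>C. \<Sum>\<pi> | \<pi> \<in> ?P \<and> relabel \<pi> ?G = H. 1)"
    proof (rule sum.cong[OF refl])
      fix H assume "H \<in> C"
      then have "H \<in> (\<lambda>\<pi>. relabel \<pi> ?G) ` ?P" by (rule rev_subsetD[OF _ equalityD1[OF CG]])
      then obtain \<rho> where \<rho>: "\<rho> permutes {..<p}" "relabel \<rho> ?G = H" by blast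
      have "bij_betw (\<lambda>\<pi>. \<pi> \<circ> \<rho>) {\<pi>. \<pi> permutes {..<p} \<and> relabel \<pi> H = H} {\<pi> \<in> ?P. relabel \<pi> ?G = H}"
      proof (rule bij_betw_byWitness[where f' = "\<lambda>\<pi>. \<pi> \<circ> inv_into UNIV \<rho>"])
        show "(\<lambda>\<pi>. \<pi> \<circ> \<rho>) ` {\<pi>. \<pi> permutes {..<p} \<and> relabel \<pi> H = H} \<subseteq> {\<pi> \<in> ?P. relabel \<pi> ?G = H}"
          using \<rho> by (auto intro: permutes_compose simp flip: relabel_relabel)
        show "(\<lambda>\<pi>. \<pi> \<circ> inv_into UNIV \<rho>) ` {\<pi> \<in> ?P. relabel \<pi> ?G = H} \<subseteq> {\<pi>. \<pi> permutes {..<p} \<and> relabel \<pi> H = H}"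
          using permutes_inv[OF \<rho>(1)] relabel_inv[OF \<rho>] by (auto intro: permutes_compose simp flip: relabel_relabel)
      qed (simp_all add: comp_assoc permutes_inv_o[OF \<rho>(1)])
      then have "?s H = card {\<pi> \<in> ?P. relabel \<pi> ?G = H}" by (rule bij_betw_same_card)
      then show "int (?s H) = (\<Sum>\<pi> | \<pi> \<in> ?P \<and> relabel \<pi> ?G = H. 1)" by simp
    qed
    also have "\<dots> = (\<Sum>\<pi>\<in>?P. 1)"
    proof (rule sum.group[OF finP])
      show "finite C" using finite_imageI[OF finP] by (subst CG)
      show "(\<lambda>\<pi>. relabel \<pi> ?G) ` ?P \<subseteq> C" by (rule equalityD2[OF CG])
    qed
    finally show "(\<Sum>H\<in>C. int (?s H)) = int (fact p)" by (simp add: card_permutations)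
  qed
  finally show ?thesis by (simp add: mult.commute)
qed

section \<open>Sets invariant under cyclic rotations\<close>

definition invariant_sets :: "('x \<Rightarrow> 'x) \<Rightarrow> 'x set \<Rightarrow> 'x set set" where
  "invariant_sets f X = {Y. Y \<subseteq> X \<and> f ` Y = Y}"

lemma card_invariant_sets_Un:
  assumes "f ` X1 \<subseteq> X1" "f ` X2 \<subseteq> X2" "X1 \<inter> X2 = {}"
  shows "card (invariant_sets f (X1 \<union> X2)) = card (invariant_sets f X1) * card (invariant_sets f X2)"
proof -
  have "bij_betw (\<lambda>Y. (Y \<inter> X1, Y \<inter> X2)) (invariant_sets f (X1 \<union> X2)) (invariant_sets f X1 \<times> invariant_sets f X2)"
  proof (rule bij_betw_byWitness[where f' = "\<lambda>(Y, Z). Y \<union> Z"])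
    show "(\<lambda>Y. (Y \<inter> X1, Y \<inter> X2)) ` invariant_sets f (X1 \<union> X2) \<subseteq> invariant_sets f X1 \<times> invariant_sets f X2"
    proof (rule image_subsetI)
      fix Y assume "Y \<in> invariant_sets f (X1 \<union> X2)"
      then have Y: "Y \<subseteq> X1 \<union> X2" "f ` Y = Y" by (auto simp: invariant_sets_def)
      have "f ` (Y \<inter> X1) = Y \<inter> X1"
      proof (rule subset_antisym; rule subsetI)
        fix y assume y: "y \<in> Y \<inter> X1"
        then obtain x where "x \<in> Y" "y = f x" using Y(2) by blast
        then show "y \<in> f ` (Y \<inter> X1)" using y Y(1) assms by blast
      qed (use Y assms in blast)
      moreover have "f ` (Y \<inter> X2) = Y \<inter> X2"
      proof (rule subset_antisym; rule subsetI)
        fix y assume y: "y \<in> Y \<inter> X2"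
        then obtain x where "x \<in> Y" "y = f x" using Y(2) by blast
        then show "y \<in> f ` (Y \<inter> X2)" using y Y(1) assms by blast
      qed (use Y assms in blast)
      ultimately show "(Y \<inter> X1, Y \<inter> X2) \<in> invariant_sets f X1 \<times> invariant_sets f X2"
        by (simp add: invariant_sets_def)
    qed
    show "\<forall>Y\<in>invariant_sets f (X1 \<union> X2). (case (Y \<inter> X1, Y \<inter> X2) of (Y, Z) \<Rightarrow> Y \<union> Z) = Y"
      by (auto simp: invariant_sets_def)
    show "\<forall>YZ\<in>invariant_sets f X1 \<times> invariant_sets f X2. ((case YZ of (Y, Z) \<Rightarrow> Y \<union> Z) \<inter> X1, (case YZ of (Y, Z) \<Rightarrow> Y \<union> Z) \<inter> X2) = YZ"
      using assms(3) by (auto simp: invariant_sets_def)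
    show "(\<lambda>(Y, Z). Y \<union> Z) ` (invariant_sets f X1 \<times> invariant_sets f X2) \<subseteq> invariant_sets f (X1 \<union> X2)"
      by (auto simp: invariant_sets_def image_Un)
  qed
  from bij_betw_same_card[OF this] show ?thesis by (simp add: card_cartesian_product)
qed

lemma card_invariant_sets_transport:
  assumes h: "bij_betw h X X'" and comm: "\<And>x. x \<in> X \<Longrightarrow> h (f x) = f' (h x)" and f: "f ` X \<subseteq> X"
  shows "card (invariant_sets f X) = card (invariant_sets f' X')"
proof -
  have inj: "inj_on h X" and X': "X' = h ` X" using h by (auto simp: bij_betw_def)
  have key: "f' ` h ` Y = h ` f ` Y" if "Y \<subseteq> X" for Y
    unfolding image_image using comm that by (intro image_cong) auto
  have "bij_betw (image h) (invariant_sets f X) (invariant_sets f' X')"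
  proof (rule bij_betw_imageI)
    show "inj_on (image h) (invariant_sets f X)"
      by (rule inj_on_subset[OF inj_on_image_Pow[OF inj]]) (auto simp: invariant_sets_def)
    show "image h ` invariant_sets f X = invariant_sets f' X'"
    proof (rule subset_antisym; rule subsetI)
      fix Z assume "Z \<in> image h ` invariant_sets f X"
      then obtain Y where Y: "Y \<subseteq> X" "f ` Y = Y" "Z = h ` Y" by (auto simp: invariant_sets_def)
      then have "f' ` Z = Z" using key[OF Y(1)] by simp
      then show "Z \<in> invariant_sets f' X'" using Y by (auto simp: invariant_sets_def X')
    next
      fix Z assume "Z \<in> invariant_sets f' X'"
      then have Z: "Z \<subseteq> h ` X" "f' ` Z = Z" by (auto simp: invariant_sets_def X')
      then obtain Y where Y: "Y \<subseteq> X" "Z = h ` Y" by (auto simp: subset_image_iff)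
      have "h ` f ` Y = h ` Y" using key[OF Y(1)] Z(2) Y(2) by simp
      moreover have "f ` Y \<subseteq> X" using f Y(1) by blast
      ultimately have "f ` Y = Y" using inj_on_image_eq_iff[OF inj _ Y(1)] by blast
      then show "Z \<in> image h ` invariant_sets f X" using Y by (auto simp: invariant_sets_def)
    qed
  qed
  then show ?thesis by (rule bij_betw_same_card)
qed

text \<open>The fibres of \<open>q\<close> are the orbits of \<open>f\<close>: the value of \<open>q\<close> is constant on orbits, and every point is
  reached from the base point \<open>r\<close> of its fibre. An invariant set is a union of orbits.\<close>

lemma card_invariant_sets_orbits:
  assumes X: "finite X" and f: "f ` X \<subseteq> X" "inj_on f X" and q: "\<And>x. x \<in> X \<Longrightarrow> q (f x) = q x"
    and r: "\<And>x. x \<in> X \<Longrightarrow> r (q x) \<in> X \<and> (\<exists>n. x = (f ^^ n) (r (q x)))"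
  shows "card (invariant_sets f X) = 2 ^ card (q ` X)"
proof -
  have fX: "f ` X = X" by (rule endo_inj_surj[OF X f])
  have "bij_betw (\<lambda>Z. {x \<in> X. q x \<in> Z}) (Pow (q ` X)) (invariant_sets f X)"
  proof (rule bij_betw_byWitness[where f' = "image q"])
    show "\<forall>Z\<in>Pow (q ` X). q ` {x \<in> X. q x \<in> Z} = Z" by auto
    show "\<forall>Y\<in>invariant_sets f X. {x \<in> X. q x \<in> q ` Y} = Y"
    proof
      fix Y assume "Y \<in> invariant_sets f X"
      then have Y: "Y \<subseteq> X" "f ` Y = Y" by (auto simp: invariant_sets_def)
      have pull_back: "x \<in> Y" if "x \<in> X" "(f ^^ n) x \<in> Y" for n x
        using that
      proof (induction n arbitrary: x)
        case (Suc n)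
        have "f x \<in> Y" using Suc.IH[of "f x"] Suc.prems f(1) by (auto simp: funpow_swap1)
        then obtain y where "y \<in> Y" "f x = f y" using Y(2) by (metis imageE)
        then show ?case using f(2) Suc.prems(1) Y(1) by (metis inj_onD subsetD)
      qed simp
      have push_forward: "(f ^^ n) x \<in> Y" if "x \<in> Y" for n x
        using that Y(2) by (induction n) auto
      have "x \<in> Y" if x: "x \<in> X" and y: "y \<in> Y" "q x = q y" for x y
      proof -
        obtain n m where n: "x = (f ^^ n) (r (q x))" and m: "y = (f ^^ m) (r (q y))"
          using r[OF x] r[of y] y(1) Y(1) by blast
        have "r (q y) \<in> Y" using pull_back[of "r (q y)" m] r[of y] y(1) Y(1) m by auto
        from push_forward[OF this, of n] show ?thesis using n y(2) by simp
      qed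
      then show "{x \<in> X. q x \<in> q ` Y} = Y" using Y(1) by blast
    qed
    show "(\<lambda>Z. {x \<in> X. q x \<in> Z}) ` Pow (q ` X) \<subseteq> invariant_sets f X"
    proof (rule image_subsetI)
      fix Z
      let ?Y = "{x \<in> X. q x \<in> Z}"
      have "y \<in> f ` ?Y" if "y \<in> ?Y" for y
      proof -
        have "y \<in> f ` X" using fX that by simp
        then obtain x where x: "x \<in> X" "y = f x" by blast
        then have "q x \<in> Z" using that q[OF x(1)] by simp
        then show ?thesis using x by blast
      qed
      moreover have "f x \<in> ?Y" if "x \<in> ?Y" for x using that q[of x] imageI[of x X f] by (simp add: fX)
      ultimately have "f ` ?Y = ?Y" by blast
      then show "?Y \<in> invariant_sets f X" unfolding invariant_sets_def by blast
    qed
    show "image q ` invariant_sets f X \<subseteq> Pow (q ` X)" by (auto simp: invariant_sets_def)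
  qed
  from bij_betw_same_card[OF this] have "card (invariant_sets f X) = card (Pow (q ` X))" by simp
  then show ?thesis using X by (simp add: card_Pow)
qed

definition pairs :: "'a set \<Rightarrow> 'a set set" where
  "pairs S = {e. e \<subseteq> S \<and> card e = 2}"

definition rot :: "nat \<Rightarrow> nat \<Rightarrow> nat" where
  "rot k i = Suc i mod k"

definition rotate_with :: "nat \<Rightarrow> ('a \<Rightarrow> 'a) \<Rightarrow> nat \<times> 'a \<Rightarrow> nat \<times> 'a" where
  "rotate_with l \<pi> = map_prod (rot l) \<pi>"

lemma rot_funpow: "i < k \<Longrightarrow> (rot k ^^ n) i = (i + n) mod k"
  by (induction n) (auto simp: rot_def mod_Suc_eq)

lemma bij_rot: "k > 0 \<Longrightarrow> bij_betw (rot k) {..<k} {..<k}"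
proof -
  assume k: "k > 0"
  have "inj_on (rot k) {..<k}"
  proof (rule inj_onI)
    fix i j assume "i \<in> {..<k}" "j \<in> {..<k}" "rot k i = rot k j"
    then show "i = j" by (auto simp: rot_def mod_Suc split: if_splits)
  qed
  moreover have "rot k ` {..<k} \<subseteq> {..<k}" using k by (auto simp: rot_def)
  ultimately show ?thesis using endo_inj_surj[of "{..<k}" "rot k"] by (simp add: bij_betw_def)
qed

lemma map_prod_funpow:
  fixes f :: "'a \<Rightarrow> 'a" and g :: "'b \<Rightarrow> 'b"
  shows "(map_prod f g ^^ n) (x, y) = ((f ^^ n) x, (g ^^ n) y)"
  by (induction n) auto

text \<open>The orbits of the diagonal rotation on \<open>{..<l} \<times> {..<k}\<close> are distinguished by the difference of
  the coordinates modulo \<open>gcd l k\<close>; that points with equal difference lie in one orbit is the Chinese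
  remainder theorem for moduli that need not be coprime.\<close>

lemma card_invariant_sets_torus:
  assumes l: "l > 0" and k: "k > 0"
  shows "card (invariant_sets (rotate_with l (rot k)) ({..<l} \<times> {..<k})) = 2 ^ gcd l k"
proof -
  let ?X = "{..<l} \<times> {..<k}" and ?f = "rotate_with l (rot k)"
  define d where "d = int (gcd l k)"
  define q where "q = (\<lambda>(i, j). nat ((int i - int j) mod d))"
  define r where "r c = (c, 0 :: nat)" for c :: nat
  have d: "d > 0" "d dvd int l" "d dvd int k" using l by (auto simp: d_def)
  have dl: "d \<le> int l" using d(2) l by (intro zdvd_imp_le) auto
  have "card (invariant_sets ?f ?X) = 2 ^ card (q ` ?X)"
  proof (rule card_invariant_sets_orbits)
    show "finite ?X" by simp
    show "?f ` ?X \<subseteq> ?X" using l k by (auto simp: rotate_with_def rot_def)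
    show "inj_on ?f ?X"
      unfolding rotate_with_def using bij_rot[OF l] bij_rot[OF k]
      by (intro map_prod_inj_on) (auto simp: bij_betw_def)
  next
    fix x assume "x \<in> ?X"
    then obtain i j where x: "x = (i, j)" "i < l" "j < k" by auto
    have "(int (Suc i mod l) - int (Suc j mod k)) mod d = (int i - int j) mod d"
    proof -
      have "int (Suc i mod l) mod d = int (Suc i) mod d" using d(2) by (simp add: zmod_int mod_mod_cancel)
      moreover have "int (Suc j mod k) mod d = int (Suc j) mod d" using d(3) by (simp add: zmod_int mod_mod_cancel)
      ultimately have "(int (Suc i mod l) - int (Suc j mod k)) mod d = (int (Suc i) - int (Suc j)) mod d"
        by (metis mod_diff_cong)
      then show ?thesis by simp
    qed
    then show "q (?f x) = q x" by (simp add: q_def x rotate_with_def rot_def)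
    let ?c = "nat ((int i - int j) mod d)"
    have c: "int ?c = (int i - int j) mod d" using d(1) by simp
    have cl: "?c < l" using d(1) dl pos_mod_bound[OF d(1), of "int i - int j"] by linarith
    \<comment> \<open>\<open>n\<close> is a common solution of \<open>n = j\<close> modulo \<open>k\<close> and \<open>n = i - ?c\<close> modulo \<open>l\<close>; reducing it modulo \<open>l * k\<close>
      makes it nonnegative.\<close>
    obtain u v where uv: "u * int l + v * int k = d" using bezout_int[of "int l" "int k"] by (auto simp: d_def)
    obtain t where t: "int i - int j - int ?c = d * t"
      using c by (metis minus_mod_eq_mult_div)
    define n where "n = nat ((int j + int k * (v * t)) mod (int l * int k))"
    have n: "int n = (int j + int k * (v * t)) mod (int l * int k)" using l k by (simp add: n_def)
    have "int n mod int k = int j mod int k" unfolding n by (simp add: mod_mod_cancel)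
    then have nk: "n mod k = j" using x(3) by (metis mod_less of_nat_eq_iff zmod_int)
    have e: "int ?c + (int j + int k * (v * t)) = int i + int l * (- (u * t))"
    proof -
      have "d * t = u * int l * t + v * int k * t" by (simp add: uv[symmetric] distrib_right)
      then show ?thesis using t by (simp add: algebra_simps)
    qed
    have "(int ?c + int n) mod int l = (int ?c + (int j + int k * (v * t))) mod int l"
      unfolding n by (metis dvd_triv_left mod_add_right_eq mod_mod_cancel)
    also have "\<dots> = int i mod int l" unfolding e by (rule mod_mult_self2)
    finally have nl: "(?c + n) mod l = i" using x(2) by (metis mod_less of_nat_add of_nat_eq_iff zmod_int)
    have "(?f ^^ n) (r (q x)) = x"
      using rot_funpow[OF cl, of n] rot_funpow[OF k, of n] nk nl
      by (simp add: q_def r_def x rotate_with_def map_prod_funpow)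
    then show "r (q x) \<in> ?X \<and> (\<exists>n. x = (?f ^^ n) (r (q x)))"
      using cl k by (auto simp: q_def r_def x intro: exI[of _ n])
  qed
  also have "q ` ?X = {..<gcd l k}"
  proof (rule subset_antisym; rule subsetI)
    fix c assume "c \<in> q ` ?X"
    then show "c \<in> {..<gcd l k}" using d(1) by (auto simp: q_def d_def nat_less_iff)
  next
    fix c assume c: "c \<in> {..<gcd l k}"
    then have "c < l" using dl d_def by auto
    moreover have "q (c, 0) = c" using c by (simp add: q_def d_def)
    ultimately show "c \<in> q ` ?X" using k by (metis SigmaI image_eqI lessThan_iff)
  qed
  finally show ?thesis by simp
qed

lemma pairs_lessThan_cases:
  assumes "e \<in> pairs {..<k}"
  obtains i j where "i < j" "j < k" "e = {i, j :: nat}"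
proof -
  obtain x y where xy: "e = {x, y}" "x \<noteq> y" using assms by (auto simp: pairs_def card_2_iff)
  then have "x < k" "y < k" using assms by (auto simp: pairs_def)
  then show thesis using xy that[of x y] that[of y x] by (metis insert_commute linorder_neqE_nat)
qed

text \<open>The orbits of the rotation on the edges of a \<open>k\<close>-cycle are the cyclic distances \<open>1, \<dots>, k div 2\<close>.\<close>

lemma card_invariant_pairs_cycle:
  assumes k: "k > 0"
  shows "card (invariant_sets (image (rot k)) (pairs {..<k})) = 2 ^ (k div 2)"
proof -
  let ?X = "pairs {..<k}" and ?f = "image (rot k)"
  define q where "q e = (let d = Max e - Min e in min d (k - d))" for e :: "nat set"
  define r where "r d = {0, d}" for d :: nat
  have q: "q {i, j} = min (j - i) (k - (j - i))" if "i < j" for i j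
    using that by (simp add: q_def)
  have inj: "inj_on (rot k) {..<k}" and im: "rot k ` {..<k} = {..<k}" using bij_rot[OF k] by (auto simp: bij_betw_def)
  have fn: "(?f ^^ n) {x, y} = {(rot k ^^ n) x, (rot k ^^ n) y}" for n x y
    by (induction n) auto
  have "card (invariant_sets ?f ?X) = 2 ^ card (q ` ?X)"
  proof (rule card_invariant_sets_orbits)
    show "finite ?X" by (rule finite_subset[of _ "Pow {..<k}"]) (auto simp: pairs_def)
    show "?f ` ?X \<subseteq> ?X"
    proof (rule image_subsetI)
      fix e assume "e \<in> ?X"
      then have e: "e \<subseteq> {..<k}" "card e = 2" by (auto simp: pairs_def)
      have "card (rot k ` e) = 2" using card_image[OF inj_on_subset[OF inj e(1)]] e(2) by simp
      then show "rot k ` e \<in> ?X" using e(1) im by (auto simp: pairs_def)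
    qed
    show "inj_on ?f ?X"
      by (rule inj_on_subset[OF inj_on_image_Pow[OF inj]]) (auto simp: pairs_def)
  next
    fix e assume "e \<in> ?X"
    then obtain i j where e: "i < j" "j < k" "e = {i, j}" by (rule pairs_lessThan_cases)
    show "q (?f e) = q e"
    proof (cases "Suc j = k")
      case True
      then have f: "?f {i, j} = {0, Suc i}" using e by (auto simp: rot_def)
      show ?thesis unfolding e(3) f q[OF e(1)] using q[of 0 "Suc i"] e True by (simp add: min.commute)
    next
      case False
      then have f: "?f {i, j} = {Suc i, Suc j}" using e by (auto simp: rot_def)
      show ?thesis unfolding e(3) f q[OF e(1)] using q[of "Suc i" "Suc j"] e by simp
    qed
    let ?d = "min (j - i) (k - (j - i))"
    have d: "0 < ?d" "?d < k" using e by auto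
    have "\<exists>n. {i, j} = (?f ^^ n) {0, ?d}"
    proof (cases "j - i \<le> k - (j - i)")
      case True
      then have "(?f ^^ i) {0, ?d} = {i, j}"
        using rot_funpow[of 0 k i] rot_funpow[OF d(2), of i] e by (simp add: fn min_def)
      then show ?thesis by metis
    next
      case False
      then have "?d = k - (j - i)" by simp
      moreover have "(k - (j - i) + j) mod k = i"
      proof -
        have "k - (j - i) + j = k + i" using e by simp
        then show ?thesis using e by simp
      qed
      ultimately have "(?f ^^ j) {0, ?d} = {i, j}"
        using rot_funpow[of 0 k j] rot_funpow[OF d(2), of j] e by (simp add: fn insert_commute)
      then show ?thesis by metis
    qed
    then show "r (q e) \<in> ?X \<and> (\<exists>n. e = (?f ^^ n) (r (q e)))"
      using d k by (auto simp: r_def e(3) q[OF e(1)] pairs_def)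
  qed
  also have "q ` ?X = {1..k div 2}"
  proof (rule subset_antisym; rule subsetI)
    fix d assume "d \<in> q ` ?X"
    then obtain e where "e \<in> ?X" "d = q e" by blast
    then obtain i j where ij: "i < j" "j < k" "d = q {i, j}" by (metis pairs_lessThan_cases)
    have "d = min (j - i) (k - (j - i))" using q[OF ij(1)] ij(3) by simp
    then have "1 \<le> d" "2 * d \<le> k" using ij by linarith+
    then show "d \<in> {1..k div 2}" by auto
  next
    fix d assume d: "d \<in> {1..k div 2}"
    then have "{0, d} \<in> ?X" "q {0, d} = d" using q[of 0 d] by (auto simp: pairs_def)
    then show "d \<in> q ` ?X" by (metis image_eqI)
  qed
  finally show ?thesis by simp
qed

section \<open>Splitting off the cycle of a point\<close>

definition pointed_cycles :: "'a \<Rightarrow> 'a set \<Rightarrow> 'a list set" where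
  "pointed_cycles a S = {cs. cs \<noteq> [] \<and> hd cs = a \<and> distinct cs \<and> set cs \<subseteq> S}"

text \<open>A permutation is the cycle through \<open>a\<close>, listed from \<open>a\<close> on, composed with a permutation of the
  points off that cycle.\<close>

lemma sum_permutes_split_cycle:
  assumes S: "finite S" and a: "a \<in> S"
  shows "(\<Sum>\<pi> | \<pi> permutes S. F \<pi>) =
    (\<Sum>cs\<in>pointed_cycles a S. \<Sum>\<tau> | \<tau> permutes S - set cs. F (cycle_of_list cs \<circ> \<tau>))"
proof -
  let ?D = "pointed_cycles a S"
  have finD: "finite ?D"
    by (rule finite_subset[OF _ finite_subset_distinct[OF S]]) (auto simp: pointed_cycles_def)
  let ?rest = "\<lambda>\<pi> y. if y \<in> S - set (support \<pi> a) then \<pi> y else y"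
  have "(\<Sum>\<pi> | \<pi> permutes S. F \<pi>) =
    (\<Sum>(cs, \<tau>)\<in>(SIGMA cs:?D. {\<tau>. \<tau> permutes S - set cs}). F (cycle_of_list cs \<circ> \<tau>))"
  proof (rule sum.reindex_bij_witness[where i = "\<lambda>(cs, \<tau>). cycle_of_list cs \<circ> \<tau>" and j = "\<lambda>\<pi>. (support \<pi> a, ?rest \<pi>)"])
    fix \<pi> assume "\<pi> \<in> {\<pi>. \<pi> permutes S}"
    then have \<pi>: "\<pi> permutes S" by simp
    then have perm: "permutation \<pi>" using S permutes_imp_permutation by blast
    let ?cs = "support \<pi> a"
    have pos: "least_power \<pi> a > 0" by (rule least_power_of_permutation(2)[OF perm])
    have sub: "set ?cs \<subseteq> S"
      using permutes_in_image[OF permutes_funpow[OF \<pi>], of _ a] a by auto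
    have hd: "hd ?cs = a" using pos by (simp add: hd_map)
    have "?cs \<in> ?D" using cycle_of_permutation[OF perm, of a] sub hd pos by (simp add: pointed_cycles_def)
    moreover have "?rest \<pi> permutes S - set ?cs" by (rule semidecomposition[OF \<pi> S])
    ultimately show "(?cs, ?rest \<pi>) \<in> (SIGMA cs:?D. {\<tau>. \<tau> permutes S - set cs})" by simp
    have "(cycle_of_list ?cs \<circ> ?rest \<pi>) y = \<pi> y" for y
    proof (cases "y \<in> set ?cs")
      case True
      then show ?thesis using cycle_restrict[OF perm True] by simp
    next
      case False
      show ?thesis
      proof (cases "y \<in> S")
        case True
        have "\<pi> y \<notin> set ?cs"
        proof
          assume "\<pi> y \<in> set ?cs"
          moreover have "?rest \<pi> y = \<pi> y" using True False by simp
          moreover have "?rest \<pi> y \<in> S - set ?cs"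
            using permutes_in_image[OF semidecomposition[OF \<pi> S, of a], of y] True False by blast
          ultimately show False by simp
        qed
        then show ?thesis using True False id_outside_supp[of "\<pi> y" ?cs] by simp
      next
        case y: False
        then show ?thesis using False id_outside_supp[of y ?cs] \<pi> by (simp add: permutes_not_in)
      qed
    qed
    then show eq: "(case (?cs, ?rest \<pi>) of (cs, \<tau>) \<Rightarrow> cycle_of_list cs \<circ> \<tau>) = \<pi>" by auto
    then show "(case (?cs, ?rest \<pi>) of (cs, \<tau>) \<Rightarrow> F (cycle_of_list cs \<circ> \<tau>)) = F \<pi>" by simp
  next
    fix x assume "x \<in> (SIGMA cs:?D. {\<tau>. \<tau> permutes S - set cs})"
    then obtain cs \<tau> where x: "x = (cs, \<tau>)" and cs: "cs \<noteq> []" "hd cs = a" "distinct cs" "set cs \<subseteq> S"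
      and \<tau>: "\<tau> permutes S - set cs" by (auto simp: pointed_cycles_def)
    let ?\<pi> = "cycle_of_list cs \<circ> \<tau>" and ?k = "length cs"
    have \<pi>: "?\<pi> permutes S"
      using permutes_compose[OF permutes_subset[OF \<tau>] permutes_subset[OF cycle_permutes cs(4)]] by auto
    then have perm: "permutation ?\<pi>" using S permutes_imp_permutation by blast
    have k: "?k > 0" and a0: "a = cs ! 0" using cs(1,2) by (auto simp: hd_conv_nth)
    have \<tau>cs: "\<tau> y = y" if "y \<in> set cs" for y using \<tau> that by (simp add: permutes_not_in)
    have pow: "(?\<pi> ^^ n) a = cs ! (n mod ?k)" for n
    proof (induction n)
      case (Suc n)
      have "n mod ?k < ?k" using k by simp
      then show ?case
        using Suc cycle_of_list_nth[OF cs(3), of "n mod ?k"] \<tau>cs[of "cs ! (n mod ?k)"] by (simp add: mod_Suc_eq)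
    qed (simp add: a0)
    have "least_power ?\<pi> a dvd ?k"
      by (rule least_power_minimal) (simp add: pow a0[symmetric])
    moreover have "?k dvd least_power ?\<pi> a"
    proof -
      have "cs ! (least_power ?\<pi> a mod ?k) = cs ! 0"
        using least_power_of_permutation(1)[OF perm, of a] pow a0 by simp
      then have "least_power ?\<pi> a mod ?k = 0"
        using nth_eq_iff_index_eq[OF cs(3), of "least_power ?\<pi> a mod ?k" 0] k by simp
      then show ?thesis by auto
    qed
    ultimately have lp: "least_power ?\<pi> a = ?k" by (rule dvd_antisym)
    have sup: "support ?\<pi> a = cs"
      unfolding lp by (rule nth_equalityI) (simp_all add: pow)
    have "?rest ?\<pi> y = \<tau> y" for y
    proof (cases "y \<in> S - set cs")
      case True
      then have "\<tau> y \<notin> set cs" using permutes_in_image[OF \<tau>, of y] by blast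
      then show ?thesis unfolding sup using True id_outside_supp[of "\<tau> y" cs] by simp
    next
      case False
      then show ?thesis unfolding sup using permutes_not_in[OF \<tau> False] by auto
    qed
    then have rest: "?rest ?\<pi> = \<tau>" by (rule ext)
    show "(support (case x of (cs, \<tau>) \<Rightarrow> cycle_of_list cs \<circ> \<tau>) a, ?rest (case x of (cs, \<tau>) \<Rightarrow> cycle_of_list cs \<circ> \<tau>)) = x"
      unfolding x prod.case using sup rest by simp
    show "(case x of (cs, \<tau>) \<Rightarrow> cycle_of_list cs \<circ> \<tau>) \<in> {\<pi>. \<pi> permutes S}" using \<pi> x by simp
  qed
  also have "\<dots> = (\<Sum>cs\<in>?D. \<Sum>\<tau> | \<tau> permutes S - set cs. F (cycle_of_list cs \<circ> \<tau>))"
    by (rule sum.Sigma[symmetric]) (use finD S in \<open>auto simp: finite_permutations\<close>)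
  finally show ?thesis .
qed

text \<open>The number of graphs on \<open>S\<close> fixed by \<open>\<pi>\<close>, times the number of invariant sets of edges between \<open>S\<close> and
  further disjoint cycles whose lengths are listed in \<open>L\<close>. The list lets cycles be split off from \<open>S\<close> one
  by one.\<close>

definition cycle_weight :: "('a \<Rightarrow> 'a) \<Rightarrow> 'a set \<Rightarrow> nat list \<Rightarrow> nat" where
  "cycle_weight \<pi> S L = card (invariant_sets (image \<pi>) (pairs S)) *
     (\<Prod>l\<leftarrow>L. card (invariant_sets (rotate_with l \<pi>) ({..<l} \<times> S)))"

lemma invariant_sets_cong:
  assumes "\<And>x. x \<in> X \<Longrightarrow> f x = g x" shows "invariant_sets f X = invariant_sets g X"
proof -
  have "f ` Y = g ` Y" if "Y \<subseteq> X" for Y using assms that by (intro image_cong) auto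
  then show ?thesis unfolding invariant_sets_def by (intro Collect_cong conj_cong) simp_all
qed

text \<open>Edges on \<open>S\<close> lie within the cycle \<open>cs\<close>, between \<open>cs\<close> and the rest, or within the rest; the second
  kind is what a further entry \<open>length cs\<close> of the list accounts for. The edges from an earlier cycle
  of length \<open>l\<close> to \<open>cs\<close> contribute \<open>2 ^ gcd l (length cs)\<close>.\<close>

lemma cycle_weight_split:
  assumes cs: "distinct cs" "cs \<noteq> []" "set cs \<subseteq> S" and \<tau>: "\<tau> permutes S - set cs"
    and L: "\<And>l. l \<in> set L \<Longrightarrow> l > 0"
  shows "cycle_weight (cycle_of_list cs \<circ> \<tau>) S L =
    2 ^ (length cs div 2 + (\<Sum>l\<leftarrow>L. gcd l (length cs))) * cycle_weight \<tau> (S - set cs) (length cs # L)"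
proof -
  let ?\<pi> = "cycle_of_list cs \<circ> \<tau>" and ?C = "set cs" and ?B = "S - set cs" and ?k = "length cs"
  let ?h = "(!) cs"
  have k: "?k > 0" using cs(2) by simp
  have h: "bij_betw ?h {..<?k} ?C" by (rule bij_betw_nth[OF cs(1)]) simp_all
  have \<pi>C: "?\<pi> (?h i) = ?h (rot ?k i)" if "i < ?k" for i
    using cycle_of_list_nth[OF cs(1) that] permutes_not_in[OF \<tau>, of "cs ! i"] that by (simp add: rot_def)
  have \<tau>B: "\<tau> y \<in> ?B" if "y \<in> ?B" for y using permutes_in_image[OF \<tau>, of y] that by blast
  have \<pi>B: "?\<pi> y = \<tau> y" if "y \<in> ?B" for y
    using \<tau>B[OF that] id_outside_supp[of "\<tau> y" cs] by simp
  have rot: "rot ?k i < ?k" for i using k by (simp add: rot_def)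
  have \<pi>CC: "?\<pi> y \<in> ?C" if y: "y \<in> ?C" for y
  proof -
    obtain i where "i < ?k" "y = ?h i" using y by (metis in_set_conv_nth)
    then show ?thesis using \<pi>C rot by simp
  qed
  have inj: "inj ?\<pi>"
    using permutes_inj[OF \<tau>] permutes_inj[OF cycle_permutes[of cs]] by (rule inj_compose[rotated])
  have card2: "card (?\<pi> ` e) = card e" for e by (rule card_image[OF inj_on_subset[OF inj subset_UNIV]])
  define X where "X = (\<lambda>(x, y). {x, y}) ` (?C \<times> ?B)"
  have XI: "{x, y} \<in> X" if "x \<in> ?C" "y \<in> ?B" for x y unfolding X_def using that by auto
  have pairs_split: "pairs S = pairs ?C \<union> (X \<union> pairs ?B)"
  proof (rule subset_antisym; rule subsetI)
    fix e assume "e \<in> pairs S"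
    then obtain x y where xy: "e = {x, y}" "x \<noteq> y" "x \<in> S" "y \<in> S" by (auto simp: pairs_def card_2_iff)
    consider "x \<in> ?C" "y \<in> ?C" | "x \<in> ?C" "y \<in> ?B" | "x \<in> ?B" "y \<in> ?C" | "x \<in> ?B" "y \<in> ?B" using xy by blast
    then show "e \<in> pairs ?C \<union> (X \<union> pairs ?B)"
    proof cases
      case 3
      then show ?thesis using XI[of y x] by (simp add: xy(1) insert_commute)
    qed (use xy XI in \<open>auto simp: pairs_def card_2_iff\<close>)
  next
    fix e assume "e \<in> pairs ?C \<union> (X \<union> pairs ?B)"
    moreover have "e \<in> pairs S" if "e \<in> X"
    proof -
      obtain x y where "x \<in> ?C" "y \<in> ?B" "e = {x, y}" using \<open>e \<in> X\<close> by (auto simp: X_def)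
      then show ?thesis using cs(3) by (auto simp: pairs_def card_2_iff)
    qed
    ultimately show "e \<in> pairs S" using cs(3) by (auto simp: pairs_def)
  qed
  have mapC: "image ?\<pi> ` pairs ?C \<subseteq> pairs ?C"
  proof (rule image_subsetI)
    fix e assume e: "e \<in> pairs ?C"
    have "?\<pi> ` e \<subseteq> ?C"
    proof (rule image_subsetI)
      fix y assume "y \<in> e"
      then have "y \<in> ?C" using e by (auto simp: pairs_def)
      then show "?\<pi> y \<in> ?C" by (rule \<pi>CC)
    qed
    then show "?\<pi> ` e \<in> pairs ?C" using e by (simp add: pairs_def card2 del: comp_apply)
  qed
  have mapB: "image ?\<pi> ` pairs ?B \<subseteq> pairs ?B"
  proof (rule image_subsetI)
    fix e assume e: "e \<in> pairs ?B"
    have "?\<pi> ` e \<subseteq> ?B"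
    proof (rule image_subsetI)
      fix y assume "y \<in> e"
      then have "y \<in> ?B" using e by (auto simp: pairs_def)
      then show "?\<pi> y \<in> ?B" using \<pi>B \<tau>B by metis
    qed
    then show "?\<pi> ` e \<in> pairs ?B" using e by (simp add: pairs_def card2 del: comp_apply)
  qed
  have mapX: "image ?\<pi> ` X \<subseteq> X"
  proof (rule image_subsetI)
    fix e assume "e \<in> X"
    then obtain x y where xy: "x \<in> ?C" "y \<in> ?B" "e = {x, y}" by (auto simp: X_def)
    have "?\<pi> ` e = {?\<pi> x, ?\<pi> y}" by (simp add: xy(3))
    also have "\<dots> \<in> X" by (rule XI[OF \<pi>CC[OF xy(1)]]) (use \<pi>B[OF xy(2)] \<tau>B[OF xy(2)] in metis)
    finally show "?\<pi> ` e \<in> X" .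
  qed
  have disj: "pairs ?C \<inter> (X \<union> pairs ?B) = {}" "X \<inter> pairs ?B = {}"
    by (auto simp: pairs_def X_def card_2_iff)
  have "card (invariant_sets (image ?\<pi>) (pairs S)) =
      card (invariant_sets (image ?\<pi>) (pairs ?C)) * (card (invariant_sets (image ?\<pi>) X) * card (invariant_sets (image ?\<pi>) (pairs ?B)))"
    unfolding pairs_split
    using card_invariant_sets_Un[OF mapC _ disj(1)] card_invariant_sets_Un[OF mapX mapB disj(2)] mapX mapB
    by (simp add: image_Un le_supI1 le_supI2)
  also have "card (invariant_sets (image ?\<pi>) (pairs ?C)) = 2 ^ (?k div 2)"
  proof -
    have "card (invariant_sets (image (rot ?k)) (pairs {..<?k})) = card (invariant_sets (image ?\<pi>) (pairs ?C))"
    proof (rule card_invariant_sets_transport[where h = "image ?h"])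
      have hi: "inj_on ?h {..<?k}" and him: "?h ` {..<?k} = ?C" using h by (auto simp: bij_betw_def)
      have cardh: "card (?h ` e) = card e" if "e \<subseteq> {..<?k}" for e
        by (rule card_image[OF inj_on_subset[OF hi that]])
      show "bij_betw (image ?h) (pairs {..<?k}) (pairs ?C)"
      proof (rule bij_betw_imageI)
        show "inj_on (image ?h) (pairs {..<?k})"
          by (rule inj_on_subset[OF inj_on_image_Pow[OF hi]]) (auto simp: pairs_def)
        show "image ?h ` pairs {..<?k} = pairs ?C"
        proof (rule subset_antisym; rule subsetI)
          fix e assume "e \<in> image ?h ` pairs {..<?k}"
          then show "e \<in> pairs ?C" using cardh him by (auto simp: pairs_def)
        next
          fix e assume e: "e \<in> pairs ?C"
          then have "e \<subseteq> ?h ` {..<?k}" unfolding him by (simp add: pairs_def)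
          then obtain e' where "e' \<subseteq> {..<?k}" "e = ?h ` e'" by (rule subset_imageE)
          then show "e \<in> image ?h ` pairs {..<?k}" using cardh e by (auto simp: pairs_def)
        qed
      qed
      show "?h ` rot ?k ` e = ?\<pi> ` ?h ` e" if "e \<in> pairs {..<?k}" for e
        unfolding image_image using that \<pi>C by (intro image_cong) (auto simp: pairs_def)
      show "image (rot ?k) ` pairs {..<?k} \<subseteq> pairs {..<?k}"
      proof (rule image_subsetI)
        fix e assume e: "e \<in> pairs {..<?k}"
        have "inj_on (rot ?k) e"
          using bij_rot[OF k] e by (auto simp: bij_betw_def pairs_def intro: inj_on_subset)
        then show "rot ?k ` e \<in> pairs {..<?k}" using e rot by (auto simp: pairs_def card_image)
      qed
    qed
    then show ?thesis using card_invariant_pairs_cycle[OF k] by simp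
  qed
  also have "card (invariant_sets (image ?\<pi>) X) = card (invariant_sets (rotate_with ?k \<tau>) ({..<?k} \<times> ?B))"
  proof (rule card_invariant_sets_transport[symmetric, where h = "\<lambda>(i, y). {?h i, y}"])
    show "bij_betw (\<lambda>(i, y). {?h i, y}) ({..<?k} \<times> ?B) X"
    proof (rule bij_betw_imageI)
      show "inj_on (\<lambda>(i, y). {?h i, y}) ({..<?k} \<times> ?B)"
      proof (rule inj_onI, clarsimp)
        fix i y j z assume a: "i < ?k" "y \<notin> ?C" "j < ?k" "z \<notin> ?C" "{?h i, y} = {?h j, z}"
        have "?h i \<in> ?C" "?h j \<in> ?C" using a by auto
        then have "?h i = ?h j" "y = z" using a by (auto simp: doubleton_eq_iff)
        then show "i = j \<and> y = z" using nth_eq_iff_index_eq[OF cs(1)] a by blast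
      qed
      have him: "?C = ?h ` {..<?k}" using h by (simp add: bij_betw_def)
      show "(\<lambda>(i, y). {?h i, y}) ` ({..<?k} \<times> ?B) = X"
        unfolding X_def by (subst (2) him) (force simp: image_iff)
    qed
    show "(case rotate_with ?k \<tau> x of (i, y) \<Rightarrow> {?h i, y}) = ?\<pi> ` (case x of (i, y) \<Rightarrow> {?h i, y})"
      if x: "x \<in> {..<?k} \<times> ?B" for x
    proof -
      obtain i y where iy: "x = (i, y)" "i < ?k" "y \<in> ?B" using x by blast
      have "?\<pi> ` {?h i, y} = {?\<pi> (?h i), ?\<pi> y}" by blast
      also have "\<dots> = {?h (rot ?k i), \<tau> y}" unfolding \<pi>C[OF iy(2)] \<pi>B[OF iy(3)] ..
      finally show ?thesis by (simp add: iy(1) rotate_with_def)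
    qed
    show "rotate_with ?k \<tau> ` ({..<?k} \<times> ?B) \<subseteq> {..<?k} \<times> ?B"
      using rot \<tau>B by (fastforce simp: rotate_with_def)
  qed
  also have "card (invariant_sets (image ?\<pi>) (pairs ?B)) = card (invariant_sets (image \<tau>) (pairs ?B))"
  proof -
    have "?\<pi> ` e = \<tau> ` e" if "e \<in> pairs ?B" for e
      using that \<pi>B by (intro image_cong) (auto simp: pairs_def)
    then show ?thesis by (simp add: invariant_sets_cong[of "pairs ?B" "image ?\<pi>" "image \<tau>"])
  qed
  finally have edges: "card (invariant_sets (image ?\<pi>) (pairs S)) = 2 ^ (?k div 2) *
    (card (invariant_sets (rotate_with ?k \<tau>) ({..<?k} \<times> ?B)) * card (invariant_sets (image \<tau>) (pairs ?B)))" .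
  have factor: "card (invariant_sets (rotate_with l ?\<pi>) ({..<l} \<times> S)) =
      2 ^ gcd l ?k * card (invariant_sets (rotate_with l \<tau>) ({..<l} \<times> ?B))" if l: "l > 0" for l
  proof -
    have rl: "rot l i < l" for i using l by (simp add: rot_def)
    have split: "{..<l} \<times> S = ({..<l} \<times> ?C) \<union> ({..<l} \<times> ?B)" using cs(3) by auto
    have "card (invariant_sets (rotate_with l ?\<pi>) ({..<l} \<times> S)) =
      card (invariant_sets (rotate_with l ?\<pi>) ({..<l} \<times> ?C)) * card (invariant_sets (rotate_with l ?\<pi>) ({..<l} \<times> ?B))"
      unfolding split
    proof (rule card_invariant_sets_Un)
      show "rotate_with l ?\<pi> ` ({..<l} \<times> ?C) \<subseteq> {..<l} \<times> ?C"
        using rl \<pi>CC by (force simp: rotate_with_def simp del: comp_apply)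
      show "rotate_with l ?\<pi> ` ({..<l} \<times> ?B) \<subseteq> {..<l} \<times> ?B"
      proof (rule image_subsetI)
        fix x assume "x \<in> {..<l} \<times> ?B"
        then obtain i y where iy: "x = (i, y)" "y \<in> ?B" by blast
        show "rotate_with l ?\<pi> x \<in> {..<l} \<times> ?B"
          using rl[of i] \<tau>B[OF iy(2)] \<pi>B[OF iy(2)] by (simp add: iy(1) rotate_with_def)
      qed
    qed auto
    also have "card (invariant_sets (rotate_with l ?\<pi>) ({..<l} \<times> ?C)) = 2 ^ gcd l ?k"
    proof -
      have "card (invariant_sets (rotate_with l (rot ?k)) ({..<l} \<times> {..<?k})) =
          card (invariant_sets (rotate_with l ?\<pi>) ({..<l} \<times> ?C))"
      proof (rule card_invariant_sets_transport[where h = "map_prod id ?h"])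
        show "bij_betw (map_prod id ?h) ({..<l} \<times> {..<?k}) ({..<l} \<times> ?C)"
          by (rule bij_betw_map_prod[OF _ h]) simp
        show "map_prod id ?h (rotate_with l (rot ?k) x) = rotate_with l ?\<pi> (map_prod id ?h x)"
          if x: "x \<in> {..<l} \<times> {..<?k}" for x
          using x \<pi>C by (auto simp: rotate_with_def)
        show "rotate_with l (rot ?k) ` ({..<l} \<times> {..<?k}) \<subseteq> {..<l} \<times> {..<?k}"
          using rl rot by (auto simp: rotate_with_def)
      qed
      then show ?thesis using card_invariant_sets_torus[OF l k] by simp
    qed
    also have "invariant_sets (rotate_with l ?\<pi>) ({..<l} \<times> ?B) = invariant_sets (rotate_with l \<tau>) ({..<l} \<times> ?B)"
      by (rule invariant_sets_cong) (use \<pi>B in \<open>auto simp: rotate_with_def simp del: comp_apply\<close>)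
    finally show ?thesis .
  qed
  have "(\<Prod>l\<leftarrow>L. card (invariant_sets (rotate_with l ?\<pi>) ({..<l} \<times> S))) =
    2 ^ (\<Sum>l\<leftarrow>L. gcd l ?k) * (\<Prod>l\<leftarrow>L. card (invariant_sets (rotate_with l \<tau>) ({..<l} \<times> ?B)))"
    using L
  proof (induction L)
    case (Cons l L)
    have "l > 0" by (rule Cons.prems) simp
    moreover have "(\<Prod>l\<leftarrow>L. card (invariant_sets (rotate_with l ?\<pi>) ({..<l} \<times> S))) =
      2 ^ (\<Sum>l\<leftarrow>L. gcd l ?k) * (\<Prod>l\<leftarrow>L. card (invariant_sets (rotate_with l \<tau>) ({..<l} \<times> ?B)))"
      by (rule Cons.IH) (simp add: Cons.prems)
    ultimately show ?case
      by (simp only: list.map prod_list.Cons sum_list.Cons factor power_add mult_ac)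
  qed simp
  then show ?thesis unfolding cycle_weight_def edges
    by (simp only: list.map prod_list.Cons power_add mult_ac)
qed

section \<open>The recursion and its values\<close>

text \<open>Falling factorials, with integer values: \<open>code_simp\<close> computes with natural numbers in unary.\<close>

fun falling :: "nat \<Rightarrow> nat \<Rightarrow> int" where
  "falling n 0 = 1"
| "falling n (Suc k) = int n * falling (n - 1) k"

lemma card_distinct_lists:
  assumes "finite A"
  shows "int (card {xs. length xs = k \<and> distinct xs \<and> set xs \<subseteq> A}) = falling (card A) k"
  using assms
proof (induction k arbitrary: A)
  case 0
  have "{xs. length xs = 0 \<and> distinct xs \<and> set xs \<subseteq> A} = {[]}" by auto
  then show ?case by simp
next
  case (Suc k)
  let ?L = "\<lambda>k A. {xs. length xs = k \<and> distinct xs \<and> set xs \<subseteq> A}"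
  have "?L (Suc k) A = (\<lambda>(x, xs). x # xs) ` (SIGMA x:A. ?L k (A - {x}))"
    by (force simp: length_Suc_conv image_iff)
  moreover have "inj_on (\<lambda>(x, xs). x # xs) (SIGMA x:A. ?L k (A - {x}))"
    by (auto simp: inj_on_def)
  ultimately have "card (?L (Suc k) A) = card (SIGMA x:A. ?L k (A - {x}))"
    by (simp add: card_image)
  also have "\<dots> = (\<Sum>x\<in>A. card (?L k (A - {x})))"
  proof (rule card_SigmaI[OF Suc.prems], intro ballI)
    fix x
    show "finite (?L k (A - {x}))"
      by (rule finite_subset[OF _ finite_subset_distinct[of "A - {x}"]]) (use Suc.prems in auto)
  qed
  finally have "int (card (?L (Suc k) A)) = (\<Sum>x\<in>A. int (card (?L k (A - {x}))))" by simp
  also have "\<dots> = (\<Sum>x\<in>A. falling (card A - 1) k)"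
    using Suc.prems by (intro sum.cong refl) (subst Suc.IH, simp_all)
  finally show ?case by simp
qed

text \<open>The sum of \<open>sign \<pi> * cycle_weight \<pi> S L\<close> over the permutations of a set \<open>S\<close> of \<open>n\<close> elements, by the length
  \<open>k\<close> of the cycle through one point: the falling factorial counts such cycles, and the sign
  and the powers of two are the contribution of the cycle.\<close>

function signed_count :: "nat \<Rightarrow> nat list \<Rightarrow> int" where
  "signed_count n L = (if n = 0 then 1 else
     (\<Sum>k\<leftarrow>[1..<Suc n]. falling (n - 1) (k - 1) * (- 1) ^ (k - 1) *
        2 ^ (k div 2 + (\<Sum>l\<leftarrow>L. gcd l k)) * signed_count (n - k) (k # L)))"
  by auto
termination by (relation "measure fst") auto

declare signed_count.simps [simp del]

lemma card_pointed_cycles: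
  assumes S: "finite S" and a: "a \<in> S" and k: "k > 0"
  shows "int (card {cs \<in> pointed_cycles a S. length cs = k}) = falling (card S - 1) (k - 1)"
proof -
  let ?L = "{xs. length xs = k - 1 \<and> distinct xs \<and> set xs \<subseteq> S - {a}}"
  have "{cs \<in> pointed_cycles a S. length cs = k} = (#) a ` ?L"
  proof (rule subset_antisym; rule subsetI)
    fix cs assume cs: "cs \<in> {cs \<in> pointed_cycles a S. length cs = k}"
    then obtain xs where "cs = a # xs" by (cases cs) (auto simp: pointed_cycles_def)
    then show "cs \<in> (#) a ` ?L" using cs by (auto simp: pointed_cycles_def)
  qed (use a k in \<open>auto simp: pointed_cycles_def\<close>)
  then have "card {cs \<in> pointed_cycles a S. length cs = k} = card ?L" by (simp add: card_image)
  also have "int (card ?L) = falling (card (S - {a})) (k - 1)" using S by (intro card_distinct_lists) simp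
  finally show ?thesis using S a by simp
qed

lemma cycle_weight_empty:
  fixes \<pi> :: "'a \<Rightarrow> 'a"
  shows "cycle_weight \<pi> {} L = 1"
proof -
  have "pairs {} = ({} :: 'a set set)" by (auto simp: pairs_def)
  moreover have "invariant_sets f {} = {{}}" for f :: "'a set \<Rightarrow> 'a set" by (auto simp: invariant_sets_def)
  moreover have "invariant_sets f {} = {{}}" for f :: "nat \<times> 'a \<Rightarrow> nat \<times> 'a" by (auto simp: invariant_sets_def)
  then have "(\<Prod>l\<leftarrow>L. card (invariant_sets (rotate_with l \<pi>) ({..<l} \<times> {}))) = 1" by (induction L) auto
  ultimately show ?thesis by (simp add: cycle_weight_def)
qed

lemma sum_sign_cycle_weight:
  assumes "finite S" "\<And>l. l \<in> set L \<Longrightarrow> l > 0"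
  shows "(\<Sum>\<pi> | \<pi> permutes S. sign \<pi> * int (cycle_weight \<pi> S L)) = signed_count (card S) L"
  using assms
proof (induction "card S" arbitrary: S L rule: less_induct)
  case less
  note S = less.prems(1) and L = less.prems(2)
  show ?case
  proof (cases "S = {}")
    case True
    have "cycle_weight id ({} :: 'a set) L = 1" by (rule cycle_weight_empty)
    then show ?thesis using True by (simp add: signed_count.simps[of 0])
  next
    case False
    then obtain a where a: "a \<in> S" by blast
    let ?n = "card S" and ?D = "pointed_cycles a S"
    have n: "?n > 0" using S False by (simp add: card_gt_0_iff)
    have finD: "finite ?D"
      by (rule finite_subset[OF _ finite_subset_distinct[OF S]]) (auto simp: pointed_cycles_def)
    define w where "w k = (- 1) ^ (k - 1) * 2 ^ (k div 2 + (\<Sum>l\<leftarrow>L. gcd l k)) * signed_count (?n - k) (k # L)" for k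
    have "(\<Sum>\<pi> | \<pi> permutes S. sign \<pi> * int (cycle_weight \<pi> S L)) =
      (\<Sum>cs\<in>?D. \<Sum>\<tau> | \<tau> permutes S - set cs.
         sign (cycle_of_list cs \<circ> \<tau>) * int (cycle_weight (cycle_of_list cs \<circ> \<tau>) S L))"
      by (rule sum_permutes_split_cycle[OF S a])
    also have "\<dots> = (\<Sum>cs\<in>?D. w (length cs))"
    proof (rule sum.cong[OF refl])
      fix cs assume "cs \<in> ?D"
      then have cs: "distinct cs" "cs \<noteq> []" "set cs \<subseteq> S" by (auto simp: pointed_cycles_def)
      let ?k = "length cs" and ?B = "S - set cs"
      have k: "?k > 0" using cs(2) by simp
      have kn: "?k \<le> ?n" using card_mono[OF S cs(3)] distinct_card[OF cs(1)] by simp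
      have cB: "card ?B = ?n - ?k" using card_Diff_subset[OF _ cs(3)] distinct_card[OF cs(1)] by simp
      define r :: int where "r = (- 1) ^ (?k - 1) * 2 ^ (?k div 2 + (\<Sum>l\<leftarrow>L. gcd l ?k))"
      have "(\<Sum>\<tau> | \<tau> permutes ?B. sign (cycle_of_list cs \<circ> \<tau>) * int (cycle_weight (cycle_of_list cs \<circ> \<tau>) S L)) =
        (\<Sum>\<tau> | \<tau> permutes ?B. r * (sign \<tau> * int (cycle_weight \<tau> ?B (?k # L))))"
      proof (rule sum.cong[OF refl])
        fix \<tau> assume "\<tau> \<in> {\<tau>. \<tau> permutes ?B}"
        then have \<tau>: "\<tau> permutes ?B" by simp
        then have perm: "permutation \<tau>" using S by (intro permutes_imp_permutation[of ?B]) auto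
        have sg: "sign (cycle_of_list cs \<circ> \<tau>) = (- 1) ^ (?k - 1) * sign \<tau>"
          unfolding sign_compose[OF permutation_of_cycle perm] sign_cycle_of_list[OF cs(2,1)] ..
        have cw: "cycle_weight (cycle_of_list cs \<circ> \<tau>) S L =
            2 ^ (?k div 2 + (\<Sum>l\<leftarrow>L. gcd l ?k)) * cycle_weight \<tau> ?B (?k # L)"
          by (rule cycle_weight_split[OF cs \<tau>]) (rule L)
        show "sign (cycle_of_list cs \<circ> \<tau>) * int (cycle_weight (cycle_of_list cs \<circ> \<tau>) S L) =
          r * (sign \<tau> * int (cycle_weight \<tau> ?B (?k # L)))"
          unfolding sg cw r_def by simp
      qed
      also have "\<dots> = r * (\<Sum>\<tau> | \<tau> permutes ?B. sign \<tau> * int (cycle_weight \<tau> ?B (?k # L)))"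
        by (simp only: sum_distrib_left)
      also have "(\<Sum>\<tau> | \<tau> permutes ?B. sign \<tau> * int (cycle_weight \<tau> ?B (?k # L))) = signed_count (card ?B) (?k # L)"
        by (rule less.hyps) (use S L k kn n cB in auto)
      finally show "(\<Sum>\<tau> | \<tau> permutes ?B. sign (cycle_of_list cs \<circ> \<tau>) * int (cycle_weight (cycle_of_list cs \<circ> \<tau>) S L)) = w ?k"
        by (simp only: w_def r_def cB)
    qed
    also have "\<dots> = (\<Sum>k\<in>{1..?n}. \<Sum>cs | cs \<in> ?D \<and> length cs = k. w (length cs))"
    proof (rule sum.group[symmetric, OF finD])
      show "length ` ?D \<subseteq> {1..?n}"
      proof (rule image_subsetI)
        fix cs assume "cs \<in> ?D"
        then have cs: "distinct cs" "cs \<noteq> []" "set cs \<subseteq> S" by (auto simp: pointed_cycles_def)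
        then show "length cs \<in> {1..?n}"
          using card_mono[OF S cs(3)] distinct_card[OF cs(1)] by (cases cs) auto
      qed
    qed simp
    also have "\<dots> = (\<Sum>k\<in>{1..?n}. falling (?n - 1) (k - 1) * w k)"
    proof (rule sum.cong[OF refl])
      fix k assume k: "k \<in> {1..?n}"
      have "(\<Sum>cs | cs \<in> ?D \<and> length cs = k. w (length cs)) = (\<Sum>cs | cs \<in> ?D \<and> length cs = k. w k)"
        by (rule sum.cong) auto
      then show "(\<Sum>cs | cs \<in> ?D \<and> length cs = k. w (length cs)) = falling (?n - 1) (k - 1) * w k"
        using card_pointed_cycles[OF S a, of k] k by simp
    qed
    also have "\<dots> = (\<Sum>k\<leftarrow>[1..<Suc ?n]. falling (?n - 1) (k - 1) * w k)"
      by (subst sum_list_distinct_conv_sum_set) (simp_all add: atLeastLessThanSuc_atLeastAtMost del: upt_Suc)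
    also have "\<dots> = signed_count ?n L"
      unfolding signed_count.simps[of ?n L] using n by (simp add: w_def mult.assoc del: upt_Suc)
    finally show ?thesis .
  qed
qed

lemma card_fixed_graphs:
  assumes \<pi>: "\<pi> permutes S"
  shows "card {G \<in> graphs S. relabel \<pi> G = G} = cycle_weight \<pi> S []"
proof -
  have "bij_betw snd {G \<in> graphs S. relabel \<pi> G = G} (invariant_sets (image \<pi>) (pairs S))"
    by (rule bij_betw_byWitness[where f' = "Pair S"])
      (auto simp: graphs_def relabel_def invariant_sets_def pairs_def permutes_image[OF \<pi>] permutes_in_image[OF \<pi>])
  then have "card {G \<in> graphs S. relabel \<pi> G = G} = card (invariant_sets (image \<pi>) (pairs S))"
    by (rule bij_betw_same_card)
  then show ?thesis by (simp add: cycle_weight_def)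
qed

text \<open>For \<open>L = []\<close> the cycle weight is the number of fixed graphs, so the signed orbit count applies.\<close>

theorem count_even_graph_classes:
  "int (fact p * card (even_graphs p // iso_rel p)) = signed_count p []"
proof -
  have "int (fact p * card (even_graphs p // iso_rel p)) =
    (\<Sum>\<pi> | \<pi> permutes {..<p}. sign \<pi> * int (card {G \<in> graphs {..<p}. relabel \<pi> G = G}))"
    by (rule signed_burnside[symmetric])
  also have "\<dots> = (\<Sum>\<pi> | \<pi> permutes {..<p}. sign \<pi> * int (cycle_weight \<pi> {..<p} []))"
    by (rule sum.cong) (simp_all add: card_fixed_graphs)
  also have "\<dots> = signed_count p []" using sum_sign_cycle_weight[of "{..<p}" "[]"] by simp
  finally show ?thesis .
qed

lemma signed_count_values:
  "map (\<lambda>p. signed_count p []) [0..<10] =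
    [1, 1, 0, 0, 24, 120 * 6, 720 * 28, 5040 * 252, 40320 * 4726, 362880 * 150324]"
  by code_simp

lemma no_odd_aut_values:
  "map (\<lambda>p. card (no_odd_aut_classes p :: 'a::infinite graph set set)) [0..<10] =
     [1, 1, 0, 0, 1, 6, 28, 252, 4726, 150324]"
proof -
  let ?q = "\<lambda>p. card (even_graphs p // iso_rel p)"
  let ?v = "[1, 1, 0, 0, 1, 6, 28, 252, 4726, 150324] :: nat list"
  have "?q p = ?v ! p" if p: "p < 10" for p
  proof -
    have "signed_count p [] = map (\<lambda>p. signed_count p []) [0..<10] ! p" using p by simp
    also have "\<dots> = int (fact p * ?v ! p)"
    proof -
      have "p \<in> {0, 1, 2, 3, 4, 5, 6, 7, 8, 9}" using p by auto
      then show ?thesis unfolding signed_count_values by (elim insertE) (simp_all add: fact_numeral)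
    qed
    finally have "int (fact p * ?q p) = int (fact p * ?v ! p)"
      using count_even_graph_classes[of p] by simp
    then have "fact p * ?q p = fact p * ?v ! p" unfolding of_nat_eq_iff .
    then show ?thesis by simp
  qed
  then show ?thesis
    unfolding card_no_odd_aut_classes by (intro nth_equalityI) simp_all
qed

theorem proposition3p9:
  shows "(\<forall>p.
            vectorspace.fin_dim class_ring
              (cohomology (Gr :: ('a::infinite, 'k::field_char_0, 'a graph \<Rightarrow> 'k) bicomodule) p) \<and>
            vectorspace.dim class_ring
              (cohomology (Gr :: ('a, 'k, 'a graph \<Rightarrow> 'k) bicomodule) p) =
            card (no_odd_aut_classes p :: 'a graph set set)) \<and>
         map (\<lambda>p. card (no_odd_aut_classes p :: 'a graph set set)) [0..<10] =
           [1, 1, 0, 0, 1, 6, 28, 252, 4726, 150324]"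
  using dim_cohomology_Gr no_odd_aut_values unfolding card_no_odd_aut_classes by blast

end
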